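(* Let $m\ge 2$ and let $K \subset \mathbb{R}^m$ be a convex body with $C^2$-class boundary that contains all of its centres of curvature. Then $$I(K) \le \mathrm{vol}(K-K) \qquad\text{and}\qquad n(K) \le \binom{2m}{m}.$$
   Context: A convex body in $\mathbb{R}^m$ is a compact convex set with nonempty interior; $\mathrm{bd}\,K$ denotes its boundary, $\mathrm{vol}$ denotes $m$-dimensional Lebesgue measure, and $K-K=\{x-y : x,y\in K\}$. For a convex body $K$ and $q \in \mathrm{bd}\,K$, a line starting at $q$ and perpendicular to a supporting hyperplane of $K$ at $q$ is called a normal of $K$ at $q$. For $p \in K$, $n(K,p)$ denotes the number of normals of $K$ passing through $p$; normals are counted according to their starting points, so a line that is a normal at both of its boundary points is counted twice. Set $$I(K) = \int_{K} n(K,p)\, dp, \qquad n(K) = \frac{I(K)}{\mathrm{vol}(K)}.$$ If $\mathrm{bd}\,K$ is of class $C^2$, the centres of curvature of $K$ at $q\in \mathrm{bd}\,K$ are the points $q + \rho N(q)$, where $N(q)$ is the inner unit normal at $q$ and $\rho = 1/\kappa$ runs over the principal radii of curvature at $q$ ($\kappa$ a nonzero principal curvature of $\mathrm{bd}\,K$ at $q$). *)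

theory Defs
  imports "HOL-Analysis.Analysis"
begin

definition convex_body :: "(real^'n) set \<Rightarrow> bool" where
  "convex_body K \<longleftrightarrow> compact K \<and> convex K \<and> interior K \<noteq> {}"

text \<open>For \<open>u \<noteq> 0\<close>, the hyperplane \<open>{x. u \<bullet> x = u \<bullet> q}\<close> supports \<open>K\<close> at \<open>q \<in> K\<close> iff
  \<open>K\<close> lies on one side of it, which up to the sign of \<open>u\<close> is the inequality below.\<close>

definition is_normal_at :: "(real^'n) set \<Rightarrow> real^'n \<Rightarrow> (real^'n) set \<Rightarrow> bool" where
  "is_normal_at K q L \<longleftrightarrow> q \<in> frontier K \<and>
     (\<exists>u. u \<noteq> 0 \<and> (\<forall>x\<in>K. u \<bullet> x \<le> u \<bullet> q) \<and> L = range (\<lambda>t. q + t *\<^sub>R u))"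

text \<open>Normals are counted together with their starting point, so a line normal at both of its
  boundary points contributes two pairs. The value is \<open>\<infinity>\<close> if there are infinitely many.\<close>

definition normal_count :: "(real^'n) set \<Rightarrow> real^'n \<Rightarrow> ennreal" where
  "normal_count K p = emeasure (count_space UNIV) {(q, L). is_normal_at K q L \<and> p \<in> L}"

text \<open>For a convex body with \<open>C\<^sup>2\<close> boundary, \<open>normal_count K\<close> is Borel measurable on \<open>K\<close>: it counts
  the fibres of a compact relation. So this is a genuine integral and not only a lower one.\<close>

definition normal_integral :: "(real^'n) set \<Rightarrow> ennreal" where
  "normal_integral K = (\<integral>\<^sup>+ p \<in> K. normal_count K p \<partial>lebesgue)"

definition mean_normal_count :: "(real^'n) set \<Rightarrow> ennreal" where
  "mean_normal_count K = normal_integral K / emeasure lebesgue K"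

definition difference_body :: "(real^'n) set \<Rightarrow> (real^'n) set" where
  "difference_body K = {x - y | x y. x \<in> K \<and> y \<in> K}"

text \<open>\<open>g\<close> is the gradient and \<open>H\<close> the Hessian matrix of \<open>f\<close>.\<close>

definition C2_function_on :: "(real^'n) set \<Rightarrow> (real^'n \<Rightarrow> real) \<Rightarrow> (real^'n \<Rightarrow> real^'n) \<Rightarrow> bool" where
  "C2_function_on U f g \<longleftrightarrow> (\<exists>H :: real^'n \<Rightarrow> real^'n^'n.
     (\<forall>x\<in>U. (f has_derivative (\<lambda>h. g x \<bullet> h)) (at x)) \<and>
     (\<forall>x\<in>U. (g has_derivative (\<lambda>h. H x *v h)) (at x)) \<and>
     continuous_on U H)"

text \<open>The boundary is an embedded hypersurface of class \<open>C\<^sup>2\<close>: locally a regular level set.\<close>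

definition C2_boundary :: "(real^'n) set \<Rightarrow> bool" where
  "C2_boundary K \<longleftrightarrow> (\<forall>q\<in>frontier K. \<exists>U f g. open U \<and> q \<in> U \<and> C2_function_on U f g \<and>
     (\<forall>x\<in>U. g x \<noteq> 0) \<and> frontier K \<inter> U = {x\<in>U. f x = 0})"

text \<open>Well defined whenever the supporting hyperplane at \<open>q\<close> is unique, as for a convex body with
  \<open>C\<^sup>2\<close> boundary.\<close>

definition inner_unit_normal :: "(real^'n) set \<Rightarrow> real^'n \<Rightarrow> real^'n" where
  "inner_unit_normal K q = (THE u. norm u = 1 \<and> (\<forall>x\<in>K. u \<bullet> q \<le> u \<bullet> x))"

text \<open>The principal curvatures are the eigenvalues of the Weingarten map, minus the differential of
  the inner unit normal field, on the tangent space of the boundary at \<open>q\<close>; this sign makes them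
  \<open>1 / r\<close> for a ball of radius \<open>r\<close>. Differentiating within the frontier determines \<open>D\<close> exactly on
  the tangent space, so the choice of \<open>D\<close> off it is irrelevant.\<close>

definition principal_curvature_at :: "(real^'n) set \<Rightarrow> real^'n \<Rightarrow> real \<Rightarrow> bool" where
  "principal_curvature_at K q \<kappa> \<longleftrightarrow>
     (\<exists>D. (inner_unit_normal K has_derivative D) (at q within frontier K) \<and>
        (\<exists>v. v \<noteq> 0 \<and> v \<bullet> inner_unit_normal K q = 0 \<and> - D v = \<kappa> *\<^sub>R v))"

definition centres_of_curvature :: "(real^'n) set \<Rightarrow> (real^'n) set" where
  "centres_of_curvature K = {q + (1 / \<kappa>) *\<^sub>R inner_unit_normal K q | q \<kappa>.
     q \<in> frontier K \<and> principal_curvature_at K q \<kappa> \<and> \<kappa> \<noteq> 0}"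

end

theory Submission imports Defs begin

text \<open>Write \<open>m\<close> for the dimension. The normals are parametrised by vectors instead of boundary points.
For \<open>v \<noteq> 0\<close> let \<open>foot v\<close> be the point of \<open>K\<close> at which \<open>v \<bullet> x\<close> is least, so that \<open>v\<close> is an inner normal
vector there. A normal through an interior point \<open>p\<close> that starts at \<open>q\<close> is the same thing as a
vector \<open>v = p - q\<close> with \<open>foot v = q\<close>. Hence \<open>n(K, p)\<close> counts the solutions of \<open>foot v + v = p\<close> in the set
\<open>S\<close> of all \<open>v \<noteq> 0\<close> with \<open>foot v + v \<in> K\<close> (lemma \<open>normal_count_le\<close>), and the area inequality
(\<open>nn_integral_multiplicity_le\<close>) gives \<open>I(K) \<le> \<integral>\<^sub>S \<bar>det (D foot + id)\<bar>\<close>. Moreover \<open>S \<subseteq> K - K\<close>, because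
\<open>v = (foot v + v) - foot v\<close>. It remains to see that the integral is at most the volume of \<open>S\<close>.

This holds on every ray separately. The map \<open>foot\<close> is the gradient of \<open>v \<bullet> foot v\<close>, so its
derivative at \<open>v\<close> is self-adjoint; it vanishes on \<open>v\<close>, and it is homogeneous of degree \<open>-1\<close> in \<open>v\<close>.
Its other eigenvalues are \<open>-\<rho>\<^sub>i\<close>, where the points \<open>foot v + \<rho>\<^sub>i v\<close> are the centres of curvature at \<open>foot v\<close>. So
\<open>t\<^sup>m\<^sup>-\<^sup>1 \<bar>det (D foot + id)\<bar>\<close> at \<open>t v\<close> is the product of the \<open>m - 1\<close> numbers \<open>\<bar>t - \<rho>\<^sub>i\<bar>\<close>. The ray meets \<open>S\<close> for
\<open>0 < t \<le> l\<close>, and the hypothesis on the centres of curvature gives \<open>0 \<le> \<rho>\<^sub>i \<le> l\<close>. By the inequality of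
arithmetic and geometric means it suffices to compare \<open>\<bar>t - \<rho>\<bar>\<^sup>m\<^sup>-\<^sup>1\<close> with \<open>t\<^sup>m\<^sup>-\<^sup>1\<close> for a single \<open>\<rho>\<close>, and
\<open>\<rho>\<^sup>m + (l - \<rho>)\<^sup>m \<le> l\<^sup>m\<close> (\<open>normal_jacobian_ray_le\<close>, \<open>nn_integral_le_by_rays\<close>).

All of this needs \<open>foot\<close> to be single-valued and differentiable, that is, no principal curvature may
vanish. The hypothesis does not mention vanishing curvatures, but it excludes them: the nonzero
principal curvatures are at least the reciprocal of the diameter of \<open>K\<close>, so by continuity of the determinant
the set of points with a vanishing principal curvature is open and closed in the boundary. The boundary is
connected since \<open>m \<ge> 2\<close>, and at a point farthest from the origin all curvatures are positive
(\<open>not_flat\<close>).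

The bound for \<open>n(K)\<close> follows from the bound for \<open>I(K)\<close> and the inequality of Rogers and Shephard.\<close>

section \<open>Self-adjoint linear maps\<close>

text \<open>The quadratic form \<open>x \<bullet> A x\<close> has a maximiser \<open>e\<close> on the unit sphere of \<open>V\<close>. Moving \<open>e\<close> in the direction
\<open>w = A e - c e\<close>, which is orthogonal to \<open>e\<close>, changes the form by \<open>2 t (w \<bullet> w)\<close> to first order, so \<open>w = 0\<close>.\<close>

lemma selfadjoint_eigenvector:
  fixes A :: "'a::euclidean_space \<Rightarrow> 'a"
  assumes lin: "linear A" and sym: "\<And>x y. A x \<bullet> y = x \<bullet> A y"
    and V: "subspace V" and inv: "A ` V \<subseteq> V" and nz: "V \<noteq> {0}"
  obtains e c where "e \<in> V" "norm e = 1" "A e = c *\<^sub>R e"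
proof -
  let ?S = "V \<inter> sphere 0 1"
  obtain y where y: "y \<in> V" "y \<noteq> 0"
    using nz V subspace_0 by blast
  have "y /\<^sub>R norm y \<in> ?S"
    using y V by (simp add: subspace_scale)
  moreover have "compact ?S"
    by (simp add: closed_subspace V closed_Int_compact)
  moreover have "continuous_on ?S (\<lambda>x. x \<bullet> A x)"
    using lin by (intro continuous_intros linear_continuous_on) (simp add: linear_linear)
  ultimately obtain e where e: "e \<in> ?S" and max: "\<And>x. x \<in> ?S \<Longrightarrow> x \<bullet> A x \<le> e \<bullet> A e"
    using continuous_attains_sup[of ?S "\<lambda>x. x \<bullet> A x"] by blast
  define c where "c = e \<bullet> A e"
  define w where "w = A e - c *\<^sub>R e"
  have ee: "e \<bullet> e = 1" using e by (simp add: dot_square_norm)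
  have eV: "e \<in> V" using e by simp
  have wV: "w \<in> V"
    unfolding w_def using eV inv V by (intro subspace_diff subspace_scale) auto
  have bound: "x \<bullet> A x \<le> c * (x \<bullet> x)" if "x \<in> V" for x
  proof (cases "x = 0")
    case True then show ?thesis by simp
  next
    case False
    have "x /\<^sub>R norm x \<in> ?S" using that False V by (simp add: subspace_scale)
    from max[OF this] have "(x \<bullet> A x) / (norm x)^2 \<le> c"
      using lin by (simp add: c_def linear_scale power2_eq_square field_simps)
    then show ?thesis using False by (simp add: dot_square_norm divide_le_eq)
  qed
  have we: "w \<bullet> e = 0"
    by (simp add: w_def inner_diff_left c_def ee inner_commute[of "A e"])
  have wAe: "w \<bullet> A e = w \<bullet> w"
    using we by (simp add: w_def inner_diff_right inner_diff_left)
  define b where "b = \<bar>c * (w \<bullet> w) - w \<bullet> A w\<bar> + 1"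
  have quad: "2 * t * (w \<bullet> w) \<le> t^2 * (c * (w \<bullet> w) - w \<bullet> A w)" for t
  proof -
    have "(e + t *\<^sub>R w) \<bullet> A (e + t *\<^sub>R w) \<le> c * ((e + t *\<^sub>R w) \<bullet> (e + t *\<^sub>R w))"
      using eV wV V by (intro bound subspace_add subspace_scale)
    moreover have "e \<bullet> A w = w \<bullet> w"
      using wAe sym[of e w] by (simp add: inner_commute)
    ultimately show ?thesis
      using lin we wAe ee
      by (simp add: linear_add linear_scale inner_add_left inner_add_right c_def
          power2_eq_square algebra_simps inner_commute)
  qed
  have "w \<bullet> w = 0"
  proof (rule ccontr)
    assume "w \<bullet> w \<noteq> 0"
    then have pos: "w \<bullet> w > 0" by simp
    have b: "b > 0" "c * (w \<bullet> w) - w \<bullet> A w < b" by (auto simp: b_def)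
    from quad[of "(w \<bullet> w) / b"] have "2 * (w \<bullet> w)^2 / b \<le> (w \<bullet> w)^2 / b * ((c * (w \<bullet> w) - w \<bullet> A w) / b)"
      by (simp add: power2_eq_square)
    also have "\<dots> \<le> (w \<bullet> w)^2 / b * 1"
      using b by (intro mult_left_mono) auto
    finally show False using pos b by (simp add: divide_simps)
  qed
  then have "A e = c *\<^sub>R e" by (simp add: w_def)
  with eV e that show ?thesis by simp
qed

text \<open>Split off one eigenvector; its orthogonal complement in \<open>V\<close> is again invariant, as \<open>A\<close> is self-adjoint.\<close>

lemma selfadjoint_eigenbasis_subspace:
  fixes A :: "'a::euclidean_space \<Rightarrow> 'a"
  assumes lin: "linear A" and sym: "\<And>x y. A x \<bullet> y = x \<bullet> A y"
  shows "subspace V \<Longrightarrow> A ` V \<subseteq> V \<Longrightarrow>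
    \<exists>B. B \<subseteq> V \<and> V \<subseteq> span B \<and> pairwise orthogonal B \<and> (\<forall>e\<in>B. norm e = 1 \<and> (\<exists>c. A e = c *\<^sub>R e))"
proof (induction "dim V" arbitrary: V rule: less_induct)
  case less
  show ?case
  proof (cases "V = {0}")
    case True
    then show ?thesis by (intro exI[of _ "{}"]) auto
  next
    case False
    obtain e c where e: "e \<in> V" "norm e = 1" "A e = c *\<^sub>R e"
      using selfadjoint_eigenvector[OF lin sym less.prems False] by blast
    define W where "W = V \<inter> {x. e \<bullet> x = 0}"
    have W: "subspace W"
      unfolding W_def using less.prems by (intro subspace_inter subspace_hyperplane)
    have "e \<notin> W" using e by (auto simp: W_def dot_square_norm)
    then have "W \<subset> V" using e(1) unfolding W_def by blast
    then have "dim W < dim V"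
      using W less.prems(1) by (metis dim_psubset span_eq_iff)
    moreover have "A ` W \<subseteq> W"
    proof safe
      fix x assume "x \<in> W"
      moreover have "e \<bullet> A x = c * (e \<bullet> x)" using e sym[of e x] by simp
      ultimately show "A x \<in> W" using less.prems by (auto simp: W_def)
    qed
    ultimately obtain B where B: "B \<subseteq> W" "W \<subseteq> span B" "pairwise orthogonal B"
        "\<forall>e\<in>B. norm e = 1 \<and> (\<exists>c. A e = c *\<^sub>R e)"
      using less.hyps[OF _ W] by blast
    have "V \<subseteq> span (insert e B)"
    proof
      fix x assume x: "x \<in> V"
      have "x - (e \<bullet> x) *\<^sub>R e \<in> W"
        using x e less.prems by (auto simp: W_def inner_diff_right dot_square_norm intro: subspace_diff subspace_scale)
      then have "x - (e \<bullet> x) *\<^sub>R e \<in> span (insert e B)"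
        using B span_mono[of B "insert e B"] by blast
      moreover have "(e \<bullet> x) *\<^sub>R e \<in> span (insert e B)"
        by (simp add: span_base span_scale)
      ultimately show "x \<in> span (insert e B)"
        using span_add by fastforce
    qed
    moreover have "pairwise orthogonal (insert e B)"
      using B by (auto simp: pairwise_insert orthogonal_def W_def inner_commute)
    ultimately show ?thesis
      using B e by (intro exI[of _ "insert e B"]) (auto simp: W_def)
  qed
qed

definition orthonormal_family :: "('i \<Rightarrow> 'a::real_inner) \<Rightarrow> bool" where
  "orthonormal_family e \<longleftrightarrow> (\<forall>i j. e i \<bullet> e j = (if i = j then 1 else 0))"

lemma selfadjoint_eigenbasis:
  fixes A :: "real^'n \<Rightarrow> real^'n"
  assumes lin: "linear A" and sym: "\<And>x y. A x \<bullet> y = x \<bullet> A y"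
  obtains e :: "'n \<Rightarrow> real^'n" and c where "orthonormal_family e" "\<And>i. A (e i) = c i *\<^sub>R e i"
proof -
  obtain B where B: "UNIV \<subseteq> span B" "pairwise orthogonal B"
      "\<And>e. e\<in>B \<Longrightarrow> norm e = 1" "\<And>e. e\<in>B \<Longrightarrow> (\<exists>c. A e = c *\<^sub>R e)"
    using selfadjoint_eigenbasis_subspace[OF lin sym, of UNIV] by auto
  have "0 \<notin> B" using B(3)[of 0] by auto
  then have ind: "independent B" using B by (simp add: pairwise_orthogonal_independent)
  have "card B = CARD('n)"
    using basis_card_eq_dim[of B UNIV] B ind by simp
  moreover have "finite B" using ind independent_imp_finite by blast
  ultimately obtain e where e: "bij_betw e (UNIV::'n set) B"
    using finite_same_card_bij[of "UNIV::'n set" B] by auto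
  have inB: "e i \<in> B" for i using e by (auto simp: bij_betw_def)
  obtain c where c: "\<And>i. A (e i) = c i *\<^sub>R e i"
    using B(4)[OF inB] by metis
  have "orthonormal_family e"
    unfolding orthonormal_family_def
  proof (intro allI)
    fix i j
    have "i \<noteq> j \<Longrightarrow> e i \<noteq> e j" using e by (auto simp: bij_betw_def inj_def)
    then show "e i \<bullet> e j = (if i = j then 1 else 0)"
      using B(2,3) inB by (auto simp: pairwise_def orthogonal_def dot_square_norm)
  qed
  then show ?thesis using that c by blast
qed

lemma det_orthonormal_eigenbasis:
  fixes L :: "real^'n \<Rightarrow> real^'n" and e :: "'n \<Rightarrow> real^'n"
  assumes lin: "linear L" and e: "orthonormal_family e" and c: "\<And>i. L (e i) = c i *\<^sub>R e i"
  shows "det (matrix L) = (\<Prod>i\<in>UNIV. c i)"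
proof -
  define Q :: "real^'n^'n" where "Q = (\<chi> i j. e j $ i)"
  define D :: "real^'n^'n" where "D = (\<chi> i j. if i = j then c i else 0)"
  have "transpose Q ** Q = mat 1"
    using e unfolding orthonormal_family_def
    by (simp add: Q_def matrix_matrix_mult_def transpose_def mat_def vec_eq_iff inner_vec_def)
  then have "det Q * det Q = 1"
    by (metis det_I det_mul det_transpose)
  then have Q: "det Q \<noteq> 0" by auto
  have "matrix L ** Q = Q ** D"
  proof -
    have "(matrix L ** Q) $ i $ j = (Q ** D) $ i $ j" for i j
    proof -
      have "(matrix L ** Q) $ i $ j = (matrix L *v e j) $ i"
        by (simp add: matrix_matrix_mult_def matrix_vector_mult_def Q_def)
      also have "\<dots> = c j * e j $ i"
        using lin by (simp add: matrix_works c)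
      also have "\<dots> = (Q ** D) $ i $ j"
        by (simp add: matrix_matrix_mult_def Q_def D_def if_distrib sum.delta mult.commute cong: if_cong)
      finally show ?thesis .
    qed
    then show ?thesis by (simp add: vec_eq_iff)
  qed
  then have "det (matrix L) * det Q = det Q * det D" by (metis det_mul)
  moreover have "det D = (\<Prod>i\<in>UNIV. c i)"
    unfolding D_def by (subst det_diagonal) auto
  ultimately show ?thesis using Q by simp
qed

section \<open>Jacobians and measures of differentiable images\<close>

text \<open>The estimate of the measure of an image by a Jacobian determinant is stated for coordinates that are indexed
by a well-ordered type. Numbering the elements of a finite type well-orders a copy of it.\<close>

typedef 'a ordered_copy = "UNIV :: 'a set" by simp

instance ordered_copy :: (finite) finite
proof
  have "range (Abs_ordered_copy :: 'a \<Rightarrow> _) = UNIV"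
    by (metis (no_types) Abs_ordered_copy_cases surj_def)
  then show "finite (UNIV :: 'a ordered_copy set)"
    by (metis finite finite_imageI)
qed

definition copy_rank :: "'a::finite ordered_copy \<Rightarrow> nat" where
  "copy_rank = (SOME f. inj f)"

lemma inj_copy_rank: "inj copy_rank"
proof -
  have "\<exists>f :: 'a ordered_copy \<Rightarrow> nat. inj f"
    using finite_imp_inj_to_nat_seg[OF finite[of "UNIV :: 'a ordered_copy set"]] by blast
  then show ?thesis unfolding copy_rank_def by (rule someI_ex)
qed

instantiation ordered_copy :: (finite) wellorder
begin

definition "x \<le> y \<longleftrightarrow> copy_rank x \<le> copy_rank y"
definition "x < y \<longleftrightarrow> copy_rank x < copy_rank y"

instance
proof
  fix P :: "'a ordered_copy \<Rightarrow> bool" and a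
  assume "\<And>x. (\<And>y. y < x \<Longrightarrow> P y) \<Longrightarrow> P x"
  then show "P a"
    unfolding less_ordered_copy_def by (rule measure_induct_rule[of copy_rank])
qed (use inj_copy_rank in \<open>auto simp: less_eq_ordered_copy_def less_ordered_copy_def inj_def\<close>)

end

definition reindex :: "('m \<Rightarrow> 'n) \<Rightarrow> real^'n \<Rightarrow> real^'m" where
  "reindex h x = (\<chi> i. x $ h i)"

lemma linear_reindex: "linear (reindex h)"
  by (rule linearI) (simp_all add: reindex_def vec_eq_iff)

lemma inner_reindex:
  assumes "bij h" shows "reindex h x \<bullet> reindex h y = x \<bullet> y"
  using sum.reindex_bij_betw[of h UNIV UNIV "\<lambda>i. x $ i * y $ i"] assms
  by (simp add: inner_vec_def reindex_def)

lemma prod_Basis_cart: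
  fixes x :: "real^'n"
  shows "(\<Prod>b\<in>Basis. x \<bullet> b) = (\<Prod>i\<in>UNIV. x $ i)"
proof -
  have B: "Basis = (\<lambda>i. axis i (1::real) :: real^'n) ` UNIV"
    by (auto simp: Basis_vec_def)
  have inj: "inj (\<lambda>i. axis i (1::real) :: real^'n)"
    by (simp add: inj_def axis_eq_axis)
  show ?thesis
    unfolding B prod.reindex[OF inj] by (simp add: inner_axis)
qed

lemma measurable_reindex [measurable]:
  "reindex (h :: 'm::finite \<Rightarrow> 'n::finite) \<in> borel \<rightarrow>\<^sub>M borel"
  by (intro borel_measurable_continuous_onI linear_continuous_on)
    (use linear_reindex linear_linear in blast)

text \<open>Renaming the coordinates maps boxes to boxes with the same side lengths.\<close>

lemma distr_lborel_reindex:
  fixes h :: "'m::finite \<Rightarrow> 'n::finite"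
  assumes h: "bij h"
  shows "distr lborel borel (reindex h) = lborel"
proof (rule lborel_eqI[symmetric])
  fix l u :: "real^'m" assume le: "\<And>b. b \<in> Basis \<Longrightarrow> l \<bullet> b \<le> u \<bullet> b"
  have le': "l $ i \<le> u $ i" for i
    using le[of "axis i 1"] by (simp add: inner_axis)
  let ?g = "reindex (inv h) :: real^'m \<Rightarrow> real^'n"
  have vim: "reindex h -` box l u = box (?g l) (?g u)"
    using h by (auto simp: reindex_def mem_box_cart bij_inv_eq_iff)
      (metis bij_inv_eq_iff)+
  have "emeasure (distr lborel borel (reindex h)) (box l u) = emeasure lborel (box (?g l) (?g u))"
    by (simp add: emeasure_distr vim)
  also have "\<dots> = ennreal (\<Prod>b\<in>Basis. (?g u - ?g l) \<bullet> b)"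
    using le' by (subst emeasure_lborel_box) (auto simp: Basis_vec_def inner_axis reindex_def)
  also have "(\<Prod>b\<in>Basis. (?g u - ?g l) \<bullet> b) = (\<Prod>i\<in>UNIV. u $ inv h i - l $ inv h i)"
    by (subst prod_Basis_cart) (simp add: reindex_def)
  also have "\<dots> = (\<Prod>i\<in>UNIV. u $ i - l $ i)"
    using prod.reindex_bij_betw[of "inv h" UNIV UNIV "\<lambda>i. u $ i - l $ i"] h
    by (simp add: bij_imp_bij_inv)
  also have "\<dots> = (\<Prod>b\<in>Basis. (u - l) \<bullet> b)"
    by (subst prod_Basis_cart) simp
  finally show "emeasure (distr lborel borel (reindex h)) (box l u) = (\<Prod>b\<in>Basis. (u - l) \<bullet> b)" .
qed simp

lemma
  fixes h :: "'m::finite \<Rightarrow> 'n::finite"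
  assumes h: "bij h"
  shows measurable_lebesgue_reindex: "reindex h \<in> lebesgue \<rightarrow>\<^sub>M lebesgue"
    and distr_lebesgue_reindex: "distr lebesgue lebesgue (reindex h) = lebesgue"
proof -
  have m: "reindex h \<in> lebesgue \<rightarrow>\<^sub>M lborel"
    by (simp add: measurable_completion)
  have d: "distr lebesgue lborel (reindex h) = lborel"
    using distr_lborel_reindex[OF h] by (subst distr_completion) (simp_all cong: distr_cong)
  show "reindex h \<in> lebesgue \<rightarrow>\<^sub>M lebesgue"
    by (rule completion.measurable_completion2[OF m]) (simp add: d)
  show "distr lebesgue lebesgue (reindex h) = lebesgue"
    using completion.completion_distr_eq[OF m] by (simp add: d)
qed

lemma emeasure_differentiable_image_ordered:
  fixes f :: "real^'n::{finite,wellorder} \<Rightarrow> real^'n::_"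
  assumes S: "S \<in> sets borel"
    and deriv: "\<And>x. x \<in> S \<Longrightarrow> (f has_derivative f' x) (at x within S)"
    and meas: "(\<lambda>x. \<bar>det (matrix (f' x))\<bar> * indicator S x) \<in> borel_measurable borel"
    and fin: "(\<integral>\<^sup>+x. ennreal \<bar>det (matrix (f' x))\<bar> * indicator S x \<partial>lborel) < \<infinity>"
  shows "f ` S \<in> sets lebesgue"
    and "emeasure lebesgue (f ` S) \<le> (\<integral>\<^sup>+x. ennreal \<bar>det (matrix (f' x))\<bar> * indicator S x \<partial>lborel)"
proof -
  let ?g = "\<lambda>x. \<bar>det (matrix (f' x))\<bar> * indicator S x"
  let ?J = "\<lambda>x. \<bar>det (matrix (f' x))\<bar>"
  have eq: "ennreal (?g x) = ennreal (?J x) * indicator S x" for x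
    by (simp add: indicator_def)
  obtain r where r: "0 \<le> r" "(\<integral>\<^sup>+x. ennreal (?g x) \<partial>lborel) = ennreal r"
    using fin unfolding eq[symmetric]
    by (cases "\<integral>\<^sup>+x. ennreal (?g x) \<partial>lborel" rule: ennreal_cases) auto
  have "(?g has_integral r) UNIV"
    using meas r by (intro nn_integral_has_integral) auto
  moreover have "?g = (\<lambda>x. if x \<in> S then ?J x else 0)"
    by (auto simp: indicator_def)
  ultimately have I: "(?J has_integral r) S"
    using has_integral_restrict_UNIV[of S ?J r] by simp
  have Sl: "S \<in> sets lebesgue" using S by auto
  note * = measurable_differentiable_image[OF Sl deriv] measure_differentiable_image[OF Sl deriv]
  have L: "f ` S \<in> lmeasurable"
    using *(1) I has_integral_integrable by blast
  then show "f ` S \<in> sets lebesgue" by auto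
  have "measure lebesgue (f ` S) \<le> r"
    using *(2) I has_integral_integrable integral_unique by metis
  then show "emeasure lebesgue (f ` S) \<le> (\<integral>\<^sup>+x. ennreal \<bar>det (matrix (f' x))\<bar> * indicator S x \<partial>lborel)"
    using r L eq by (simp add: emeasure_eq_measure2 ennreal_leI)
qed

abbreviation to_copy :: "real^'n \<Rightarrow> real^('n ordered_copy)" where
  "to_copy \<equiv> reindex Rep_ordered_copy"
abbreviation of_copy :: "real^('n ordered_copy) \<Rightarrow> real^'n" where
  "of_copy \<equiv> reindex Abs_ordered_copy"

lemma bij_Rep_ordered_copy: "bij Rep_ordered_copy"
  by (metis Abs_ordered_copy_inverse Rep_ordered_copy_inverse UNIV_I bijI')

lemma bij_Abs_ordered_copy: "bij Abs_ordered_copy"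
  by (metis Abs_ordered_copy_inverse Rep_ordered_copy_inverse UNIV_I bijI')

lemma of_copy_to_copy [simp]: "of_copy (to_copy x) = x" "to_copy (of_copy y) = y"
  by (simp_all add: reindex_def Abs_ordered_copy_inverse Rep_ordered_copy_inverse)

text \<open>The absolute value of the determinant, computed in the ordered copy of the coordinates.\<close>

definition jacobian :: "(real^'n \<Rightarrow> real^'n) \<Rightarrow> real" where
  "jacobian L = \<bar>det (matrix (to_copy \<circ> L \<circ> of_copy))\<bar>"

lemma jacobian_entries:
  "jacobian L = \<bar>det (\<chi> i j. L (axis (Rep_ordered_copy j) 1) $ Rep_ordered_copy i)\<bar>"
proof -
  have "of_copy (axis j 1) = axis (Rep_ordered_copy j) 1" for j :: "'a ordered_copy"
    by (auto simp: reindex_def axis_def vec_eq_iff Abs_ordered_copy_inverse Rep_ordered_copy_inverse)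
  then show ?thesis
    by (simp add: jacobian_def matrix_def) (simp add: reindex_def)
qed

lemma jacobian_orthonormal_eigenbasis:
  fixes L :: "real^'n \<Rightarrow> real^'n" and e :: "'n \<Rightarrow> real^'n"
  assumes lin: "linear L" and e: "orthonormal_family e" and c: "\<And>i. L (e i) = c i *\<^sub>R e i"
  shows "jacobian L = (\<Prod>i\<in>UNIV. \<bar>c i\<bar>)"
proof -
  have "det (matrix (to_copy \<circ> L \<circ> of_copy)) = (\<Prod>i\<in>UNIV. c (Rep_ordered_copy i))"
  proof (rule det_orthonormal_eigenbasis)
    show "linear (to_copy \<circ> L \<circ> of_copy)"
      by (intro linear_compose linear_reindex lin)
    show "orthonormal_family (\<lambda>i. to_copy (e (Rep_ordered_copy i)))"
      using e unfolding orthonormal_family_def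
      by (simp add: inner_reindex bij_Rep_ordered_copy Rep_ordered_copy_inject)
    show "(to_copy \<circ> L \<circ> of_copy) (to_copy (e (Rep_ordered_copy i))) =
        c (Rep_ordered_copy i) *\<^sub>R to_copy (e (Rep_ordered_copy i))" for i
      by (simp add: c linear_scale linear_reindex)
  qed
  also have "\<dots> = (\<Prod>i\<in>UNIV. c i)"
    using prod.reindex_bij_betw[of Rep_ordered_copy UNIV UNIV c] bij_Rep_ordered_copy by simp
  finally show ?thesis by (simp add: jacobian_def abs_prod)
qed

text \<open>The renaming of coordinates preserves Lebesgue measure, so the estimate carries over from ordered indices.\<close>

lemma emeasure_differentiable_image_le:
  fixes f :: "real^'n \<Rightarrow> real^'n"
  assumes S: "S \<in> sets borel"
    and deriv: "\<And>x. x \<in> S \<Longrightarrow> (f has_derivative f' x) (at x within S)"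
    and meas [measurable]: "(\<lambda>x. jacobian (f' x) * indicator S x) \<in> borel_measurable borel"
    and fin: "(\<integral>\<^sup>+x. ennreal (jacobian (f' x)) * indicator S x \<partial>lborel) < \<infinity>"
  shows "f ` S \<in> sets lebesgue"
    and "emeasure lebesgue (f ` S) \<le> (\<integral>\<^sup>+x. ennreal (jacobian (f' x)) * indicator S x \<partial>lborel)"
proof -
  define T :: "(real^('n ordered_copy)) set" where "T = of_copy -` S"
  define g where "g = to_copy \<circ> f \<circ> of_copy"
  define g' where "g' = (\<lambda>y. to_copy \<circ> f' (of_copy y) \<circ> of_copy)"
  have T: "T \<in> sets borel"
    unfolding T_def using S measurable_reindex by (metis measurable_sets_borel)
  have oc: "of_copy ` T = S"
    by (auto simp: T_def image_iff intro!: exI[of _ "to_copy _"])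
  have dg: "(g has_derivative g' y) (at y within T)" if "y \<in> T" for y
  proof -
    have y: "of_copy y \<in> S" using that by (simp add: T_def)
    have lin: "bounded_linear (reindex h)" for h :: "'i::finite \<Rightarrow> 'j::finite"
      using linear_reindex linear_linear by blast
    have "(f \<circ> of_copy has_derivative f' (of_copy y) \<circ> of_copy) (at y within T)"
      using deriv[OF y] oc by (intro diff_chain_within bounded_linear.has_derivative[OF lin] has_derivative_ident)
        (auto simp: id_def)
    then show ?thesis
      unfolding g_def g'_def using bounded_linear.has_derivative[OF lin] by (fastforce simp: o_def)
  qed
  have J: "\<bar>det (matrix (g' y))\<bar> = jacobian (f' (of_copy y))" for y
    by (simp add: jacobian_def g'_def)
  have ind: "indicator T y = (indicator S (of_copy y) :: 'z::zero_neq_one)" for y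
    by (simp add: T_def indicator_def)
  have m: "(\<lambda>y. \<bar>det (matrix (g' y))\<bar> * indicator T y) \<in> borel_measurable borel"
    using measurable_compose[OF measurable_reindex meas] by (simp add: J ind)
  have mm: "(\<lambda>x. ennreal (jacobian (f' x)) * indicator S x) \<in> borel_measurable borel"
  proof -
    have "(\<lambda>x. ennreal (jacobian (f' x)) * indicator S x) = (\<lambda>x. ennreal (jacobian (f' x) * indicator S x))"
      by (auto simp: indicator_def)
    then show ?thesis by simp
  qed
  have int: "(\<integral>\<^sup>+y. ennreal \<bar>det (matrix (g' y))\<bar> * indicator T y \<partial>lborel) =
      (\<integral>\<^sup>+x. ennreal (jacobian (f' x)) * indicator S x \<partial>lborel)"
  proof -
    have "(\<integral>\<^sup>+x. ennreal (jacobian (f' x)) * indicator S x \<partial>lborel) =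
      (\<integral>\<^sup>+x. ennreal (jacobian (f' x)) * indicator S x \<partial>distr lborel borel of_copy)"
      by (simp add: distr_lborel_reindex bij_Abs_ordered_copy)
    also have "\<dots> = (\<integral>\<^sup>+y. ennreal \<bar>det (matrix (g' y))\<bar> * indicator T y \<partial>lborel)"
      by (subst nn_integral_distr) (simp_all add: mm J ind)
    finally show ?thesis by simp
  qed
  note image = emeasure_differentiable_image_ordered[OF T dg m, unfolded int, OF _ fin]
  have gT: "g ` T = to_copy ` f ` S"
    by (simp add: g_def oc[symmetric] image_comp o_def)
  have fS: "f ` S = to_copy -` (g ` T)"
    unfolding gT by (auto simp: image_iff) (metis of_copy_to_copy(1))
  show "f ` S \<in> sets lebesgue"
    using measurable_sets[OF measurable_lebesgue_reindex[OF bij_Rep_ordered_copy] image(1)]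
    by (simp add: fS)
  have "emeasure lebesgue (f ` S) = emeasure (distr lebesgue lebesgue to_copy) (g ` T)"
    using image(1) by (subst emeasure_distr) (auto simp: fS measurable_lebesgue_reindex bij_Rep_ordered_copy)
  also have "\<dots> = emeasure lebesgue (g ` T)"
    by (simp add: distr_lebesgue_reindex bij_Rep_ordered_copy)
  finally show "emeasure lebesgue (f ` S) \<le> (\<integral>\<^sup>+x. ennreal (jacobian (f' x)) * indicator S x \<partial>lborel)"
    using image(2) by simp
qed

section \<open>The area inequality with multiplicities\<close>

text \<open>The code of level \<open>k\<close> of a point records which of the first \<open>k\<close> sets contain it. The points with a common code
form an atom; there are at most \<open>2\<^sup>k\<close> atoms of level \<open>k\<close>, and they shrink as \<open>k\<close> grows.\<close>

definition base_code :: "(nat \<Rightarrow> 'a set) \<Rightarrow> nat \<Rightarrow> 'a \<Rightarrow> nat set" where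
  "base_code B k x = {i. i < k \<and> x \<in> B i}"

text \<open>Any finitely many points have distinct codes at some level, because only finitely many pairs have to be separated.\<close>

lemma emeasure_count_space_le_SUP_card:
  assumes sep: "\<And>x y :: 'a. x \<noteq> y \<Longrightarrow> \<exists>i. x \<in> B i \<and> y \<notin> B i"
  shows "emeasure (count_space UNIV) X \<le> (SUP k. of_nat (card (base_code B k ` X)))"
    (is "_ \<le> ?R")
proof -
  have fin: "finite (base_code B k ` Z)" for k Z
    by (rule finite_subset[of _ "Pow {..<k}"]) (auto simp: base_code_def)
  have finite_le: "of_nat (card Y) \<le> ?R" if Y: "finite Y" "Y \<subseteq> X" for Y
  proof -
    define sepi where "sepi = (\<lambda>(x, y). SOME i. x \<in> B i \<and> y \<notin> B i)"
    have sepi: "x \<in> B (sepi (x, y)) \<and> y \<notin> B (sepi (x, y))" if "x \<noteq> y" for x y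
      using someI_ex[OF sep[OF that]] by (simp add: sepi_def)
    define k where "k = Suc (Max (insert 0 (sepi ` (Y \<times> Y))))"
    have k: "sepi (x, y) < k" if "x \<in> Y" "y \<in> Y" for x y
      unfolding k_def less_Suc_eq_le using that Y by (intro Max_ge) auto
    have "inj_on (base_code B k) Y"
    proof (rule inj_onI, rule ccontr)
      fix x y assume *: "x \<in> Y" "y \<in> Y" "base_code B k x = base_code B k y" "x \<noteq> y"
      then have "sepi (x, y) \<in> base_code B k x" "sepi (x, y) \<notin> base_code B k y"
        using k[OF *(1,2)] sepi[OF *(4)] unfolding base_code_def by blast+
      with * show False by simp
    qed
    then have "card Y = card (base_code B k ` Y)" by (simp add: card_image)
    also have "\<dots> \<le> card (base_code B k ` X)" using Y fin by (intro card_mono) auto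
    finally have "(of_nat (card Y) :: ennreal) \<le> of_nat (card (base_code B k ` X))"
      by (simp add: of_nat_mono)
    then show ?thesis by (meson SUP_upper UNIV_I order_trans)
  qed
  show ?thesis
  proof (cases "finite X")
    case True then show ?thesis using finite_le[of X] by (simp add: emeasure_count_space)
  next
    case False
    have "of_nat n \<le> ?R" for n
    proof -
      obtain Y where "Y \<subseteq> X" "finite Y" "card Y = n"
        using infinite_arbitrarily_large[OF False] by blast
      then show ?thesis using finite_le by blast
    qed
    then have "?R = top"
      using SUP_least[of UNIV "of_nat :: nat \<Rightarrow> ennreal" ?R]
      by (simp add: ennreal_SUP_of_nat_eq_top top_unique)
    then show ?thesis by (metis top_greatest)
  qed
qed

lemma separating_open_sequence:
  obtains B :: "nat \<Rightarrow> 'a::euclidean_space set"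
  where "\<And>i. open (B i)" "\<And>x y. x \<noteq> y \<Longrightarrow> \<exists>i. x \<in> B i \<and> y \<notin> B i"
proof -
  have "\<exists>B :: nat \<Rightarrow> 'a set. (\<forall>n. open (B n)) \<and> (\<forall>S. open S \<longrightarrow> (\<exists>k. S = \<Union>{B n |n. n \<in> k}))"
    by (rule univ_second_countable_sequence) blast
  then obtain B :: "nat \<Rightarrow> 'a set" where
    B: "\<And>n. open (B n)" "\<And>S. open S \<Longrightarrow> \<exists>k. S = \<Union>{B n |n. n \<in> k}"
    by blast
  have "\<exists>i. x \<in> B i \<and> y \<notin> B i" if "x \<noteq> y" for x y
  proof -
    obtain k where "- {y} = \<Union>{B n |n. n \<in> k}" using B(2)[of "- {y}"] by auto
    then show ?thesis using that by blast
  qed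
  with B(1) that show ?thesis by blast
qed

text \<open>The area formula as an inequality. Cut \<open>S\<close> into the atoms of level \<open>k\<close> of a countable base. The number of atoms
whose image contains \<open>p\<close> increases with \<open>k\<close> to the number of preimages of \<open>p\<close>, while at every level its
integral is the sum of the measures of the images, hence at most the integral of the Jacobian.\<close>

lemma nn_integral_multiplicity_le:
  fixes f :: "real^'n \<Rightarrow> real^'n"
  assumes S [measurable]: "S \<in> sets borel"
    and deriv: "\<And>x. x \<in> S \<Longrightarrow> (f has_derivative f' x) (at x within S)"
    and meas [measurable]: "(\<lambda>x. jacobian (f' x) * indicator S x) \<in> borel_measurable borel"
    and fin: "(\<integral>\<^sup>+x. ennreal (jacobian (f' x)) * indicator S x \<partial>lborel) < \<infinity>"
  shows "(\<integral>\<^sup>+p. emeasure (count_space UNIV) {x\<in>S. f x = p} \<partial>lebesgue) \<le>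
    (\<integral>\<^sup>+x. ennreal (jacobian (f' x)) * indicator S x \<partial>lborel)" (is "_ \<le> ?I")
proof -
  obtain B :: "nat \<Rightarrow> (real^'n) set" where B: "\<And>i. open (B i)" "\<And>x y. x \<noteq> y \<Longrightarrow> \<exists>i. x \<in> B i \<and> y \<notin> B i"
    using separating_open_sequence by blast
  define atom where "atom = (\<lambda>k T. {x\<in>S. base_code B k x = T})"
  define N where "N = (\<lambda>k p. \<Sum>T\<in>Pow {..<k}. (indicator (f ` atom k T) p :: ennreal))"
  have atomS: "atom k T \<subseteq> S" for k T by (auto simp: atom_def)
  have atom_borel [measurable]: "atom k T \<in> sets borel" if "T \<subseteq> {..<k}" for k T
  proof -
    define C where "C = (\<lambda>i. if i \<in> T then B i else - B i)"
    have "atom k T = S \<inter> (\<Inter>i\<in>{..<k}. C i)"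
      using that by (auto simp: atom_def base_code_def C_def split: if_splits)
    moreover have C: "C i \<in> sets borel" for i
      using B(1)[of i] by (auto simp: C_def)
    have "(\<Inter>i\<in>{..<k}. C i) \<in> sets borel"
      by (cases "k = 0") (auto intro!: sets.finite_INT C)
    ultimately show ?thesis
      using S by (auto intro: sets.Int)
  qed
  \<comment> \<open>Every point of \<open>S\<close> lies in exactly one atom of each level.\<close>
  have split: "(\<Sum>T\<in>Pow {..<k}. (indicator (atom k T) x :: ennreal)) = indicator S x" for k x
  proof (cases "x \<in> S")
    case True
    have "(\<Sum>T\<in>Pow {..<k}. (indicator (atom k T) x :: ennreal)) = (\<Sum>T\<in>Pow {..<k}. if T = base_code B k x then 1 else 0)"
      using True by (intro sum.cong) (auto simp: atom_def indicator_def)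
    also have "\<dots> = 1"
      by (subst sum.delta) (auto simp: base_code_def)
    finally show ?thesis using True by simp
  next
    case False then show ?thesis by (simp add: indicator_def atom_def)
  qed
  have J: "(\<lambda>x. ennreal (jacobian (f' x)) * indicator (atom k T) x) \<in> borel_measurable borel"
    if "T \<subseteq> {..<k}" for k T
  proof -
    have "(\<lambda>x. ennreal (jacobian (f' x)) * indicator (atom k T) x) =
        (\<lambda>x. ennreal (jacobian (f' x) * indicator S x) * indicator (atom k T) x)"
      by (rule ext) (simp add: indicator_def atom_def)
    then show ?thesis using atom_borel[OF that] by simp
  qed
  have image: "f ` atom k T \<in> sets lebesgue \<and>
      emeasure lebesgue (f ` atom k T) \<le> (\<integral>\<^sup>+x. ennreal (jacobian (f' x)) * indicator (atom k T) x \<partial>lborel)"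
    if T: "T \<subseteq> {..<k}" for k T
  proof -
    have d: "(f has_derivative f' x) (at x within atom k T)" if "x \<in> atom k T" for x
      using has_derivative_subset[OF deriv atomS] that atomS by blast
    have m: "(\<lambda>x. jacobian (f' x) * indicator (atom k T) x) \<in> borel_measurable borel"
    proof -
      have "(\<lambda>x. jacobian (f' x) * indicator (atom k T) x) =
        (\<lambda>x. (jacobian (f' x) * indicator S x) * indicator (atom k T) x)"
        by (rule ext) (simp add: indicator_def atom_def)
      then show ?thesis using atom_borel[OF T] by simp
    qed
    have "(\<integral>\<^sup>+x. ennreal (jacobian (f' x)) * indicator (atom k T) x \<partial>lborel) \<le> ?I"
      by (intro nn_integral_mono) (simp add: indicator_def atom_def)
    then have "(\<integral>\<^sup>+x. ennreal (jacobian (f' x)) * indicator (atom k T) x \<partial>lborel) < \<infinity>"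
      using fin by (rule le_less_trans)
    from emeasure_differentiable_image_le[OF atom_borel[OF T] d m this] show ?thesis by blast
  qed
  have N_meas [measurable]: "N k \<in> borel_measurable lebesgue" for k
    unfolding N_def using image by (intro borel_measurable_sum borel_measurable_indicator) auto
  have N_int: "(\<integral>\<^sup>+p. N k p \<partial>lebesgue) \<le> ?I" for k
  proof -
    have "(\<integral>\<^sup>+p. N k p \<partial>lebesgue) = (\<Sum>T\<in>Pow {..<k}. \<integral>\<^sup>+p. indicator (f ` atom k T) p \<partial>lebesgue)"
      unfolding N_def using image by (intro nn_integral_sum borel_measurable_indicator) auto
    also have "\<dots> = (\<Sum>T\<in>Pow {..<k}. emeasure lebesgue (f ` atom k T))"
      by (intro sum.cong nn_integral_indicator conjunct1[OF image]) auto
    also have "\<dots> \<le> (\<Sum>T\<in>Pow {..<k}. \<integral>\<^sup>+x. ennreal (jacobian (f' x)) * indicator (atom k T) x \<partial>lborel)"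
      by (intro sum_mono conjunct2[OF image]) auto
    also have "\<dots> = (\<integral>\<^sup>+x. (\<Sum>T\<in>Pow {..<k}. ennreal (jacobian (f' x)) * indicator (atom k T) x) \<partial>lborel)"
    proof (rule nn_integral_sum[symmetric])
      fix T assume "T \<in> Pow {..<k}"
      then show "(\<lambda>x. ennreal (jacobian (f' x)) * indicator (atom k T) x) \<in> borel_measurable lborel"
        using J[of T k] by simp
    qed
    also have "\<dots> = ?I"
      by (simp add: sum_distrib_left[symmetric] split)
    finally show ?thesis .
  qed
  have N_card: "N k p = of_nat (card (base_code B k ` {x\<in>S. f x = p}))" for k p
  proof -
    have "N k p = (\<Sum>T\<in>Pow {..<k}. if T \<in> base_code B k ` {x\<in>S. f x = p} then 1 else 0)"
      unfolding N_def
    proof (rule sum.cong)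
      fix T
      have "p \<in> f ` atom k T \<longleftrightarrow> T \<in> base_code B k ` {x\<in>S. f x = p}"
        unfolding atom_def by blast
      then show "(indicator (f ` atom k T) p :: ennreal) = (if T \<in> base_code B k ` {x\<in>S. f x = p} then 1 else 0)"
        by (simp add: indicator_def)
    qed simp
    also have "\<dots> = of_nat (card (Pow {..<k} \<inter> base_code B k ` {x\<in>S. f x = p}))"
      by (subst sum.inter_restrict[symmetric]) simp_all
    also have "Pow {..<k} \<inter> base_code B k ` {x\<in>S. f x = p} = base_code B k ` {x\<in>S. f x = p}"
      by (auto simp: base_code_def)
    finally show ?thesis .
  qed
  have "incseq N"
  proof (intro incseq_SucI le_funI)
    fix k p
    let ?X = "{x\<in>S. f x = p}"
    have "base_code B k ` ?X = (\<lambda>T. T \<inter> {..<k}) ` base_code B (Suc k) ` ?X"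
      unfolding image_image by (rule image_cong) (auto simp: base_code_def)
    moreover have "finite (base_code B (Suc k) ` ?X)"
      by (rule finite_subset[of _ "Pow {..<Suc k}"]) (auto simp: base_code_def)
    ultimately have "card (base_code B k ` ?X) \<le> card (base_code B (Suc k) ` ?X)"
      by (simp add: card_image_le)
    then show "N k p \<le> N (Suc k) p" by (simp add: N_card of_nat_mono)
  qed
  have "(\<integral>\<^sup>+p. emeasure (count_space UNIV) {x\<in>S. f x = p} \<partial>lebesgue) \<le> (\<integral>\<^sup>+p. (SUP k. N k p) \<partial>lebesgue)"
    unfolding N_card by (intro nn_integral_mono emeasure_count_space_le_SUP_card B(2))
  also have "\<dots> = (SUP k. \<integral>\<^sup>+p. N k p \<partial>lebesgue)"
    using \<open>incseq N\<close> by (intro nn_integral_monotone_convergence_SUP) auto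
  also have "\<dots> \<le> ?I" by (intro SUP_least N_int)
  finally show ?thesis .
qed

section \<open>Comparison of integrals along rays\<close>

lemma nn_integral_affine_lborel:
  fixes f :: "'a::euclidean_space \<Rightarrow> ennreal"
  assumes [measurable]: "f \<in> borel_measurable borel" and c: "c \<noteq> 0"
  shows "(\<integral>\<^sup>+x. f x \<partial>lborel) = ennreal (\<bar>c\<bar> ^ DIM('a)) * (\<integral>\<^sup>+x. f (t + c *\<^sub>R x) \<partial>lborel)"
  using c by (subst lborel_affine[of c t])
    (simp_all add: nn_integral_density nn_integral_distr nn_integral_cmult)

text \<open>Polar coordinates without a measure on the sphere, whose role is played by the shell \<open>1 \<le> norm w \<le> 2\<close>. For
\<open>v \<noteq> 0\<close> the numbers \<open>s\<close> with \<open>v / s\<close> in the shell have measure \<open>ln 2\<close> with respect to \<open>ds / s\<close>. Inserting this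
factor, exchanging the integrals and substituting \<open>v = s w\<close> gives the formula.\<close>

lemma nn_integral_polar:
  fixes f :: "'a::euclidean_space \<Rightarrow> ennreal"
  assumes [measurable]: "f \<in> borel_measurable borel"
  shows "ennreal (ln 2) * (\<integral>\<^sup>+v. f v \<partial>lborel) =
    (\<integral>\<^sup>+w. indicator {w. 1 \<le> norm w \<and> norm w \<le> 2} w *
      (\<integral>\<^sup>+s. ennreal (s ^ (DIM('a) - 1)) * f (s *\<^sub>R w) * indicator {0<..} s \<partial>lborel) \<partial>lborel)"
proof -
  let ?A = "{w::'a. 1 \<le> norm w \<and> norm w \<le> 2}"
  have [measurable]: "?A \<in> sets borel" by measurable
  have one: "(\<integral>\<^sup>+s. indicator ?A (v /\<^sub>R s) * (ennreal (1/s) * indicator {0<..} s) \<partial>lborel) = ennreal (ln 2)"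
    if "v \<noteq> 0" for v :: 'a
  proof -
    have "indicator ?A (v /\<^sub>R s) * (ennreal (1/s) * indicator {0<..} s) =
        ennreal (1/s) * indicator {norm v / 2..norm v} s" for s
    proof (cases "s > 0")
      case True
      have "norm (v /\<^sub>R s) = norm v / s"
        using True by (simp add: divide_inverse)
      then have "v /\<^sub>R s \<in> ?A \<longleftrightarrow> s \<in> {norm v / 2..norm v}"
        using True by (simp add: le_divide_eq divide_le_eq) linarith
      then show ?thesis using True by (simp add: indicator_def)
    next
      case False
      moreover have "norm v > 0" using that by simp
      ultimately have "s \<notin> {norm v / 2..norm v}" unfolding atLeastAtMost_iff by linarith
      then show ?thesis using False by (simp add: indicator_def)
    qed
    then have "(\<integral>\<^sup>+s. indicator ?A (v /\<^sub>R s) * (ennreal (1/s) * indicator {0<..} s) \<partial>lborel) =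
      (\<integral>\<^sup>+s. ennreal (1/s) * indicator {norm v / 2..norm v} s \<partial>lborel)"
      by simp
    also have "\<dots> = ennreal (ln (norm v) - ln (norm v / 2))"
    proof (rule nn_integral_FTC_Icc)
      fix x assume "x \<in> {norm v / 2..norm v}"
      then have "norm v / 2 \<le> x" "x \<le> norm v" by auto
      moreover have "norm v > 0" using that by simp
      ultimately have x: "x > 0" by linarith
      show "(ln has_real_derivative 1 / x) (at x)"
        using x by (auto intro!: derivative_eq_intros)
      show "0 \<le> 1 / x" using x by simp
    qed simp_all
    also have "ln (norm v) - ln (norm v / 2) = ln 2"
      using that by (simp add: ln_div)
    finally show ?thesis .
  qed
  have "ennreal (ln 2) * (\<integral>\<^sup>+v. f v \<partial>lborel) = (\<integral>\<^sup>+v. f v * ennreal (ln 2) \<partial>lborel)"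
    by (simp add: nn_integral_multc mult.commute)
  also have "\<dots> = (\<integral>\<^sup>+v. f v * (\<integral>\<^sup>+s. indicator ?A (v /\<^sub>R s) * (ennreal (1/s) * indicator {0<..} s) \<partial>lborel) \<partial>lborel)"
    by (intro nn_integral_cong_AE eventually_mono[OF AE_lborel_singleton[of 0]]) (subst one, assumption, rule refl)
  also have "\<dots> = (\<integral>\<^sup>+v. (\<integral>\<^sup>+s. f v * (indicator ?A (v /\<^sub>R s) * (ennreal (1/s) * indicator {0<..} s)) \<partial>lborel) \<partial>lborel)"
    by (intro nn_integral_cong nn_integral_cmult[symmetric]) measurable
  also have "\<dots> = (\<integral>\<^sup>+s. (\<integral>\<^sup>+v. f v * (indicator ?A (v /\<^sub>R s) * (ennreal (1/s) * indicator {0<..} s)) \<partial>lborel) \<partial>lborel)"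
    by (rule lborel_pair.Fubini') measurable
  also have "\<dots> = (\<integral>\<^sup>+s. (\<integral>\<^sup>+w. indicator ?A w * (ennreal (s ^ (DIM('a) - 1)) * f (s *\<^sub>R w) * indicator {0<..} s) \<partial>lborel) \<partial>lborel)"
  proof (rule nn_integral_cong)
    fix s :: real
    show "(\<integral>\<^sup>+v. f v * (indicator ?A (v /\<^sub>R s) * (ennreal (1/s) * indicator {0<..} s)) \<partial>lborel) =
      (\<integral>\<^sup>+w. indicator ?A w * (ennreal (s ^ (DIM('a) - 1)) * f (s *\<^sub>R w) * indicator {0<..} s) \<partial>lborel)"
    proof (cases "s > 0")
      case True
      have "s ^ DIM('a) * (1 / s) = s ^ (DIM('a) - 1)"
        using True by (cases "DIM('a)") auto
      then have p: "ennreal (s ^ DIM('a)) * ennreal (1 / s) = ennreal (s ^ (DIM('a) - 1))"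
        using True by (simp add: ennreal_mult[symmetric])
      have "(\<integral>\<^sup>+v. f v * (indicator ?A (v /\<^sub>R s) * (ennreal (1/s) * indicator {0<..} s)) \<partial>lborel) =
        ennreal (s ^ DIM('a)) * (\<integral>\<^sup>+w. f (s *\<^sub>R w) * (indicator ?A w * ennreal (1/s)) \<partial>lborel)"
        using True by (subst nn_integral_affine_lborel[where c = s and t = 0]) simp_all
      also have "\<dots> = (\<integral>\<^sup>+w. ennreal (s ^ DIM('a)) * (f (s *\<^sub>R w) * (indicator ?A w * ennreal (1/s))) \<partial>lborel)"
        by (rule nn_integral_cmult[symmetric]) measurable
      also have "\<dots> = (\<integral>\<^sup>+w. indicator ?A w * (ennreal (s ^ (DIM('a) - 1)) * f (s *\<^sub>R w) * indicator {0<..} s) \<partial>lborel)"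
        using True unfolding p[symmetric] by (simp add: mult_ac)
      finally show ?thesis .
    next
      case False then show ?thesis by simp
    qed
  qed
  also have "\<dots> = (\<integral>\<^sup>+w. (\<integral>\<^sup>+s. indicator ?A w * (ennreal (s ^ (DIM('a) - 1)) * f (s *\<^sub>R w) * indicator {0<..} s) \<partial>lborel) \<partial>lborel)"
    by (rule lborel_pair.Fubini') measurable
  also have "\<dots> = (\<integral>\<^sup>+w. indicator ?A w *
      (\<integral>\<^sup>+s. ennreal (s ^ (DIM('a) - 1)) * f (s *\<^sub>R w) * indicator {0<..} s \<partial>lborel) \<partial>lborel)"
    by (intro nn_integral_cong nn_integral_cmult) measurable
  finally show ?thesis .
qed

lemma nn_integral_le_by_rays:
  fixes f g :: "'a::euclidean_space \<Rightarrow> ennreal"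
  assumes f: "f \<in> borel_measurable borel" and g: "g \<in> borel_measurable borel"
    and rays: "\<And>w. w \<noteq> 0 \<Longrightarrow>
      (\<integral>\<^sup>+s. ennreal (s ^ (DIM('a) - 1)) * f (s *\<^sub>R w) * indicator {0<..} s \<partial>lborel) \<le>
      (\<integral>\<^sup>+s. ennreal (s ^ (DIM('a) - 1)) * g (s *\<^sub>R w) * indicator {0<..} s \<partial>lborel)"
  shows "(\<integral>\<^sup>+v. f v \<partial>lborel) \<le> (\<integral>\<^sup>+v. g v \<partial>lborel)"
proof -
  have "ennreal (ln 2) * (\<integral>\<^sup>+v. f v \<partial>lborel) \<le> ennreal (ln 2) * (\<integral>\<^sup>+v. g v \<partial>lborel)"
    unfolding nn_integral_polar[OF f] nn_integral_polar[OF g]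
  proof (intro nn_integral_mono)
    fix w :: 'a
    show "indicator {w. 1 \<le> norm w \<and> norm w \<le> 2} w *
        (\<integral>\<^sup>+s. ennreal (s ^ (DIM('a) - 1)) * f (s *\<^sub>R w) * indicator {0<..} s \<partial>lborel) \<le>
      indicator {w. 1 \<le> norm w \<and> norm w \<le> 2} w *
        (\<integral>\<^sup>+s. ennreal (s ^ (DIM('a) - 1)) * g (s *\<^sub>R w) * indicator {0<..} s \<partial>lborel)"
      using rays[of w] by (cases "w = 0") (simp, intro mult_left_mono, simp_all)
  qed
  moreover have "ln 2 > (0::real)" by simp
  ultimately show ?thesis
    by (subst (asm) ennreal_mult_le_mult_iff) auto
qed

lemma prod_le_mean_power:
  fixes x :: "'i \<Rightarrow> real"
  assumes "finite I" "I \<noteq> {}" "\<And>i. i \<in> I \<Longrightarrow> 0 \<le> x i"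
  shows "(\<Prod>i\<in>I. x i) \<le> (\<Sum>i\<in>I. x i ^ card I) / card I"
proof -
  have k: "card I > 0" using assms by (simp add: card_gt_0_iff)
  have "(\<Prod>i\<in>I. x i) = ((\<Prod>i\<in>I. x i) ^ card I) powr (1 / card I)"
  proof (cases "(\<Prod>i\<in>I. x i) = 0")
    case True then show ?thesis using k by simp
  next
    case False
    then have "(\<Prod>i\<in>I. x i) > 0" using assms(3) prod_nonneg[of I x] by (simp add: less_le)
    then show ?thesis using k by (simp add: powr_realpow[symmetric] powr_powr)
  qed
  also have "\<dots> = (\<Prod>i\<in>I. x i ^ card I) powr (1 / card I)"
    by (simp add: prod_power_distrib)
  also have "\<dots> \<le> (\<Sum>i\<in>I. x i ^ card I / card I)"
    using assms by (intro arith_geom_mean) auto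
  finally show ?thesis by (simp add: sum_divide_distrib)
qed

text \<open>The integral is \<open>(a\<^sup>k\<^sup>+\<^sup>1 + (l - a)\<^sup>k\<^sup>+\<^sup>1) / (k + 1)\<close>, and \<open>x \<mapsto> x\<^sup>k\<^sup>+\<^sup>1\<close> is superadditive on the nonnegative reals.\<close>

lemma nn_integral_abs_diff_power_le:
  fixes a l :: real
  assumes "0 \<le> a" "a \<le> l"
  shows "(\<integral>\<^sup>+t. ennreal (\<bar>t - a\<bar> ^ k) * indicator {0..l} t \<partial>lborel) \<le> ennreal (l ^ Suc k / Suc k)"
proof -
  have left: "(\<integral>\<^sup>+t. ennreal ((a - t) ^ k) * indicator {0..a} t \<partial>lborel) = ennreal (- ((a - a) ^ Suc k / Suc k) - - ((a - 0) ^ Suc k / Suc k))"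
    by (rule nn_integral_FTC_Icc)
      (use assms in \<open>auto intro!: derivative_eq_intros simp del: power_Suc\<close>)
  have right: "(\<integral>\<^sup>+t. ennreal ((t - a) ^ k) * indicator {a..l} t \<partial>lborel) = ennreal ((l - a) ^ Suc k / Suc k - (a - a) ^ Suc k / Suc k)"
    by (rule nn_integral_FTC_Icc)
      (use assms in \<open>auto intro!: derivative_eq_intros simp del: power_Suc\<close>)
  have "(\<integral>\<^sup>+t. ennreal (\<bar>t - a\<bar> ^ k) * indicator {0..l} t \<partial>lborel) \<le>
    (\<integral>\<^sup>+t. ennreal ((a - t) ^ k) * indicator {0..a} t + ennreal ((t - a) ^ k) * indicator {a..l} t \<partial>lborel)"
    by (rule nn_integral_mono) (auto simp: indicator_def)
  also have "\<dots> = ennreal (a ^ Suc k / Suc k) + ennreal ((l - a) ^ Suc k / Suc k)"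
    by (subst nn_integral_add) (simp_all only: left right, simp_all)
  also have "\<dots> = ennreal ((a ^ Suc k + (l - a) ^ Suc k) / Suc k)"
    using assms by (simp add: ennreal_plus[symmetric] add_divide_distrib del: ennreal_plus)
  also have "\<dots> \<le> ennreal (l ^ Suc k / Suc k)"
  proof (intro ennreal_leI divide_right_mono)
    have "a ^ Suc k + (l - a) ^ Suc k = a * a ^ k + (l - a) * (l - a) ^ k" by simp
    also have "\<dots> \<le> a * l ^ k + (l - a) * l ^ k"
      using assms by (intro add_mono mult_left_mono power_mono) auto
    also have "\<dots> = l ^ Suc k" by (simp add: algebra_simps)
    finally show "a ^ Suc k + (l - a) ^ Suc k \<le> l ^ Suc k" .
  qed simp
  finally show ?thesis .
qed

text \<open>By the inequality between the geometric and the arithmetic mean, the worst case is that all \<open>a i\<close> coincide.\<close>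

lemma nn_integral_prod_abs_diff_le:
  fixes a :: "'i \<Rightarrow> real" and l :: real
  assumes I: "finite I" "I \<noteq> {}" and a: "\<And>i. i \<in> I \<Longrightarrow> 0 \<le> a i \<and> a i \<le> l"
  shows "(\<integral>\<^sup>+t. ennreal (\<Prod>i\<in>I. \<bar>t - a i\<bar>) * indicator {0..l} t \<partial>lborel) \<le>
    (\<integral>\<^sup>+t. ennreal (t ^ card I) * indicator {0..l} t \<partial>lborel)"
proof -
  let ?k = "card I"
  have k: "?k > 0" using I by (simp add: card_gt_0_iff)
  have l: "0 \<le> l" using I a by fastforce
  have "(\<integral>\<^sup>+t. ennreal (\<Prod>i\<in>I. \<bar>t - a i\<bar>) * indicator {0..l} t \<partial>lborel) \<le>
    (\<integral>\<^sup>+t. (\<Sum>i\<in>I. ennreal (1 / ?k) * (ennreal (\<bar>t - a i\<bar> ^ ?k) * indicator {0..l} t)) \<partial>lborel)"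
  proof (rule nn_integral_mono)
    fix t
    have "ennreal (\<Prod>i\<in>I. \<bar>t - a i\<bar>) \<le> ennreal ((\<Sum>i\<in>I. \<bar>t - a i\<bar> ^ ?k) / ?k)"
      using I by (intro ennreal_leI prod_le_mean_power) auto
    also have "\<dots> = (\<Sum>i\<in>I. ennreal (1 / ?k) * ennreal (\<bar>t - a i\<bar> ^ ?k))"
      by (simp add: ennreal_mult[symmetric] sum_divide_distrib)
    finally show "ennreal (\<Prod>i\<in>I. \<bar>t - a i\<bar>) * indicator {0..l} t \<le>
        (\<Sum>i\<in>I. ennreal (1 / ?k) * (ennreal (\<bar>t - a i\<bar> ^ ?k) * indicator {0..l} t))"
      by (simp add: indicator_def)
  qed
  also have "\<dots> = (\<Sum>i\<in>I. ennreal (1 / ?k) * (\<integral>\<^sup>+t. ennreal (\<bar>t - a i\<bar> ^ ?k) * indicator {0..l} t \<partial>lborel))"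
    by (simp add: nn_integral_sum nn_integral_cmult)
  also have "\<dots> \<le> (\<Sum>i\<in>I. ennreal (1 / ?k) * ennreal (l ^ Suc ?k / Suc ?k))"
    using a by (intro sum_mono mult_left_mono nn_integral_abs_diff_power_le) auto
  also have "\<dots> = of_nat ?k * ennreal (1 / ?k) * ennreal (l ^ Suc ?k / Suc ?k)"
    by (simp add: mult.assoc)
  also have "of_nat ?k * ennreal (1 / ?k) = 1"
    using k by (simp add: ennreal_of_nat_eq_real_of_nat ennreal_mult[symmetric])
  also have "1 * ennreal (l ^ Suc ?k / Suc ?k) = ennreal (l ^ Suc ?k / Suc ?k - 0 ^ Suc ?k / Suc ?k)" by simp
  also have "\<dots> = (\<integral>\<^sup>+t. ennreal (t ^ ?k) * indicator {0..l} t \<partial>lborel)"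
    by (rule nn_integral_FTC_Icc[symmetric])
      (use l in \<open>auto intro!: derivative_eq_intros simp del: power_Suc\<close>)
  finally show ?thesis .
qed

section \<open>The Rogers-Shephard inequality\<close>

text \<open>A value of the Beta function.\<close>

lemma central_binomial_integral:
  assumes m: "m \<ge> 1"
  shows "(\<integral>\<^sup>+t. ennreal (real m * (1 - t) ^ (m - 1) * t ^ m) * indicator {0..1} t \<partial>lborel)
    = ennreal (1 / real ((2 * m) choose m))"
proof -
  have "((\<lambda>t. t powr (real (m + 1) - 1) * (1 - t) powr (real m - 1)) has_integral Beta (real (m + 1)) (real m)) {0..1}"
    using m by (intro has_integral_Beta_real) auto
  then have "((\<lambda>t. t ^ m * (1 - t) ^ (m - 1)) has_integral Beta (real (m + 1)) (real m)) {0..1}"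
  proof (rule has_integral_spike_finite[of "{0, 1}", rotated 2])
    fix t :: real assume "t \<in> {0..1} - {0, 1}"
    then have t: "0 < t" "0 < 1 - t" by auto
    have "t powr (real (m + 1) - 1) = t ^ m"
      using t(1) by (simp add: powr_realpow)
    moreover have "(1 - t) powr (real m - 1) = (1 - t) ^ (m - 1)"
      using powr_realpow[OF t(2), of "m - 1"] m by (simp only: of_nat_diff of_nat_1)
    ultimately show "t ^ m * (1 - t) ^ (m - 1) = t powr (real (m + 1) - 1) * (1 - t) powr (real m - 1)"
      by (simp only:)
  qed simp
  then have "((\<lambda>t. real m * (t ^ m * (1 - t) ^ (m - 1))) has_integral real m * Beta (real (m + 1)) (real m)) {0..1}"
    by (rule has_integral_mult_right)
  moreover have "real m * Beta (real (m + 1)) (real m) = 1 / real ((2 * m) choose m)"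
  proof -
    have "Gamma (real m + 1) = fact m" "Gamma (real m + real m + 1) = fact (2 * m)"
      using Gamma_fact[of m, where 'a = real] Gamma_fact[of "2 * m", where 'a = real]
      by (simp_all add: add.commute)
    moreover have "real m \<notin> \<int>\<^sub>\<le>\<^sub>0"
      using m by (auto dest: nonpos_Ints_nonpos)
    then have "real m * Gamma (real m) = fact m"
      using Gamma_plus1[of "real m"] Gamma_fact[of m, where 'a = real] by (simp add: add.commute)
    moreover have "real (m + 1) + real m = real m + real m + 1" "real (m + 1) = real m + 1" by simp_all
    ultimately have "real m * Beta (real (m + 1)) (real m) = fact m * fact m / fact (2 * m)"
      unfolding Beta_def by (metis mult.left_commute times_divide_eq_right)
    then show ?thesis
      by (simp add: binomial_fact)
  qed
  ultimately have I: "((\<lambda>t. real m * (1 - t) ^ (m - 1) * t ^ m) has_integral 1 / real ((2 * m) choose m)) {0..1}"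
    by (simp add: mult_ac)
  show ?thesis
    by (rule nn_integral_has_integral_lebesgue'[OF _ I]) auto
qed

text \<open>Integrate \<open>c x = vol (K \<inter> (K + x))\<close> over all \<open>x\<close>; the result is \<open>vol(K)\<^sup>2\<close>. If \<open>x = t (a - b)\<close> with \<open>a\<close>, \<open>b\<close> in \<open>K\<close> and
\<open>0 \<le> t \<le> 1\<close>, then \<open>K \<inter> (K + x)\<close> contains \<open>t a + (1 - t) K\<close>, so \<open>c x \<ge> (1 - t)\<^sup>m vol(K)\<close>. The least such \<open>t\<close> is the
gauge of \<open>x\<close> with respect to \<open>D\<close>. The integral over \<open>D\<close> of \<open>(1 - gauge)\<^sup>m\<close>, computed by layers \<open>t D\<close> of volume
\<open>t\<^sup>m vol(D)\<close>, is a Beta integral times \<open>vol(D)\<close>.\<close>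

lemma Rogers_Shephard:
  fixes K :: "'a::euclidean_space set"
  assumes K: "compact K" "convex K" and pos: "emeasure lborel K \<noteq> 0"
  defines "D \<equiv> {x - y | x y. x \<in> K \<and> y \<in> K}"
  shows "emeasure lborel D \<le> of_nat ((2 * DIM('a)) choose DIM('a)) * emeasure lborel K"
proof -
  let ?m = "DIM('a)" and ?V = "emeasure lborel K"
  have m: "?m \<ge> 1" using DIM_positive[where 'a = 'a] by linarith
  have Kb [measurable]: "K \<in> sets borel" using K by (simp add: borel_compact)
  have Vfin: "?V < \<infinity>" using K emeasure_compact_finite by blast
  have Dc: "compact D" unfolding D_def using K compact_differences[of K K] by simp
  then have Db [measurable]: "D \<in> sets borel" by (simp add: borel_compact)
  define c :: "'a \<Rightarrow> ennreal" where "c = (\<lambda>x. \<integral>\<^sup>+y. indicator K y * indicator K (y - x) \<partial>lborel)"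
  have total: "(\<integral>\<^sup>+x. c x \<partial>lborel) = ?V * ?V"
  proof -
    have "(\<integral>\<^sup>+x. c x \<partial>lborel) = (\<integral>\<^sup>+y. (\<integral>\<^sup>+x. indicator K y * indicator K (y - x) \<partial>lborel) \<partial>lborel)"
      unfolding c_def by (rule lborel_pair.Fubini') measurable
    also have "\<dots> = (\<integral>\<^sup>+y. indicator K y * ?V \<partial>lborel)"
    proof (rule nn_integral_cong)
      fix y
      have "(\<integral>\<^sup>+x. indicator K y * indicator K (y - x) \<partial>lborel) =
          indicator K y * (\<integral>\<^sup>+x. indicator K (y + (-1) *\<^sub>R x) \<partial>lborel)"
        by (subst nn_integral_cmult[symmetric]) simp_all
      also have "(\<integral>\<^sup>+x. indicator K (y + (-1) *\<^sub>R x) \<partial>lborel) = (\<integral>\<^sup>+x. indicator K x \<partial>(lborel :: 'a measure))"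
        by (subst (2) nn_integral_affine_lborel[where c = "-1" and t = y]) simp_all
      finally show "(\<integral>\<^sup>+x. indicator K y * indicator K (y - x) \<partial>lborel) = indicator K y * ?V"
        by simp
    qed
    also have "\<dots> = ?V * ?V" by (subst nn_integral_multc) simp_all
    finally show ?thesis .
  qed
  have lower: "ennreal ((1 - t) ^ ?m) * ?V \<le> c (t *\<^sub>R d)" if "0 \<le> t" "t \<le> 1" "d \<in> D" for t d
  proof (cases "t = 1")
    case True
    then have "(1 - t) ^ ?m = 0" using m by (simp add: power_0_left)
    then show ?thesis by (simp only: ennreal_0 mult_zero_left zero_le)
  next
    case False
    then have t: "1 - t > 0" using that by simp
    obtain a b where ab: "a \<in> K" "b \<in> K" "d = a - b" using \<open>d \<in> D\<close> unfolding D_def by blast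
    have eq: "t *\<^sub>R a + (1 - t) *\<^sub>R k - t *\<^sub>R d = t *\<^sub>R b + (1 - t) *\<^sub>R k" for k
      by (simp add: ab scaleR_diff_right)
    have incl: "t *\<^sub>R a + (1 - t) *\<^sub>R k \<in> K \<and> t *\<^sub>R a + (1 - t) *\<^sub>R k - t *\<^sub>R d \<in> K" if "k \<in> K" for k
      unfolding eq using that ab t \<open>0 \<le> t\<close> by (intro conjI convexD[OF K(2)]) auto
    have "ennreal ((1 - t) ^ ?m) * ?V = ennreal ((1 - t) ^ ?m) * (\<integral>\<^sup>+k. indicator K k \<partial>lborel)"
      by simp
    also have "\<dots> \<le> ennreal ((1 - t) ^ ?m) * (\<integral>\<^sup>+k. indicator K (t *\<^sub>R a + (1 - t) *\<^sub>R k) *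
        indicator K (t *\<^sub>R a + (1 - t) *\<^sub>R k - t *\<^sub>R d) \<partial>lborel)"
      using incl by (intro mult_left_mono nn_integral_mono) (auto simp: indicator_def)
    also have "\<dots> = c (t *\<^sub>R d)"
      unfolding c_def using t by (subst nn_integral_affine_lborel[where c = "1 - t" and t = "t *\<^sub>R a"]) simp_all
    finally show ?thesis .
  qed
  \<comment> \<open>The layers \<open>t D\<close> as one subset of the product space, closed and hence measurable.\<close>
  define E where "E = (\<lambda>(t, d). (t, t *\<^sub>R d)) ` ({0..1::real} \<times> D)"
  have "compact E"
    unfolding E_def using Dc by (intro compact_continuous_image compact_Times)
      (auto simp: case_prod_beta intro!: continuous_intros)
  then have Eb [measurable]: "E \<in> sets (borel \<Otimes>\<^sub>M borel)"
    unfolding borel_prod by (rule borel_compact)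
  have E_iff: "(t, x) \<in> E \<longleftrightarrow> 0 \<le> t \<and> t \<le> 1 \<and> (\<exists>d\<in>D. x = t *\<^sub>R d)" for t x
    by (auto simp: E_def)
  \<comment> \<open>The density of the layers: its integral from \<open>r\<close> to \<open>1\<close> is \<open>(1 - r)\<^sup>m\<close>.\<close>
  define w where "w = (\<lambda>t::real. real ?m * (1 - t) ^ (?m - 1))"
  have [measurable]: "w \<in> borel_measurable borel" by (simp add: w_def)
  have layer: "?V * (\<integral>\<^sup>+t. ennreal (w t) * indicator E (t, x) \<partial>lborel) \<le> c x" for x
  proof (cases "\<exists>t. (t, x) \<in> E")
    case False then show ?thesis by simp
  next
    case True
    define Tx where "Tx = fst ` (E \<inter> (UNIV \<times> {x}))"
    have Tx: "t \<in> Tx \<longleftrightarrow> (t, x) \<in> E" for t by (force simp: Tx_def)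
    have "compact (E \<inter> (UNIV \<times> {x}))"
      by (rule compact_Int_closed[OF \<open>compact E\<close>]) (simp add: closed_Times)
    then have "compact Tx"
      unfolding Tx_def by (intro compact_continuous_image continuous_on_fst continuous_on_id)
    moreover have "Tx \<noteq> {}" using True Tx by blast
    ultimately obtain r where r: "r \<in> Tx" "\<And>t. t \<in> Tx \<Longrightarrow> r \<le> t"
      using compact_attains_inf by metis
    obtain d where d: "0 \<le> r" "r \<le> 1" "d \<in> D" "x = r *\<^sub>R d"
      using r(1) unfolding E_iff Tx by blast
    have range: "(t, x) \<in> E \<Longrightarrow> t \<in> {r..1}" for t
      using r(2)[of t] Tx[of t] E_iff[of t x] by simp
    have "(\<integral>\<^sup>+t. ennreal (w t) * indicator E (t, x) \<partial>lborel) \<le> (\<integral>\<^sup>+t. ennreal (w t) * indicator {r..1} t \<partial>lborel)"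
    proof (rule nn_integral_mono)
      fix t show "ennreal (w t) * indicator E (t, x) \<le> ennreal (w t) * indicator {r..1} t"
        using range[of t] by (cases "(t, x) \<in> E") simp_all
    qed
    also have "\<dots> = ennreal (- ((1 - 1) ^ ?m) - - ((1 - r) ^ ?m))"
    proof (rule nn_integral_FTC_Icc)
      fix t assume "t \<in> {r..1}"
      show "((\<lambda>t. - ((1 - t) ^ ?m)) has_real_derivative w t) (at t)"
        by (auto intro!: derivative_eq_intros simp: w_def)
      show "0 \<le> w t" using \<open>t \<in> {r..1}\<close> by (simp add: w_def)
    qed (use d in simp_all)
    also have "\<dots> = ennreal ((1 - r) ^ ?m)" using m by (simp add: power_0_left)
    finally have "?V * (\<integral>\<^sup>+t. ennreal (w t) * indicator E (t, x) \<partial>lborel) \<le> ?V * ennreal ((1 - r) ^ ?m)"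
      by (rule mult_left_mono) simp
    also have "\<dots> \<le> c x" using lower[OF d(1-3)] d(4) by (simp add: mult.commute)
    finally show ?thesis .
  qed
  have "(\<integral>\<^sup>+x. (\<integral>\<^sup>+t. ennreal (w t) * indicator E (t, x) \<partial>lborel) \<partial>lborel) =
    (\<integral>\<^sup>+t. (\<integral>\<^sup>+x. ennreal (w t) * indicator E (t, x) \<partial>lborel) \<partial>lborel)"
    by (rule lborel_pair.Fubini') (simp add: split_beta, measurable)
  also have "\<dots> = (\<integral>\<^sup>+t. (ennreal (w t * t ^ ?m) * indicator {0..1} t) * emeasure lborel D \<partial>lborel)"
  proof (intro nn_integral_cong_AE eventually_mono[OF AE_lborel_singleton[of 0]])
    fix t :: real assume t0: "t \<noteq> 0"
    have "(\<integral>\<^sup>+x. ennreal (w t) * indicator E (t, x) \<partial>lborel) = ennreal (w t) * (\<integral>\<^sup>+x. indicator E (t, x) \<partial>lborel)"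
      by (rule nn_integral_cmult) measurable
    also have "(\<integral>\<^sup>+x. indicator E (t, x) \<partial>lborel) = ennreal (\<bar>t\<bar> ^ ?m) * (\<integral>\<^sup>+x. indicator E (t, 0 + t *\<^sub>R x) \<partial>lborel)"
      using t0 by (intro nn_integral_affine_lborel) measurable
    also have "(\<integral>\<^sup>+x. indicator E (t, 0 + t *\<^sub>R x) \<partial>lborel) = (\<integral>\<^sup>+x. indicator {0..1} t * indicator D x \<partial>(lborel :: 'a measure))"
      using t0 by (intro nn_integral_cong) (auto simp: indicator_def E_iff)
    also have "\<dots> = indicator {0..1} t * emeasure lborel D"
      by (subst nn_integral_cmult) simp_all
    finally show "(\<integral>\<^sup>+x. ennreal (w t) * indicator E (t, x) \<partial>lborel) =
        (ennreal (w t * t ^ ?m) * indicator {0..1} t) * emeasure lborel D"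
      by (auto simp: indicator_def ennreal_mult' mult_ac w_def)
  qed
  also have "\<dots> = (\<integral>\<^sup>+t. ennreal (w t * t ^ ?m) * indicator {0..1} t \<partial>lborel) * emeasure lborel D"
    by (rule nn_integral_multc) measurable
  also have "(\<integral>\<^sup>+t. ennreal (w t * t ^ ?m) * indicator {0..1} t \<partial>lborel) = ennreal (1 / real ((2 * ?m) choose ?m))"
    unfolding w_def by (rule central_binomial_integral[OF m])
  finally have layers: "(\<integral>\<^sup>+x. (\<integral>\<^sup>+t. ennreal (w t) * indicator E (t, x) \<partial>lborel) \<partial>lborel) =
      ennreal (1 / real ((2 * ?m) choose ?m)) * emeasure lborel D" .
  have "?V * (ennreal (1 / real ((2 * ?m) choose ?m)) * emeasure lborel D) =
      (\<integral>\<^sup>+x. ?V * (\<integral>\<^sup>+t. ennreal (w t) * indicator E (t, x) \<partial>lborel) \<partial>lborel)"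
    unfolding layers[symmetric] by (rule nn_integral_cmult[symmetric]) measurable
  also have "\<dots> \<le> ?V * ?V"
    unfolding total[symmetric] by (intro nn_integral_mono layer)
  finally have "ennreal (1 / real ((2 * ?m) choose ?m)) * emeasure lborel D \<le> ?V"
    using pos Vfin by (subst (asm) ennreal_mult_le_mult_iff) auto
  then have "of_nat ((2 * ?m) choose ?m) * (ennreal (1 / real ((2 * ?m) choose ?m)) * emeasure lborel D)
      \<le> of_nat ((2 * ?m) choose ?m) * ?V"
    by (rule mult_left_mono) simp
  moreover have "of_nat ((2 * ?m) choose ?m) * ennreal (1 / real ((2 * ?m) choose ?m)) = 1"
    by (simp add: ennreal_of_nat_eq_real_of_nat ennreal_mult[symmetric])
  ultimately show ?thesis by (simp add: mult.assoc[symmetric])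
qed

section \<open>Gradients and level sets\<close>

text \<open>The symmetry of second derivatives. The mean value theorem shows that the second difference of \<open>f\<close> along \<open>s a\<close> and \<open>s b\<close>
is \<open>s\<^sup>2 (a \<bullet> A b)\<close> up to \<open>o(s\<^sup>2)\<close>, and the second difference is symmetric in \<open>a\<close> and \<open>b\<close>.\<close>

lemma gradient_derivative_selfadjoint:
  fixes f :: "'a::real_inner \<Rightarrow> real"
  assumes U: "open U" "x \<in> U"
    and f: "\<And>y. y \<in> U \<Longrightarrow> (f has_derivative (\<lambda>h. g y \<bullet> h)) (at y)"
    and g: "(g has_derivative A) (at x)"
  shows "A a \<bullet> b = a \<bullet> A b"
proof -
  have lin: "linear A" using g has_derivative_linear by blast
  have approx: "\<exists>d>0. \<forall>s. 0 < s \<and> s < d \<longrightarrow>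
      \<bar>(f (x + s *\<^sub>R a + s *\<^sub>R b) - f (x + s *\<^sub>R a) - f (x + s *\<^sub>R b) + f x) / s\<^sup>2 - a \<bullet> A b\<bar> \<le> e"
    if e: "e > 0" for e :: real and a b
  proof -
    \<comment> \<open>\<open>C\<close> is chosen so that the two remainders of \<open>g\<close>, taken at distance at most \<open>s * (norm a + norm b)\<close> and
      \<open>s * norm a\<close> with precision \<open>e / C\<close>, change the quotient by at most \<open>e\<close>.\<close>
    define C where "C = norm a * (2 * norm a + norm b) + 1"
    have C: "C > 0" unfolding C_def by (smt (verit) norm_ge_zero mult_nonneg_nonneg)
    obtain r where r: "r > 0" "ball x r \<subseteq> U" using U openE by blast
    from g have "\<forall>e>0. \<exists>d>0. \<forall>y. norm (y - x) < d \<longrightarrow> norm (g y - g x - A (y - x)) \<le> e * norm (y - x)"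
      by (simp add: has_derivative_at_alt)
    then obtain d0 where d0: "d0 > 0" "\<And>y. norm (y - x) < d0 \<Longrightarrow> norm (g y - g x - A (y - x)) \<le> e / C * norm (y - x)"
      using e C by (metis divide_pos_pos)
    define d where "d = min r d0 / (norm a + norm b + 1)"
    have n1: "norm a + norm b + 1 > 0" by (smt (verit) norm_ge_zero)
    have d: "d > 0" using r d0 n1 by (simp add: d_def)
    have "\<bar>(f (x + s *\<^sub>R a + s *\<^sub>R b) - f (x + s *\<^sub>R a) - f (x + s *\<^sub>R b) + f x) / s\<^sup>2 - a \<bullet> A b\<bar> \<le> e"
      if s: "0 < s" "s < d" for s
    proof -
      have sd: "s * (norm a + norm b + 1) < min r d0"
        using s n1 by (simp add: d_def pos_less_divide_eq)
      have small: "norm (t *\<^sub>R a + k *\<^sub>R b) < min r d0" if "0 \<le> t" "t \<le> s" "0 \<le> k" "k \<le> s" for t k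
      proof -
        have "norm (t *\<^sub>R a + k *\<^sub>R b) \<le> t * norm a + k * norm b"
          using norm_triangle_ineq[of "t *\<^sub>R a" "k *\<^sub>R b"] that by simp
        also have "\<dots> \<le> s * norm a + s * norm b"
          using that by (intro add_mono mult_right_mono) auto
        also have "\<dots> < min r d0" using sd s by (simp add: algebra_simps)
        finally show ?thesis .
      qed
      \<comment> \<open>The second difference of \<open>f\<close> is the increment of \<open>\<psi>\<close> over \<open>{0..s}\<close>.\<close>
      define \<psi> where "\<psi> = (\<lambda>t. f (x + t *\<^sub>R a + s *\<^sub>R b) - f (x + t *\<^sub>R a))"
      have inU: "x + t *\<^sub>R a + k *\<^sub>R b \<in> U" if "0 \<le> t" "t \<le> s" "0 \<le> k" "k \<le> s" for t k
        using small[OF that] r by (auto simp: subset_iff dist_norm add.assoc norm_minus_commute)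
      have der: "(\<psi> has_real_derivative (g (x + t *\<^sub>R a + s *\<^sub>R b) \<bullet> a - g (x + t *\<^sub>R a) \<bullet> a)) (at t)"
        if t: "0 \<le> t" "t \<le> s" for t
      proof -
        have 1: "((\<lambda>t. x + t *\<^sub>R a + k *\<^sub>R b) has_derivative (\<lambda>h. h *\<^sub>R a)) (at t)" for k
          by (auto intro!: derivative_eq_intros)
        have 2: "((\<lambda>t. f (x + t *\<^sub>R a + k *\<^sub>R b)) has_derivative (\<lambda>h. g (x + t *\<^sub>R a + k *\<^sub>R b) \<bullet> (h *\<^sub>R a))) (at t)"
          if "0 \<le> k" "k \<le> s" for k
          using has_derivative_compose[OF 1 f[OF inU]] t that by simp
        have 3: "((\<lambda>t. f (x + t *\<^sub>R a)) has_derivative (\<lambda>h. g (x + t *\<^sub>R a) \<bullet> (h *\<^sub>R a))) (at t)"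
          using 2[of 0] s by simp
        have "(\<psi> has_derivative (\<lambda>h. g (x + t *\<^sub>R a + s *\<^sub>R b) \<bullet> (h *\<^sub>R a) - g (x + t *\<^sub>R a) \<bullet> (h *\<^sub>R a))) (at t)"
          unfolding \<psi>_def using s by (intro has_derivative_diff 2 3) auto
        then show ?thesis
          unfolding has_field_derivative_def by (rule has_derivative_eq_rhs) (auto simp: algebra_simps)
      qed
      obtain t where t: "0 < t" "t < s" and \<psi>: "\<psi> s - \<psi> 0 = (s - 0) * (g (x + t *\<^sub>R a + s *\<^sub>R b) \<bullet> a - g (x + t *\<^sub>R a) \<bullet> a)"
        using MVT2[of 0 s \<psi> "\<lambda>t. g (x + t *\<^sub>R a + s *\<^sub>R b) \<bullet> a - g (x + t *\<^sub>R a) \<bullet> a"] s der by auto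
      define R where "R = (\<lambda>y. g y - g x - A (y - x))"
      have Rb: "norm (R (x + t *\<^sub>R a + k *\<^sub>R b)) \<le> e / C * (s * norm a + k * norm b)" if "0 \<le> k" "k \<le> s" for k
      proof -
        have "norm (R (x + t *\<^sub>R a + k *\<^sub>R b)) \<le> e / C * norm (t *\<^sub>R a + k *\<^sub>R b)"
          using d0(2)[of "x + t *\<^sub>R a + k *\<^sub>R b"] small[of t k] t that by (simp add: R_def add.assoc)
        also have "\<dots> \<le> e / C * (s * norm a + k * norm b)"
          using norm_triangle_ineq[of "t *\<^sub>R a" "k *\<^sub>R b"] t that e C mult_right_mono[of t s "norm a"]
          by (intro mult_left_mono) auto
        finally show ?thesis .
      qed
      have "g (x + t *\<^sub>R a + s *\<^sub>R b) - g (x + t *\<^sub>R a) = s *\<^sub>R A b + (R (x + t *\<^sub>R a + s *\<^sub>R b) - R (x + t *\<^sub>R a + 0 *\<^sub>R b))"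
        using lin by (simp add: R_def linear_add linear_scale)
      then have "\<psi> s - \<psi> 0 = s * (s * (A b \<bullet> a) + (R (x + t *\<^sub>R a + s *\<^sub>R b) - R (x + t *\<^sub>R a + 0 *\<^sub>R b)) \<bullet> a)"
        unfolding \<psi> by (simp add: inner_diff_left[symmetric] inner_add_left)
      then have "(\<psi> s - \<psi> 0) / s\<^sup>2 - a \<bullet> A b = (R (x + t *\<^sub>R a + s *\<^sub>R b) - R (x + t *\<^sub>R a + 0 *\<^sub>R b)) \<bullet> a / s"
        using s by (simp add: field_simps power2_eq_square inner_commute)
      also have "\<bar>\<dots>\<bar> \<le> norm (R (x + t *\<^sub>R a + s *\<^sub>R b) - R (x + t *\<^sub>R a + 0 *\<^sub>R b)) * norm a / s"
      proof -
        have "\<bar>W \<bullet> a / s\<bar> \<le> norm W * norm a / s" for W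
          using s divide_right_mono[OF Cauchy_Schwarz_ineq2[of W a], of s] by (simp add: abs_divide)
        then show ?thesis .
      qed
      also have "\<dots> \<le> (e / C * (s * norm a + s * norm b) + e / C * (s * norm a + 0 * norm b)) * norm a / s"
        using s Rb[of s] Rb[of 0] norm_triangle_ineq4[of "R (x + t *\<^sub>R a + s *\<^sub>R b)" "R (x + t *\<^sub>R a + 0 *\<^sub>R b)"]
        by (intro divide_right_mono mult_right_mono norm_ge_zero less_imp_le[OF s(1)]) linarith
      also have "\<dots> = e * ((C - 1) / C)"
      proof -
        have C1: "C - 1 = norm a * (2 * norm a + norm b)" by (simp add: C_def)
        show ?thesis unfolding C1 using s(1) C by (simp add: field_simps)
      qed
      also have "\<dots> \<le> e * 1"
        using e C by (intro mult_left_mono) auto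
      finally show ?thesis by (simp add: \<psi>_def algebra_simps)
    qed
    then show ?thesis using d by blast
  qed
  have "\<bar>a \<bullet> A b - b \<bullet> A a\<bar> \<le> 2 * e" if e: "e > 0" for e
  proof -
    obtain d1 where d1: "d1 > 0" "\<And>s. 0 < s \<and> s < d1 \<Longrightarrow>
      \<bar>(f (x + s *\<^sub>R a + s *\<^sub>R b) - f (x + s *\<^sub>R a) - f (x + s *\<^sub>R b) + f x) / s\<^sup>2 - a \<bullet> A b\<bar> \<le> e"
      using approx[OF e, of a b] by blast
    obtain d2 where d2: "d2 > 0" "\<And>s. 0 < s \<and> s < d2 \<Longrightarrow>
      \<bar>(f (x + s *\<^sub>R b + s *\<^sub>R a) - f (x + s *\<^sub>R b) - f (x + s *\<^sub>R a) + f x) / s\<^sup>2 - b \<bullet> A a\<bar> \<le> e"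
      using approx[OF e, of b a] by blast
    define s where "s = min d1 d2 / 2"
    have s: "0 < s" "s < d1" "s < d2" using d1(1) d2(1) by (auto simp: s_def)
    have sym: "f (x + s *\<^sub>R b + s *\<^sub>R a) - f (x + s *\<^sub>R b) - f (x + s *\<^sub>R a) + f x =
        f (x + s *\<^sub>R a + s *\<^sub>R b) - f (x + s *\<^sub>R a) - f (x + s *\<^sub>R b) + f x"
      by (simp add: add.assoc add.commute[of "s *\<^sub>R b"])
    show ?thesis
      using d1(2)[of s] d2(2)[of s] s unfolding sym by linarith
  qed
  from this[of "\<bar>a \<bullet> A b - b \<bullet> A a\<bar> / 4"] have "a \<bullet> A b = b \<bullet> A a"
    by (cases "a \<bullet> A b = b \<bullet> A a") auto
  then show ?thesis by (simp add: inner_commute)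
qed

text \<open>A derivative within a set \<open>S\<close> can be evaluated on every direction \<open>h\<close> that is a limit of secants of \<open>S\<close>.\<close>

lemma directional_limit_within:
  fixes \<phi> :: "'a::euclidean_space \<Rightarrow> 'b::real_normed_vector"
  assumes \<phi>: "(\<phi> has_derivative D) (at q within S)"
    and x: "\<And>k. x k \<in> S" and \<epsilon>: "\<And>k. \<epsilon> k > (0::real)" "\<epsilon> \<longlonglongrightarrow> 0"
    and h: "(\<lambda>k. (x k - q) /\<^sub>R \<epsilon> k) \<longlonglongrightarrow> h"
  shows "(\<lambda>k. (\<phi> (x k) - \<phi> q) /\<^sub>R \<epsilon> k) \<longlonglongrightarrow> D h"
proof -
  have bl: "bounded_linear D" using \<phi> has_derivative_bounded_linear by blast
  have Dlim: "(\<lambda>k. D ((x k - q) /\<^sub>R \<epsilon> k)) \<longlonglongrightarrow> D h"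
    using bl h by (rule bounded_linear.tendsto)
  have "(\<lambda>k. \<epsilon> k *\<^sub>R ((x k - q) /\<^sub>R \<epsilon> k)) \<longlonglongrightarrow> 0 *\<^sub>R h"
    by (intro tendsto_scaleR \<epsilon>(2) h)
  moreover have "\<epsilon> k *\<^sub>R ((x k - q) /\<^sub>R \<epsilon> k) = x k - q" for k
    using \<epsilon>(1)[of k] by simp
  ultimately have xq: "(\<lambda>k. x k - q) \<longlonglongrightarrow> 0" by simp
  have "Bseq (\<lambda>k. (x k - q) /\<^sub>R \<epsilon> k)" using h convergent_imp_Bseq convergentI by blast
  then obtain B where B: "B > 0" "\<And>k. norm ((x k - q) /\<^sub>R \<epsilon> k) \<le> B" by (auto elim: BseqE)
  have "(\<lambda>k. (\<phi> (x k) - \<phi> q) /\<^sub>R \<epsilon> k - D ((x k - q) /\<^sub>R \<epsilon> k)) \<longlonglongrightarrow> 0"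
  proof (rule LIMSEQ_I)
    fix r :: real assume r: "r > 0"
    obtain d where d: "d > 0" "\<And>y. y \<in> S \<Longrightarrow> norm (y - q) < d \<Longrightarrow>
        norm (\<phi> y - \<phi> q - D (y - q)) \<le> r / (2 * B) * norm (y - q)"
      using \<phi> r B unfolding has_derivative_within_alt
      by (metis divide_pos_pos mult_pos_pos zero_less_numeral)
    obtain n0 where n0: "\<And>k. k \<ge> n0 \<Longrightarrow> norm (x k - q) < d"
      using LIMSEQ_D[OF xq d(1)] by auto
    have "norm ((\<phi> (x k) - \<phi> q) /\<^sub>R \<epsilon> k - D ((x k - q) /\<^sub>R \<epsilon> k) - 0) < r" if "k \<ge> n0" for k
    proof -
      have "(\<phi> (x k) - \<phi> q) /\<^sub>R \<epsilon> k - D ((x k - q) /\<^sub>R \<epsilon> k) = (\<phi> (x k) - \<phi> q - D (x k - q)) /\<^sub>R \<epsilon> k"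
        using bl by (simp add: linear_simps scaleR_diff_right)
      then have "norm ((\<phi> (x k) - \<phi> q) /\<^sub>R \<epsilon> k - D ((x k - q) /\<^sub>R \<epsilon> k) - 0)
          = norm (\<phi> (x k) - \<phi> q - D (x k - q)) / \<epsilon> k"
        using \<epsilon>(1)[of k] by (simp add: divide_inverse)
      also have "\<dots> \<le> r / (2 * B) * norm (x k - q) / \<epsilon> k"
        using d(2)[OF x n0[OF that]] \<epsilon>(1)[of k] by (intro divide_right_mono) auto
      also have "\<dots> = r / (2 * B) * (norm (x k - q) / \<epsilon> k)"
        by (rule times_divide_eq_right[symmetric])
      also have "norm (x k - q) / \<epsilon> k = norm ((x k - q) /\<^sub>R \<epsilon> k)"
        by (simp only: norm_scaleR abs_inverse abs_of_pos[OF \<epsilon>(1)] divide_inverse mult.commute)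
      also have "r / (2 * B) * norm ((x k - q) /\<^sub>R \<epsilon> k) \<le> r / (2 * B) * B"
      proof (rule mult_left_mono)
        show "norm ((x k - q) /\<^sub>R \<epsilon> k) \<le> B" by (rule B(2))
        show "0 \<le> r / (2 * B)" using B(1) r by simp
      qed
      also have "\<dots> < r" using B(1) r by simp
      finally show ?thesis .
    qed
    then show "\<exists>n0. \<forall>k\<ge>n0. norm ((\<phi> (x k) - \<phi> q) /\<^sub>R \<epsilon> k - D ((x k - q) /\<^sub>R \<epsilon> k) - 0) < r" by blast
  qed
  from tendsto_add[OF this Dlim] show ?thesis by simp
qed

text \<open>Every vector orthogonal to the gradient is a limit of secants of the level set. Near \<open>q\<close>, the function changes sign along the
short segment from \<open>q + \<epsilon> (h - \<delta> g q)\<close> to \<open>q + \<epsilon> (h + \<delta> g q)\<close>, so it has a zero there; then let \<open>\<delta>\<close>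
tend to \<open>0\<close>.\<close>

lemma level_set_tangent_sequence:
  fixes f :: "'a::euclidean_space \<Rightarrow> real"
  assumes U: "open U" "q \<in> U" and fq: "f q = 0"
    and f: "\<And>y. y \<in> U \<Longrightarrow> (f has_derivative (\<lambda>h. g y \<bullet> h)) (at y)"
    and gq: "g q \<noteq> 0" and h: "g q \<bullet> h = 0"
  obtains x \<epsilon> where "\<And>k. x k \<in> U" "\<And>k. f (x k) = 0" "\<And>k::nat. \<epsilon> k > (0::real)" "\<epsilon> \<longlonglongrightarrow> 0"
    "(\<lambda>k. (x k - q) /\<^sub>R \<epsilon> k) \<longlonglongrightarrow> h"
proof -
  let ?n = "g q"
  have step: "\<exists>\<epsilon> x. 0 < \<epsilon> \<and> \<epsilon> < \<delta> \<and> x \<in> U \<and> f x = 0 \<and> norm ((x - q) /\<^sub>R \<epsilon> - h) \<le> \<delta> * norm ?n"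
    if \<delta>: "\<delta> > 0" for \<delta> :: real
  proof -
    obtain r where r: "r > 0" "ball q r \<subseteq> U" using U openE by blast
    have nn: "?n \<bullet> ?n > 0" using gq by simp
    \<comment> \<open>\<open>L\<close> bounds the speed of the curve \<open>p\<close>; the linear term \<open>\<epsilon> * \<delta> * (?n \<bullet> ?n)\<close> at the ends of the segment
      is then twice the error term.\<close>
    define L where "L = norm h + \<delta> * norm ?n + 1"
    have L: "L > 0" using \<delta> by (simp add: L_def add_nonneg_pos)
    have "\<delta> * (?n \<bullet> ?n) / (2 * L) > 0" using \<delta> nn L by simp
    then obtain d where d: "d > 0" "\<And>y. norm (y - q) < d \<Longrightarrow> \<bar>f y - f q - ?n \<bullet> (y - q)\<bar> \<le> \<delta> * (?n \<bullet> ?n) / (2 * L) * norm (y - q)"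
      using f[OF U(2)] unfolding has_derivative_at_alt by (metis real_norm_def)
    define \<epsilon> where "\<epsilon> = min (\<delta> / 2) (min r d / (2 * L))"
    have \<epsilon>: "0 < \<epsilon>" "\<epsilon> < \<delta>" using \<delta> r d L by (auto simp: \<epsilon>_def)
    have "\<epsilon> \<le> min r d / (2 * L)" by (simp add: \<epsilon>_def)
    then have "\<epsilon> * (2 * L) \<le> min r d" using L by (simp add: pos_le_divide_eq)
    moreover have "\<epsilon> * (2 * L) = 2 * (\<epsilon> * L)" by simp
    moreover have "\<epsilon> * L > 0" using \<epsilon> L by simp
    ultimately have \<epsilon>L: "\<epsilon> * L < min r d" by linarith
    define p where "p = (\<lambda>s. q + \<epsilon> *\<^sub>R (h + s *\<^sub>R ?n))"
    have np: "norm (p s - q) \<le> \<epsilon> * L" if "\<bar>s\<bar> \<le> \<delta>" for s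
    proof -
      have "norm (h + s *\<^sub>R ?n) \<le> norm h + \<bar>s\<bar> * norm ?n"
        using norm_triangle_ineq[of h "s *\<^sub>R ?n"] by simp
      also have "\<dots> \<le> L" using mult_right_mono[OF that, of "norm ?n"] by (simp add: L_def)
      finally show ?thesis using \<epsilon> by (simp add: p_def)
    qed
    have pU: "p s \<in> U" if "\<bar>s\<bar> \<le> \<delta>" for s
      using np[OF that] \<epsilon>L r by (auto simp: subset_iff dist_norm norm_minus_commute)
    have val: "\<bar>f (p s) - \<epsilon> * s * (?n \<bullet> ?n)\<bar> \<le> \<epsilon> * \<delta> * (?n \<bullet> ?n) / 2" if "\<bar>s\<bar> \<le> \<delta>" for s
    proof -
      have "?n \<bullet> (p s - q) = \<epsilon> * s * (?n \<bullet> ?n)"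
        using h by (simp add: p_def inner_add_right)
      then have "\<bar>f (p s) - \<epsilon> * s * (?n \<bullet> ?n)\<bar> \<le> \<delta> * (?n \<bullet> ?n) / (2 * L) * norm (p s - q)"
        using d(2)[of "p s"] np[OF that] \<epsilon>L fq by simp
      also have "\<dots> \<le> \<delta> * (?n \<bullet> ?n) / (2 * L) * (\<epsilon> * L)"
        using np[OF that] \<delta> nn L by (intro mult_left_mono) auto
      also have "\<dots> = \<epsilon> * \<delta> * (?n \<bullet> ?n) / 2" using L by simp
      finally show ?thesis .
    qed
    define X where "X = \<epsilon> * \<delta> * (?n \<bullet> ?n)"
    have pos: "X > 0" using \<epsilon> \<delta> nn by (simp add: X_def)
    have "\<bar>f (p \<delta>) - X\<bar> \<le> X / 2" using val[of \<delta>] \<delta> unfolding X_def by simp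
    then have "f (p \<delta>) \<ge> 0" using pos by linarith
    have "\<bar>f (p (-\<delta>)) - (- X)\<bar> \<le> X / 2" using val[of "-\<delta>"] \<delta> unfolding X_def by simp
    then have "f (p (-\<delta>)) \<le> 0" using pos by linarith
    moreover note \<open>f (p \<delta>) \<ge> 0\<close>
    moreover have "continuous_on {-\<delta>..\<delta>} (\<lambda>s. f (p s))"
    proof -
      have "continuous_on U f" using f by (metis continuous_at_imp_continuous_on has_derivative_continuous)
      moreover have "continuous_on {-\<delta>..\<delta>} p" unfolding p_def by (intro continuous_intros)
      moreover have "p ` {-\<delta>..\<delta>} \<subseteq> U" using pU by (auto simp: abs_le_iff)
      ultimately show ?thesis using continuous_on_compose2 by blast
    qed
    ultimately obtain s where s: "-\<delta> \<le> s" "s \<le> \<delta>" "f (p s) = 0"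
      using IVT'[of "\<lambda>s. f (p s)" "-\<delta>" 0 \<delta>] \<delta> by auto
    have "(p s - q) /\<^sub>R \<epsilon> - h = s *\<^sub>R ?n" using \<epsilon> by (simp add: p_def)
    then have "norm ((p s - q) /\<^sub>R \<epsilon> - h) \<le> \<delta> * norm ?n"
      using s by (simp add: mult_right_mono abs_le_iff)
    with s \<epsilon> pU[of s] show ?thesis by (intro exI[of _ \<epsilon>] exI[of _ "p s"]) auto
  qed
  have "\<exists>\<epsilon> x. 0 < \<epsilon> \<and> \<epsilon> < inverse (real (Suc k)) \<and> x \<in> U \<and> f x = 0 \<and>
      norm ((x - q) /\<^sub>R \<epsilon> - h) \<le> inverse (real (Suc k)) * norm ?n" for k
    by (rule step) simp
  then obtain \<epsilon> x where *: "\<And>k. 0 < \<epsilon> k" "\<And>k. \<epsilon> k < inverse (real (Suc k))" "\<And>k. x k \<in> U" "\<And>k. f (x k) = 0"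
      "\<And>k. norm ((x k - q) /\<^sub>R \<epsilon> k - h) \<le> inverse (real (Suc k)) * norm ?n"
    by metis
  have "\<epsilon> \<longlonglongrightarrow> 0"
    by (rule tendsto_sandwich[OF _ _ tendsto_const LIMSEQ_inverse_real_of_nat])
      (use * in \<open>auto intro!: always_eventually less_imp_le\<close>)
  moreover have "(\<lambda>k. (x k - q) /\<^sub>R \<epsilon> k - h) \<longlonglongrightarrow> 0"
  proof (rule Lim_null_comparison)
    show "\<forall>\<^sub>F k in sequentially. norm ((x k - q) /\<^sub>R \<epsilon> k - h) \<le> inverse (real (Suc k)) * norm ?n"
      using * by simp
    show "(\<lambda>k. inverse (real (Suc k)) * norm ?n) \<longlonglongrightarrow> 0"
      using tendsto_mult_left_zero[OF LIMSEQ_inverse_real_of_nat] by simp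
  qed
  then have "(\<lambda>k. (x k - q) /\<^sub>R \<epsilon> k) \<longlonglongrightarrow> h" by (simp add: LIM_zero_iff)
  ultimately show ?thesis using * that by blast
qed

section \<open>Inner normals of a smooth convex body\<close>

lemma normalized_has_derivative:
  fixes g :: "'a::real_normed_vector \<Rightarrow> 'b::real_inner"
  assumes g: "(g has_derivative A) (at x)" and nz: "g x \<noteq> 0"
  defines "n \<equiv> g x /\<^sub>R norm (g x)"
  shows "((\<lambda>y. g y /\<^sub>R norm (g y)) has_derivative (\<lambda>h. (A h - (n \<bullet> A h) *\<^sub>R n) /\<^sub>R norm (g x))) (at x)"
proof -
  have norm: "((\<lambda>y. norm (g y)) has_derivative (\<lambda>h. n \<bullet> A h)) (at x)"
    using has_derivative_compose[OF g has_derivative_norm[OF nz]]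
    by (rule has_derivative_eq_rhs) (simp add: n_def sgn_div_norm inner_commute)
  have "((\<lambda>y. inverse (norm (g y))) has_derivative (\<lambda>h. - (inverse (norm (g x)) * (n \<bullet> A h) * inverse (norm (g x))))) (at x)"
    using nz by (intro Deriv.has_derivative_inverse norm) simp
  from has_derivative_scaleR[OF this g]
  show ?thesis
    by (rule has_derivative_eq_rhs) (auto simp: n_def algebra_simps fun_eq_iff)
qed

locale smooth_convex_body =
  fixes K :: "(real^'n) set"
  assumes body: "convex_body K" and smooth: "C2_boundary K"
begin

definition supports :: "real^'n \<Rightarrow> real^'n \<Rightarrow> bool" where
  "supports u q \<longleftrightarrow> (\<forall>x\<in>K. u \<bullet> q \<le> u \<bullet> x)"

abbreviation N :: "real^'n \<Rightarrow> real^'n" where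
  "N \<equiv> inner_unit_normal K"

lemma compact_K: "compact K" and convex_K: "convex K" and closed_K: "closed K"
  and interior_nonempty: "interior K \<noteq> {}"
  using body by (auto simp: convex_body_def compact_imp_closed)

lemma frontier_subset_K: "frontier K \<subseteq> K"
  using closed_K by (simp add: frontier_subset_closed)

text \<open>A linear function that is nonzero is not minimal at an interior point.\<close>

lemma supports_strict:
  assumes c: "c \<in> interior K" and u: "u \<noteq> 0" and s: "supports u q"
  shows "u \<bullet> q < u \<bullet> c"
proof -
  obtain r where r: "r > 0" "ball c r \<subseteq> K"
    using c by (auto simp: mem_interior)
  have "c - (r / (2 * norm u)) *\<^sub>R u \<in> ball c r"
    using r u by (simp add: dist_norm)
  then have "u \<bullet> q \<le> u \<bullet> (c - (r / (2 * norm u)) *\<^sub>R u)"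
    using s r unfolding supports_def by blast
  also have "\<dots> = u \<bullet> c - r / 2 * norm u"
    using u by (simp add: inner_diff_right dot_square_norm power2_eq_square)
  also have "\<dots> < u \<bullet> c" using r u by simp
  finally show ?thesis .
qed

lemma supports_frontier:
  assumes "q \<in> K" "u \<noteq> 0" "supports u q" shows "q \<in> frontier K"
proof -
  have "q \<notin> interior K" using supports_strict[of q u q] assms by blast
  then show ?thesis using assms(1) closure_subset[of K] unfolding frontier_def by blast
qed

lemma ex_supports:
  assumes q: "q \<in> frontier K"
  obtains u where "norm u = 1" "supports u q"
proof -
  have "q \<in> closure K" "q \<notin> rel_interior K"
    using q interior_nonempty by (auto simp: frontier_def interior_rel_interior_gen rel_interior_nonempty_interior)
  then obtain a where a: "a \<noteq> 0" "\<And>y. y \<in> closure K \<Longrightarrow> a \<bullet> q \<le> a \<bullet> y"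
    using supporting_hyperplane_rel_boundary[OF convex_closure[OF convex_K], of q]
    by (metis convex_K convex_rel_interior_closure)
  have "supports (a /\<^sub>R norm a) q"
    unfolding supports_def using a closure_subset[of K] by (auto intro!: divide_right_mono simp: divide_inverse mult.commute[of "inverse _"])
  with a(1) show ?thesis by (intro that[of "a /\<^sub>R norm a"]) simp_all
qed

definition chart :: "(real^'n) set \<Rightarrow> (real^'n \<Rightarrow> real) \<Rightarrow> (real^'n \<Rightarrow> real^'n) \<Rightarrow> (real^'n \<Rightarrow> real^'n^'n) \<Rightarrow> bool" where
  "chart U f g H \<longleftrightarrow> open U \<and>
     (\<forall>x\<in>U. (f has_derivative (\<lambda>h. g x \<bullet> h)) (at x)) \<and>
     (\<forall>x\<in>U. (g has_derivative (\<lambda>h. H x *v h)) (at x)) \<and>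
     continuous_on U H \<and> (\<forall>x\<in>U. g x \<noteq> 0) \<and> frontier K \<inter> U = {x\<in>U. f x = 0}"

lemma ex_chart:
  assumes "q \<in> frontier K"
  obtains U f g H where "q \<in> U" "chart U f g H"
proof -
  have "\<exists>U f g. open U \<and> q \<in> U \<and> C2_function_on U f g \<and>
     (\<forall>x\<in>U. g x \<noteq> 0) \<and> frontier K \<inter> U = {x\<in>U. f x = 0}"
    using smooth[unfolded C2_boundary_def] assms by (rule bspec)
  then show thesis
  proof (elim exE conjE)
    fix U f g
    assume U: "open U" "q \<in> U" "C2_function_on U f g" "\<forall>x\<in>U. g x \<noteq> 0"
      "frontier K \<inter> U = {x\<in>U. f x = 0}"
    from U(3) show thesis
      unfolding C2_function_on_def
    proof (elim exE conjE)
      fix H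
      assume "\<forall>x\<in>U. (f has_derivative (\<lambda>h. g x \<bullet> h)) (at x)"
        "\<forall>x\<in>U. (g has_derivative (\<lambda>h. H x *v h)) (at x)" "continuous_on U H"
      with U have "chart U f g H" unfolding chart_def by (intro conjI)
      with U(2) show thesis by (rule that)
    qed
  qed
qed

lemma chartD:
  assumes "chart U f g H"
  shows "open U"
    and "x \<in> U \<Longrightarrow> (f has_derivative (\<lambda>h. g x \<bullet> h)) (at x)"
    and "x \<in> U \<Longrightarrow> (g has_derivative (\<lambda>h. H x *v h)) (at x)"
    and "continuous_on U H" and "x \<in> U \<Longrightarrow> g x \<noteq> 0"
    and "x \<in> U \<Longrightarrow> x \<in> frontier K \<longleftrightarrow> f x = 0"
  using assms unfolding chart_def by (simp_all add: set_eq_iff) blast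

lemma chart_tangent_sequence:
  assumes ch: "chart U f g H" and q: "q \<in> frontier K" "q \<in> U" and h: "g q \<bullet> h = 0"
  obtains x \<epsilon> where "\<And>k. x k \<in> frontier K" "\<And>k::nat. \<epsilon> k > (0::real)" "\<epsilon> \<longlonglongrightarrow> 0"
    "(\<lambda>k. (x k - q) /\<^sub>R \<epsilon> k) \<longlonglongrightarrow> h"
proof -
  have U: "open U" "f q = 0" "g q \<noteq> 0"
      "\<And>y. y \<in> U \<Longrightarrow> (f has_derivative (\<lambda>h. g y \<bullet> h)) (at y)"
    and level: "frontier K \<inter> U = {x\<in>U. f x = 0}"
    using ch q unfolding chart_def by blast+
  show ?thesis
  proof (rule level_set_tangent_sequence[OF U(1) q(2) U(2,4,3) h])
    fix x \<epsilon>
    assume x: "\<And>k. x k \<in> U" "\<And>k. f (x k) = 0" "\<And>k::nat. \<epsilon> k > (0::real)" "\<epsilon> \<longlonglongrightarrow> 0"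
      "(\<lambda>k. (x k - q) /\<^sub>R \<epsilon> k) \<longlonglongrightarrow> h"
    have "x k \<in> frontier K" for k using x(1,2)[of k] level by blast
    then show thesis by (rule that[OF _ x(3-5)])
  qed
qed

text \<open>A supporting vector is nonnegative on all tangent vectors, since the secants of the boundary stay in \<open>K\<close>. It
therefore vanishes on them and is a multiple of the gradient.\<close>

lemma chart_normal_parallel:
  assumes ch: "chart U f g H" and q: "q \<in> frontier K" "q \<in> U" and s: "supports u q"
  shows "u = ((u \<bullet> g q) / (g q \<bullet> g q)) *\<^sub>R g q"
proof -
  have nonneg: "u \<bullet> h \<ge> 0" if h: "g q \<bullet> h = 0" for h
  proof -
    obtain x \<epsilon> where x: "\<And>k. x k \<in> frontier K" "\<And>k::nat. \<epsilon> k > (0::real)" "\<epsilon> \<longlonglongrightarrow> 0"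
      "(\<lambda>k. (x k - q) /\<^sub>R \<epsilon> k) \<longlonglongrightarrow> h"
      using chart_tangent_sequence[OF ch q h] by blast
    have "(\<lambda>k. u \<bullet> ((x k - q) /\<^sub>R \<epsilon> k)) \<longlonglongrightarrow> u \<bullet> h"
      by (intro tendsto_intros x)
    moreover have "u \<bullet> ((x k - q) /\<^sub>R \<epsilon> k) \<ge> 0" for k
    proof -
      have "u \<bullet> q \<le> u \<bullet> x k" using s x(1)[of k] frontier_subset_K by (auto simp: supports_def)
      then have "0 \<le> inverse (\<epsilon> k) * (u \<bullet> (x k - q))"
        using x(2)[of k] by (intro mult_nonneg_nonneg) (auto simp: inner_diff_right)
      then show ?thesis by simp
    qed
    ultimately show ?thesis by (intro LIMSEQ_le_const) auto
  qed
  define h where "h = u - ((u \<bullet> g q) / (g q \<bullet> g q)) *\<^sub>R g q"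
  have gq: "g q \<noteq> 0" using ch q by (auto simp: chart_def)
  then have gh: "g q \<bullet> h = 0" by (simp add: h_def inner_diff_right inner_commute)
  then have "u \<bullet> h = 0" using nonneg[of h] nonneg[of "- h"] by simp
  then have "h \<bullet> h = 0" using gh by (simp add: h_def inner_diff_left)
  then show ?thesis by (simp add: h_def)
qed

text \<open>Two supporting unit vectors are multiples of the same gradient, and a point of the interior fixes their common sign.\<close>

lemma inner_unit_normal_props:
  assumes q: "q \<in> frontier K"
  shows norm_N: "norm (N q) = 1" and supports_N: "supports (N q) q"
    and N_eqI: "\<And>u. norm u = 1 \<Longrightarrow> supports u q \<Longrightarrow> N q = u"
proof -
  obtain c where c: "c \<in> interior K" using interior_nonempty by blast
  obtain U f g H where ch: "q \<in> U" "chart U f g H" using ex_chart[OF q] by blast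
  obtain u where u: "norm u = 1" "supports u q" using ex_supports[OF q] by blast
  have uniq: "w = u" if w: "norm w = 1" "supports w q" for w
  proof -
    define a b where "a = (u \<bullet> g q) / (g q \<bullet> g q)" and "b = (w \<bullet> g q) / (g q \<bullet> g q)"
    have ua: "u = a *\<^sub>R g q" and wb: "w = b *\<^sub>R g q"
      unfolding a_def b_def using chart_normal_parallel[OF ch(2) q ch(1)] u w by blast+
    have "u \<noteq> 0" "w \<noteq> 0" using u(1) w(1) by auto
    then have "u \<bullet> (c - q) > 0" "w \<bullet> (c - q) > 0"
      using supports_strict[OF c _ u(2)] supports_strict[OF c _ w(2)]
      by (auto simp: inner_diff_right)
    then have "a * (g q \<bullet> (c - q)) > 0" "b * (g q \<bullet> (c - q)) > 0"
      unfolding ua wb by simp_all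
    moreover have "\<bar>a\<bar> * norm (g q) = \<bar>b\<bar> * norm (g q)"
      using u(1) w(1) unfolding ua wb by simp
    moreover have "norm (g q) \<noteq> 0" using u(1) ua by auto
    ultimately have "\<bar>a\<bar> = \<bar>b\<bar>" "a > 0 \<longleftrightarrow> b > 0"
      by (simp_all add: zero_less_mult_iff) linarith+
    then have "a = b" by linarith
    then show "w = u" using ua wb by simp
  qed
  have "N q = u"
    unfolding inner_unit_normal_def
  proof (rule the_equality)
    show "norm u = 1 \<and> (\<forall>x\<in>K. u \<bullet> q \<le> u \<bullet> x)" using u unfolding supports_def by blast
    show "w = u" if "norm w = 1 \<and> (\<forall>x\<in>K. w \<bullet> q \<le> w \<bullet> x)" for w
      using uniq[of w] that unfolding supports_def by blast
  qed
  then show "norm (N q) = 1" "supports (N q) q" "\<And>u. norm u = 1 \<Longrightarrow> supports u q \<Longrightarrow> N q = u"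
    using u uniq by blast+
qed

text \<open>A chart whose function increases towards the interior of \<open>K\<close>.\<close>

definition oriented_chart where
  "oriented_chart U f g H \<longleftrightarrow> chart U f g H \<and> (\<forall>x\<in>frontier K \<inter> U. N x = g x /\<^sub>R norm (g x))"

lemma oriented_chartD:
  assumes "oriented_chart U f g H"
  shows "chart U f g H" and "x \<in> frontier K \<Longrightarrow> x \<in> U \<Longrightarrow> N x = g x /\<^sub>R norm (g x)"
  using assms unfolding oriented_chart_def by simp_all

text \<open>The gradient of a defining function is never orthogonal to the direction of a fixed interior point, so its orientation is
locally constant; if necessary, change the sign of the function.\<close>

lemma ex_oriented_chart:
  assumes q: "q \<in> frontier K"
  obtains U f g H where "q \<in> U" "oriented_chart U f g H"
proof -
  obtain c where c: "c \<in> interior K" using interior_nonempty by blast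
  obtain U f g H where ch: "q \<in> U" "chart U f g H" using ex_chart[OF q] by blast
  have cg: "continuous_on U g"
  proof (intro continuous_at_imp_continuous_on ballI)
    fix x assume "x \<in> U"
    then have "(g has_derivative (\<lambda>h. H x *v h)) (at x)" using ch(2) by (simp add: chart_def)
    then show "isCont g x" by (rule has_derivative_continuous)
  qed
  have key: "g x \<bullet> (c - x) \<noteq> 0 \<and> N x = (sgn (g x \<bullet> (c - x)) / norm (g x)) *\<^sub>R g x"
    if x: "x \<in> frontier K" "x \<in> U" for x
  proof -
    define a where "a = (N x \<bullet> g x) / (g x \<bullet> g x)"
    have Na: "N x = a *\<^sub>R g x"
      unfolding a_def using chart_normal_parallel[OF ch(2) x] supports_N[OF x(1)] by blast
    have "N x \<noteq> 0" using norm_N[OF x(1)] by auto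
    then have "N x \<bullet> (c - x) > 0"
      using supports_strict[OF c _ supports_N[OF x(1)]] by (simp add: inner_diff_right)
    then have pos: "a * (g x \<bullet> (c - x)) > 0" by (simp add: Na)
    have "\<bar>a\<bar> * norm (g x) = 1" using norm_N[OF x(1)] by (simp add: Na)
    then have "\<bar>a\<bar> = 1 / norm (g x)" by (metis nonzero_eq_divide_eq mult_zero_right zero_neq_one)
    then have "a = sgn (g x \<bullet> (c - x)) / norm (g x)"
      using pos by (auto simp: zero_less_mult_iff)
    then show ?thesis using Na pos by auto
  qed
  define s where "s = sgn (g q \<bullet> (c - q))"
  define V where "V = {x\<in>U. s * (g x \<bullet> (c - x)) > 0}"
  have s: "s = 1 \<or> s = -1" using key[OF q ch(1)] by (auto simp: s_def sgn_if)
  have "open V"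
  proof -
    have "continuous_on U (\<lambda>x. s * (g x \<bullet> (c - x)))" by (intro continuous_intros cg)
    then have "open (U \<inter> (\<lambda>x. s * (g x \<bullet> (c - x))) -` {0<..})"
      by (rule continuous_open_preimage[OF _ chartD(1)[OF ch(2)]]) simp
    also have "U \<inter> (\<lambda>x. s * (g x \<bullet> (c - x))) -` {0<..} = V" by (auto simp: V_def)
    finally show ?thesis .
  qed
  have VU: "V \<subseteq> U" by (auto simp: V_def)
  have "oriented_chart V (\<lambda>x. s * f x) (\<lambda>x. s *\<^sub>R g x) (\<lambda>x. s *\<^sub>R H x)"
    unfolding oriented_chart_def chart_def
  proof (intro conjI ballI)
    show "open V" by fact
    show "frontier K \<inter> V = {x \<in> V. s * f x = 0}" using chartD(6)[OF ch(2)] s VU by auto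
    show "continuous_on V (\<lambda>x. s *\<^sub>R H x)"
      by (intro continuous_intros continuous_on_subset[OF chartD(4)[OF ch(2)] VU])
    fix x assume x: "x \<in> V"
    then have f: "(f has_derivative (\<lambda>h. g x \<bullet> h)) (at x)" and g: "(g has_derivative (\<lambda>h. H x *v h)) (at x)"
      and g0: "g x \<noteq> 0"
      using chartD(2,3,5)[OF ch(2)] VU by blast+
    show "((\<lambda>x. s * f x) has_derivative (\<lambda>h. (s *\<^sub>R g x) \<bullet> h)) (at x)"
      using has_derivative_mult_right[OF f, of s] by (rule has_derivative_eq_rhs) simp
    show "((\<lambda>x. s *\<^sub>R g x) has_derivative (\<lambda>h. (s *\<^sub>R H x) *v h)) (at x)"
      using has_derivative_scaleR_right[OF g, of s]
      by (rule has_derivative_eq_rhs) (simp add: scaleR_matrix_vector_assoc)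
    show "s *\<^sub>R g x \<noteq> 0" using s g0 by auto
  next
    fix x assume x: "x \<in> frontier K \<inter> V"
    then have xU: "x \<in> frontier K" "x \<in> U" and "s * (g x \<bullet> (c - x)) > 0" by (auto simp: V_def)
    then have "sgn (g x \<bullet> (c - x)) = s" using s by (auto simp: sgn_if zero_less_mult_iff)
    then show "N x = (s *\<^sub>R g x) /\<^sub>R norm (s *\<^sub>R g x)"
      using key[OF xU] s by (auto simp: divide_inverse mult.commute)
  qed
  moreover have "q \<in> V"
    using key[OF q ch(1)] ch(1) by (auto simp: V_def s_def sgn_if)
  ultimately show ?thesis using that by blast
qed

text \<open>The derivative of the normalised gradient.\<close>

definition normal_derivative :: "(real^'n \<Rightarrow> real^'n) \<Rightarrow> (real^'n \<Rightarrow> real^'n^'n) \<Rightarrow> real^'n \<Rightarrow> real^'n \<Rightarrow> real^'n" where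
  "normal_derivative g H x h =
     (let n = g x /\<^sub>R norm (g x) in (H x *v h - (n \<bullet> (H x *v h)) *\<^sub>R n) /\<^sub>R norm (g x))"

lemma N_has_derivative:
  assumes ch: "oriented_chart U f g H" and x: "x \<in> frontier K" "x \<in> U"
  shows "(N has_derivative normal_derivative g H x) (at x within frontier K)"
proof -
  note c = oriented_chartD(1)[OF ch]
  note U = chartD(1)[OF c] and g = chartD(3,5)[OF c x(2)]
  have D: "((\<lambda>y. g y /\<^sub>R norm (g y)) has_derivative normal_derivative g H x) (at x within frontier K)"
    using normalized_has_derivative[OF g] unfolding normal_derivative_def Let_def
    by (rule has_derivative_at_withinI)
  obtain r where r: "r > 0" "ball x r \<subseteq> U" using U x openE by blast
  show ?thesis
  proof (rule has_derivative_transform_within[OF D r(1) x(1)])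
    fix y assume "y \<in> frontier K" "dist y x < r"
    moreover from this have "y \<in> U" using r(2) by (auto simp: dist_commute)
    ultimately show "g y /\<^sub>R norm (g y) = N y" using oriented_chartD(2)[OF ch] by simp
  qed
qed

text \<open>Principal curvatures are defined by an arbitrary derivative of the normal field within the boundary. On tangent
vectors all of them agree, so the one given by a chart can be used.\<close>

lemma N_derivative_unique_on_tangent:
  assumes D: "(N has_derivative D) (at q within frontier K)" "(N has_derivative D') (at q within frontier K)"
    and q: "q \<in> frontier K" and w: "w \<bullet> N q = 0"
  shows "D w = D' w"
proof -
  obtain U f g H where ch: "q \<in> U" "oriented_chart U f g H" using ex_oriented_chart[OF q] by blast
  note ch' = oriented_chartD(1)[OF ch(2)]
  have "N q = g q /\<^sub>R norm (g q)" "g q \<noteq> 0"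
    using oriented_chartD(2)[OF ch(2) q ch(1)] chartD(5)[OF ch' ch(1)] by auto
  then have "g q \<bullet> w = 0" using w by (auto simp: inner_commute)
  then obtain x \<epsilon> where x: "\<And>k. x k \<in> frontier K" "\<And>k::nat. \<epsilon> k > (0::real)" "\<epsilon> \<longlonglongrightarrow> 0"
      "(\<lambda>k. (x k - q) /\<^sub>R \<epsilon> k) \<longlonglongrightarrow> w"
    using chart_tangent_sequence[OF ch' q ch(1)] by blast
  show ?thesis
    using LIMSEQ_unique[OF directional_limit_within[OF D(1) x] directional_limit_within[OF D(2) x]] .
qed

end

section \<open>The boundary has no flat points\<close>

context smooth_convex_body begin

text \<open>The derivative of the normal field on the tangent space, completed by the identity on the normal line. This
is a self-adjoint map of the whole space that depends continuously on \<open>x\<close>, and it is singular exactly where a principal curvature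
vanishes.\<close>

definition completed_derivative :: "(real^'n \<Rightarrow> real^'n) \<Rightarrow> (real^'n \<Rightarrow> real^'n^'n) \<Rightarrow> real^'n \<Rightarrow> real^'n \<Rightarrow> real^'n" where
  "completed_derivative g H x h = (let n = g x /\<^sub>R norm (g x) in
     normal_derivative g H x (h - (n \<bullet> h) *\<^sub>R n) + (n \<bullet> h) *\<^sub>R n)"

lemma linear_normal_derivative: "linear (normal_derivative g H x)"
  by (rule linearI) (simp_all add: normal_derivative_def Let_def algebra_simps inner_add_right
      matrix_vector_right_distrib matrix_vector_mult_scaleR)

lemma linear_completed_derivative: "linear (completed_derivative g H x)"
proof (rule linearI)
  define n where "n = g x /\<^sub>R norm (g x)"
  have c: "completed_derivative g H x h = normal_derivative g H x (h - (n \<bullet> h) *\<^sub>R n) + (n \<bullet> h) *\<^sub>R n" for h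
    by (simp add: completed_derivative_def n_def Let_def)
  note lin = linear_normal_derivative[of g H x]
  fix a b :: "real^'n" and r :: real
  have E1: "a + b - (n \<bullet> (a + b)) *\<^sub>R n = (a - (n \<bullet> a) *\<^sub>R n) + (b - (n \<bullet> b) *\<^sub>R n)"
    by (simp add: inner_add_right algebra_simps)
  show "completed_derivative g H x (a + b) = completed_derivative g H x a + completed_derivative g H x b"
    unfolding c E1 linear_add[OF lin] by (simp add: inner_add_right scaleR_add_left)
  have E2: "r *\<^sub>R a - (n \<bullet> (r *\<^sub>R a)) *\<^sub>R n = r *\<^sub>R (a - (n \<bullet> a) *\<^sub>R n)"
    by (simp add: algebra_simps)
  show "completed_derivative g H x (r *\<^sub>R a) = r *\<^sub>R completed_derivative g H x a"
    unfolding c E2 linear_scale[OF lin] by (simp add: scaleR_add_right)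
qed

lemma completed_derivative_selfadjoint:
  assumes ch: "chart U f g H" and x: "x \<in> U"
  shows "completed_derivative g H x a \<bullet> b = a \<bullet> completed_derivative g H x b"
proof -
  define n where "n = g x /\<^sub>R norm (g x)"
  define P where "P = (\<lambda>h. h - (n \<bullet> h) *\<^sub>R n)"
  have c: "completed_derivative g H x h = P (H x *v P h) /\<^sub>R norm (g x) + (n \<bullet> h) *\<^sub>R n" for h
    by (simp add: completed_derivative_def normal_derivative_def n_def P_def Let_def)
  have P: "P y \<bullet> z = y \<bullet> P z" for y z
    by (simp add: P_def inner_diff_left inner_diff_right inner_commute)
  have H: "(H x *v y) \<bullet> z = y \<bullet> (H x *v z)" for y z
    using gradient_derivative_selfadjoint[OF chartD(1)[OF ch] x chartD(2)[OF ch] chartD(3)[OF ch x]]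
    by simp
  have "P (H x *v P a) \<bullet> b = a \<bullet> P (H x *v P b)"
    by (simp add: P H)
  then show ?thesis
    by (simp add: c inner_add_left inner_add_right inner_commute[of n])
qed

lemma completed_derivative_tangent:
  assumes "h \<bullet> g x = 0" shows "completed_derivative g H x h = normal_derivative g H x h"
  using assms by (simp add: completed_derivative_def Let_def inner_commute)

lemma completed_derivative_normal:
  assumes "g x \<noteq> 0" shows "completed_derivative g H x h \<bullet> g x = h \<bullet> g x"
proof -
  define n where "n = g x /\<^sub>R norm (g x)"
  have gn: "g x = norm (g x) *\<^sub>R n" using assms by (simp add: n_def)
  have nn: "n \<bullet> n = 1" using assms by (simp add: n_def dot_square_norm power2_eq_square)
  define y where "y = H x *v (h - (n \<bullet> h) *\<^sub>R n)"
  have "completed_derivative g H x h = (y - (n \<bullet> y) *\<^sub>R n) /\<^sub>R norm (g x) + (n \<bullet> h) *\<^sub>R n"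
    by (simp add: completed_derivative_def normal_derivative_def Let_def n_def[symmetric] y_def)
  then have "completed_derivative g H x h \<bullet> n = h \<bullet> n"
    by (simp add: inner_add_left inner_diff_left nn inner_commute[of n y] inner_commute[of n h])
  then show ?thesis by (subst (1 2) gn) simp
qed

lemma continuous_on_det_completed_derivative:
  assumes ch: "chart U f g H"
  shows "continuous_on U (\<lambda>x. det (matrix (completed_derivative g H x)))"
proof -
  have g: "continuous_on U g"
    by (intro continuous_at_imp_continuous_on ballI has_derivative_continuous[OF chartD(3)[OF ch]])
  have H: "continuous_on U H" by (rule chartD(4)[OF ch])
  have mv: "continuous_on U (\<lambda>x. H x *v k x)" if "continuous_on U k" for k
    unfolding matrix_vector_mult_def using that H by (intro continuous_intros)
  have nz: "\<forall>x\<in>U. norm (g x) \<noteq> 0" using chartD(5)[OF ch] by simp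
  have n: "continuous_on U (\<lambda>x. g x /\<^sub>R norm (g x))"
    using nz by (intro continuous_intros g)
  have "continuous_on U (\<lambda>x. completed_derivative g H x h)" for h
    unfolding completed_derivative_def normal_derivative_def Let_def
    by (intro continuous_intros g mv n nz)
  then show ?thesis
    unfolding det_def matrix_def by (simp, intro continuous_intros)
qed

lemma det_completed_derivative_eq_0_iff:
  assumes ch: "oriented_chart U f g H" and x: "x \<in> frontier K" "x \<in> U"
  shows "det (matrix (completed_derivative g H x)) = 0 \<longleftrightarrow> principal_curvature_at K x 0"
proof -
  note c = oriented_chartD(1)[OF ch]
  have g0: "g x \<noteq> 0" by (rule chartD(5)[OF c x(2)])
  have perp: "v \<bullet> N x = 0 \<longleftrightarrow> v \<bullet> g x = 0" for v
    using oriented_chartD(2)[OF ch x] g0 by simp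
  have "det (matrix (completed_derivative g H x)) = 0 \<longleftrightarrow> (\<exists>v. v \<noteq> 0 \<and> completed_derivative g H x v = 0)"
    using det_nz_iff_inj[OF linear_completed_derivative, of g H x]
      linear_injective_0[OF linear_completed_derivative, of g H x] by blast
  also have "\<dots> \<longleftrightarrow> principal_curvature_at K x 0"
  proof
    assume "\<exists>v. v \<noteq> 0 \<and> completed_derivative g H x v = 0"
    then obtain v where v: "v \<noteq> 0" "completed_derivative g H x v = 0" by blast
    then have t: "v \<bullet> g x = 0" using completed_derivative_normal[where g = g and x = x and H = H and h = v, OF g0] by simp
    then have "normal_derivative g H x v = 0" using v completed_derivative_tangent by simp
    then show "principal_curvature_at K x 0"
      unfolding principal_curvature_at_def using N_has_derivative[OF ch x] v(1) t perp by auto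
  next
    assume "principal_curvature_at K x 0"
    then obtain D v where D: "(N has_derivative D) (at x within frontier K)"
      and v: "v \<noteq> 0" "v \<bullet> N x = 0" "D v = 0"
      unfolding principal_curvature_at_def by auto
    have "normal_derivative g H x v = 0"
      using N_derivative_unique_on_tangent[OF D N_has_derivative[OF ch x] x(1) v(2)] v(3) by simp
    then show "\<exists>v. v \<noteq> 0 \<and> completed_derivative g H x v = 0"
      using v perp completed_derivative_tangent by auto
  qed
  finally show ?thesis .
qed

text \<open>Let \<open>q\<close> be a point of \<open>K\<close> with the greatest norm, so \<open>q = - norm q * N q\<close>. If the normal field were stationary in a tangent
direction \<open>v\<close>, then for boundary points \<open>x\<close> near \<open>q + \<epsilon> v\<close> the inequality \<open>N x \<bullet> (x - q) \<le> 0\<close> would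
give \<open>N q \<bullet> (x - q) \<le> o(\<epsilon>\<^sup>2)\<close>. But \<open>norm x \<le> norm q\<close> requires
\<open>\<epsilon>\<^sup>2 (v \<bullet> v) \<le> 2 * norm q * (N q \<bullet> (x - q))\<close> up to \<open>o(\<epsilon>\<^sup>2)\<close>.\<close>

lemma farthest_point_not_flat:
  obtains q where "q \<in> frontier K" "\<not> principal_curvature_at K q 0"
proof -
  have "K \<noteq> {}" using interior_nonempty by auto
  then obtain q where q: "q \<in> K" "\<And>x. x \<in> K \<Longrightarrow> norm x \<le> norm q"
    using continuous_attains_sup[OF compact_K, of norm] continuous_on_norm_id by blast
  have q0: "q \<noteq> 0"
  proof
    assume "q = 0"
    then have "K \<subseteq> {0}" using q by auto
    then have "interior K \<subseteq> interior {0}" by (rule interior_mono)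
    then show False using interior_nonempty by simp
  qed
  have s: "supports (- q) q"
    unfolding supports_def
  proof
    fix x assume "x \<in> K"
    have "q \<bullet> x \<le> norm q * norm x" by (rule norm_cauchy_schwarz)
    also have "\<dots> \<le> norm q * norm q" using q(2)[OF \<open>x \<in> K\<close>] by (intro mult_left_mono) auto
    finally show "- q \<bullet> q \<le> - q \<bullet> x" by (simp add: dot_square_norm power2_eq_square)
  qed
  have qf: "q \<in> frontier K" using supports_frontier[OF q(1) _ s] q0 by simp
  have "supports (- q /\<^sub>R norm q) q"
    using s q0 unfolding supports_def by (simp add: divide_right_mono)
  then have Nq: "N q = - q /\<^sub>R norm q" using N_eqI[OF qf] q0 by simp
  have "\<not> principal_curvature_at K q 0"
  proof
    assume "principal_curvature_at K q 0"
    then obtain D v where D: "(N has_derivative D) (at q within frontier K)"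
      and v: "v \<noteq> 0" "v \<bullet> N q = 0" "D v = 0"
      unfolding principal_curvature_at_def by auto
    obtain U f g H where ch: "q \<in> U" "oriented_chart U f g H" using ex_oriented_chart[OF qf] by blast
    have gv: "g q \<bullet> v = 0"
      using v(2) oriented_chartD(2)[OF ch(2) qf ch(1)] chartD(5)[OF oriented_chartD(1)[OF ch(2)] ch(1)]
      by (simp add: inner_commute)
    obtain x \<epsilon> where x: "\<And>k. x k \<in> frontier K" "\<And>k::nat. \<epsilon> k > (0::real)" "\<epsilon> \<longlonglongrightarrow> 0"
      "(\<lambda>k. (x k - q) /\<^sub>R \<epsilon> k) \<longlonglongrightarrow> v"
      using chart_tangent_sequence[OF oriented_chartD(1)[OF ch(2)] qf ch(1) gv] by blast
    have z: "(\<lambda>k. (N (x k) - N q) /\<^sub>R \<epsilon> k) \<longlonglongrightarrow> 0"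
      using directional_limit_within[OF D x] v(3) by simp
    \<comment> \<open>The secants of the boundary and of the normal field; \<open>w\<close> tends to \<open>v\<close> and \<open>y\<close> to \<open>0\<close>.\<close>
    define w where "w = (\<lambda>k. (x k - q) /\<^sub>R \<epsilon> k)"
    define y where "y = (\<lambda>k. (N (x k) - N q) /\<^sub>R \<epsilon> k)"
    have le: "w k \<bullet> w k \<le> - (2 * norm q) * (y k \<bullet> w k)" for k
    proof -
      have e: "\<epsilon> k \<noteq> 0" using x(2)[of k] by simp
      have xq: "x k = q + \<epsilon> k *\<^sub>R w k" and Nx: "N (x k) = N q + \<epsilon> k *\<^sub>R y k"
        using e by (simp_all add: w_def y_def)
      have "N (x k) \<bullet> x k \<le> N (x k) \<bullet> q"
        using supports_N[OF x(1)] q(1) by (auto simp: supports_def)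
      then have "\<epsilon> k * (N (x k) \<bullet> w k) \<le> 0" by (simp add: xq inner_add_right)
      then have 1: "N (x k) \<bullet> w k \<le> 0" using x(2)[of k] by (simp add: mult_le_0_iff)
      have "norm (x k) \<le> norm q" using q(2) x(1) frontier_subset_K by blast
      then have "x k \<bullet> x k \<le> q \<bullet> q" by (simp add: norm_le)
      then have "\<epsilon> k * (2 * (q \<bullet> w k) + \<epsilon> k * (w k \<bullet> w k)) \<le> 0"
        by (simp add: xq inner_add_left inner_add_right inner_commute algebra_simps)
      then have 2: "2 * (q \<bullet> w k) + \<epsilon> k * (w k \<bullet> w k) \<le> 0" using x(2)[of k] by (simp add: mult_le_0_iff)
      have qN: "q \<bullet> w k = - norm q * (N q \<bullet> w k)" using q0 by (simp add: Nq)
      have "2 * norm q * (N (x k) \<bullet> w k) \<le> 0" using 1 by (simp add: mult_le_0_iff)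
      then have "\<epsilon> k * (w k \<bullet> w k) \<le> \<epsilon> k * (- (2 * norm q) * (y k \<bullet> w k))"
        using 2 unfolding qN Nx by (simp add: inner_add_left algebra_simps)
      then show ?thesis using x(2)[of k] by (simp only: mult_le_cancel_left_pos)
    qed
    have "(\<lambda>k. w k \<bullet> w k) \<longlonglongrightarrow> v \<bullet> v" "(\<lambda>k. - (2 * norm q) * (y k \<bullet> w k)) \<longlonglongrightarrow> - (2 * norm q) * (0 \<bullet> v)"
      using x(4) z unfolding w_def y_def by (intro tendsto_intros; simp)+
    then have "v \<bullet> v \<le> - (2 * norm q) * (0 \<bullet> v)" using le by (intro LIMSEQ_le) auto
    then have "v \<bullet> v \<le> 0" by simp
    moreover have "v \<bullet> v > 0" using v(1) inner_gt_zero_iff by blast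
    ultimately show False by linarith
  qed
  with qf that show thesis by blast
qed

end

locale enclosed_curvature_body = smooth_convex_body K for K :: "(real^'n) set" +
  assumes dim: "CARD('n) \<ge> 2" and centres: "centres_of_curvature K \<subseteq> K"
begin

lemma principal_curvature_centre:
  assumes "q \<in> frontier K" "principal_curvature_at K q \<kappa>" "\<kappa> \<noteq> 0"
  shows "q + (1 / \<kappa>) *\<^sub>R N q \<in> K"
  using centres assms unfolding centres_of_curvature_def by blast

text \<open>An eigenvector of the completed derivative that is not tangent has eigenvalue \<open>1\<close>. A tangent one belongs to a principal curvature;
if that is not zero, the centre of curvature lies in \<open>K\<close>, so the radius of curvature is at most the diameter of \<open>K\<close>.
The determinant is the product of the eigenvalues.\<close>

lemma det_completed_derivative_gap:
  obtains \<delta> where "\<delta> > 0"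
    "\<And>U f g H x. oriented_chart U f g H \<Longrightarrow> x \<in> frontier K \<Longrightarrow> x \<in> U \<Longrightarrow>
       \<not> principal_curvature_at K x 0 \<Longrightarrow> \<bar>det (matrix (completed_derivative g H x))\<bar> \<ge> \<delta>"
proof -
  obtain B where B: "\<And>x. x \<in> K \<Longrightarrow> norm x \<le> B" "B > 0"
    using compact_imp_bounded[OF compact_K] bounded_pos by blast
  \<comment> \<open>A bound for the radii of curvature, at least \<open>1\<close> so that \<open>1 / d\<close> also bounds the eigenvalue of the normal direction.\<close>
  define d where "d = 2 * B + 1"
  have d: "d \<ge> 1" using B by (simp add: d_def)
  have "\<bar>det (matrix (completed_derivative g H x))\<bar> \<ge> (1 / d) ^ CARD('n)"
    if ch: "oriented_chart U f g H" and x: "x \<in> frontier K" "x \<in> U" and nf: "\<not> principal_curvature_at K x 0"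
    for U f g H x
  proof -
    let ?M = "completed_derivative g H x"
    note c = oriented_chartD(1)[OF ch]
    have g0: "g x \<noteq> 0" by (rule chartD(5)[OF c x(2)])
    obtain e :: "'n \<Rightarrow> real^'n" and l where e: "orthonormal_family e" "\<And>i. ?M (e i) = l i *\<^sub>R e i"
      using selfadjoint_eigenbasis[OF linear_completed_derivative completed_derivative_selfadjoint[OF c x(2)]] by blast
    have det: "det (matrix ?M) = (\<Prod>i\<in>UNIV. l i)"
      by (rule det_orthonormal_eigenbasis[OF linear_completed_derivative e])
    have l0: "l i \<noteq> 0" for i
      using nf det_completed_derivative_eq_0_iff[OF ch x] unfolding det by auto
    have "1 / d \<le> \<bar>l i\<bar>" for i
    proof (cases "e i \<bullet> g x = 0")
      case False
      have "l i * (e i \<bullet> g x) = e i \<bullet> g x"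
        using completed_derivative_normal[where g = g and x = x and H = H and h = "e i", OF g0] e(2)[of i] by simp
      then have "l i = 1" using False by simp
      then show ?thesis using d by simp
    next
      case True
      have "norm (e i) = 1" using e(1) by (simp add: orthonormal_family_def norm_eq_1)
      then have e0: "e i \<noteq> 0" by auto
      have "- normal_derivative g H x (e i) = (- l i) *\<^sub>R e i"
        using completed_derivative_tangent[where g = g and x = x and H = H and h = "e i", OF True] e(2)[of i] by simp
      moreover have "e i \<bullet> N x = 0" using True oriented_chartD(2)[OF ch x] by simp
      ultimately have "principal_curvature_at K x (- l i)"
        unfolding principal_curvature_at_def using N_has_derivative[OF ch x] e0 by blast
      then have "x + (1 / - l i) *\<^sub>R N x \<in> K"
        using principal_curvature_centre[OF x(1), of "- l i"] l0[of i] by (metis neg_equal_0_iff_equal)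
      then have "norm (x + (1 / - l i) *\<^sub>R N x) \<le> B" by (rule B(1))
      moreover have "norm x \<le> B" using B(1) x(1) frontier_subset_K by blast
      moreover have "norm ((1 / - l i) *\<^sub>R N x) \<le> norm (x + (1 / - l i) *\<^sub>R N x) + norm x"
        using norm_triangle_ineq4[of "x + (1 / - l i) *\<^sub>R N x" x] by simp
      moreover have "norm ((1 / - l i) *\<^sub>R N x) = 1 / \<bar>l i\<bar>"
        using norm_N[OF x(1)] by simp
      ultimately have "1 / \<bar>l i\<bar> \<le> d" unfolding d_def by linarith
      then show ?thesis using l0[of i] d by (simp add: field_simps)
    qed
    then have "(\<Prod>i\<in>(UNIV::'n set). 1 / d) \<le> (\<Prod>i\<in>UNIV. \<bar>l i\<bar>)"
      using d by (intro prod_mono) auto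
    then show ?thesis by (simp add: det abs_prod)
  qed
  moreover have "(1 / d) ^ CARD('n) > 0" using d by simp
  ultimately show ?thesis using that by blast
qed

text \<open>The determinant of the completed derivative is continuous, and none of its values on the boundary lies strictly between \<open>0\<close> and \<open>\<delta>\<close> in absolute value.\<close>

lemma flatness_locally_constant:
  assumes q: "q \<in> frontier K"
  obtains V where "open V" "q \<in> V"
    "\<And>x. x \<in> frontier K \<inter> V \<Longrightarrow> principal_curvature_at K x 0 \<longleftrightarrow> principal_curvature_at K q 0"
proof -
  obtain \<delta> where \<delta>: "\<delta> > 0"
    "\<And>U f g H x. oriented_chart U f g H \<Longrightarrow> x \<in> frontier K \<Longrightarrow> x \<in> U \<Longrightarrow>
       \<not> principal_curvature_at K x 0 \<Longrightarrow> \<bar>det (matrix (completed_derivative g H x))\<bar> \<ge> \<delta>"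
    using det_completed_derivative_gap by blast
  obtain U f g H where ch: "q \<in> U" "oriented_chart U f g H" using ex_oriented_chart[OF q] by blast
  note c = oriented_chartD(1)[OF ch(2)]
  let ?d = "\<lambda>x. det (matrix (completed_derivative g H x))"
  have iff: "?d x = 0 \<longleftrightarrow> principal_curvature_at K x 0" if "x \<in> frontier K" "x \<in> U" for x
    using det_completed_derivative_eq_0_iff[OF ch(2) that] .
  define V where "V = U \<inter> ?d -` ball (?d q) \<delta>"
  have "open V"
    unfolding V_def
    by (rule continuous_open_preimage[OF continuous_on_det_completed_derivative[OF c] chartD(1)[OF c]]) simp
  moreover have "q \<in> V" using ch(1) \<delta>(1) by (simp add: V_def)
  moreover have "principal_curvature_at K x 0 \<longleftrightarrow> principal_curvature_at K q 0"
    if x: "x \<in> frontier K \<inter> V" for x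
  proof -
    have xU: "x \<in> frontier K" "x \<in> U" and close: "\<bar>?d q - ?d x\<bar> < \<delta>"
      using x by (auto simp: V_def dist_real_def)
    show ?thesis
      using \<delta>(2)[OF ch(2) xU] \<delta>(2)[OF ch(2) q ch(1)] iff[OF xU] iff[OF q ch(1)] close by auto
  qed
  ultimately show ?thesis by (rule that)
qed

text \<open>Flatness is locally constant on the boundary, which is connected because the dimension is at least \<open>2\<close>.\<close>

lemma not_flat:
  assumes q: "q \<in> frontier K" shows "\<not> principal_curvature_at K q 0"
proof -
  have "frontier K = rel_frontier K"
    using interior_nonempty by (simp add: rel_frontier_nonempty_interior)
  moreover have "aff_dim K \<noteq> 1"
    using interior_nonempty dim by (simp add: aff_dim_nonempty_interior)
  ultimately have conn: "connected (frontier K)"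
    using connected_sphere_gen[OF convex_K compact_imp_bounded[OF compact_K]] by simp
  obtain p where p: "p \<in> frontier K" "\<not> principal_curvature_at K p 0"
    by (rule farthest_point_not_flat)
  have "\<forall>a\<in>frontier K. eventually (\<lambda>b. principal_curvature_at K a 0 = principal_curvature_at K b 0) (at a within frontier K)"
  proof
    fix a assume "a \<in> frontier K"
    then obtain V where "open V" "a \<in> V"
      "\<And>x. x \<in> frontier K \<inter> V \<Longrightarrow> principal_curvature_at K x 0 \<longleftrightarrow> principal_curvature_at K a 0"
      using flatness_locally_constant by blast
    then show "eventually (\<lambda>b. principal_curvature_at K a 0 = principal_curvature_at K b 0) (at a within frontier K)"
      unfolding eventually_at_topological by blast
  qed
  from connected_local_const[OF conn p(1) q this] p(2) show ?thesis by blast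
qed

end

section \<open>The boundary point with a given inner normal\<close>

text \<open>Differentiability of an implicitly given map: if \<open>E \<circ> q\<close> is differentiable and \<open>E\<close> has an injective derivative, then
the continuous map \<open>q\<close> is differentiable. After composing with a left inverse of \<open>E'\<close>, the increments of \<open>E \<circ> q\<close> and of \<open>q\<close>
differ by a small multiple of the latter.\<close>

lemma has_derivative_of_composition:
  fixes q :: "'a::real_normed_vector \<Rightarrow> 'b::euclidean_space" and E :: "'b \<Rightarrow> 'b"
  assumes q: "isCont q a" and E: "(E has_derivative E') (at (q a))" and inj: "inj E'"
    and comp: "((\<lambda>x. E (q x)) has_derivative k) (at a)"
  obtains B where "(q has_derivative B) (at a)"
proof -
  have lE: "linear E'" using E has_derivative_linear by blast
  then obtain G where G: "linear G" "G \<circ> E' = id"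
    using inj linear_injective_left_inverse by blast
  then have bG: "bounded_linear G" by (simp add: linear_conv_bounded_linear)
  have bk: "bounded_linear k" using comp has_derivative_bounded_linear by blast
  have GE: "G (E' h) = h" for h using G(2) by (metis comp_apply id_apply)
  define F where "F = (\<lambda>y. G (E y))"
  have F: "(F has_derivative (\<lambda>h. h)) (at (q a))"
    unfolding F_def using bounded_linear.has_derivative[OF bG E] by (simp add: GE)
  have Fk: "((\<lambda>x. F (q x)) has_derivative (\<lambda>h. G (k h))) (at a)"
    unfolding F_def by (rule bounded_linear.has_derivative[OF bG comp])
  have "bounded_linear (\<lambda>h. G (k h))" using bounded_linear_compose[OF bG bk] .
  then obtain C where C: "C > 0" "\<And>h. norm (G (k h)) \<le> norm h * C"
    using bounded_linear.pos_bounded by blast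
  have "(q has_derivative (\<lambda>h. G (k h))) (at a)"
    unfolding has_derivative_at_alt
  proof (intro conjI allI impI)
    show "bounded_linear (\<lambda>h. G (k h))" by fact
    fix e :: real assume e: "e > 0"
    \<comment> \<open>\<open>e1 \<le> 1/2\<close> and \<open>e2 \<le> 1\<close> make \<open>norm (q x - q a)\<close> at most \<open>2 * (C + 1) * norm (x - a)\<close>; the other bounds leave \<open>e / 2\<close>
      for each of the two errors.\<close>
    define e1 where "e1 = min (1/2) (e / (2 * (2 * (C + 1) + 1)))"
    define e2 where "e2 = min 1 (e / 2)"
    have c0: "2 * (2 * (C + 1) + 1) > 0" using C(1) by simp
    have e1: "e1 > 0" unfolding e1_def using divide_pos_pos[OF e c0] by simp
    have e1': "e1 \<le> 1/2" "e1 \<le> e / (2 * (2 * (C + 1) + 1))"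
      unfolding e1_def by (rule min.cobounded1, rule min.cobounded2)
    have e2: "e2 > 0" unfolding e2_def using e by simp
    have e2': "e2 \<le> 1" "e2 \<le> e / 2"
      unfolding e2_def by (rule min.cobounded1, rule min.cobounded2)
    obtain d1 where d1: "d1 > 0" "\<And>y. norm (y - q a) < d1 \<Longrightarrow> norm (F y - F (q a) - (y - q a)) \<le> e1 * norm (y - q a)"
      using F e1 unfolding has_derivative_at_alt by blast
    obtain d2 where d2: "d2 > 0" "\<And>x. norm (x - a) < d2 \<Longrightarrow> norm (F (q x) - F (q a) - G (k (x - a))) \<le> e2 * norm (x - a)"
      using Fk e2 unfolding has_derivative_at_alt by blast
    obtain d3 where d3: "d3 > 0" "\<And>x. norm (x - a) < d3 \<Longrightarrow> norm (q x - q a) < d1"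
      using q d1(1) unfolding continuous_at_eps_delta by (auto simp: dist_norm)
    have "norm (q x - q a - G (k (x - a))) \<le> e * norm (x - a)" if x: "norm (x - a) < min d2 d3" for x
    proof -
      let ?\<delta> = "q x - q a" and ?n = "norm (x - a)"
      let ?r = "F (q x) - F (q a) - ?\<delta>" and ?s = "F (q x) - F (q a) - G (k (x - a))"
      have r: "norm ?r \<le> e1 * norm ?\<delta>" using d1(2) d3(2) x by simp
      have s: "norm ?s \<le> e2 * ?n" using d2(2) x by simp
      have Gk: "norm (G (k (x - a))) \<le> ?n * C" by (rule C(2))
      have "norm ?\<delta> \<le> norm ?r + norm ?s + norm (G (k (x - a)))"
      proof -
        have "norm ?\<delta> = norm ((?s - ?r) + G (k (x - a)))" by simp
        then show ?thesis
          using norm_triangle_ineq[of "?s - ?r" "G (k (x - a))"] norm_triangle_ineq4[of ?s ?r] by linarith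
      qed
      also have "\<dots> \<le> 1/2 * norm ?\<delta> + 1 * ?n + ?n * C"
        using r s Gk mult_right_mono[OF e1'(1) norm_ge_zero, of ?\<delta>]
          mult_right_mono[OF e2'(1) norm_ge_zero, of "x - a"] by linarith
      finally have \<delta>: "norm ?\<delta> \<le> (2 * (C + 1)) * ?n" by (simp add: algebra_simps)
      have "norm (?\<delta> - G (k (x - a))) \<le> norm ?s + norm ?r"
      proof -
        have "?\<delta> - G (k (x - a)) = ?s - ?r" by simp
        then show ?thesis using norm_triangle_ineq4[of ?s ?r] by (simp only:)
      qed
      also have "\<dots> \<le> e2 * ?n + e1 * norm ?\<delta>" using r s by simp
      also have "\<dots> \<le> e / 2 * ?n + e / (2 * (2 * (C + 1) + 1)) * ((2 * (C + 1)) * ?n)"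
      proof (rule add_mono)
        show "e2 * ?n \<le> e / 2 * ?n" by (rule mult_right_mono[OF e2'(2)]) simp
        show "e1 * norm ?\<delta> \<le> e / (2 * (2 * (C + 1) + 1)) * ((2 * (C + 1)) * ?n)"
          by (rule mult_mono[OF e1'(2) \<delta>]) (use divide_pos_pos[OF e c0] in simp_all)
      qed
      also have "\<dots> \<le> e / 2 * ?n + e / 2 * ?n"
      proof -
        have "e / (2 * (2 * (C + 1) + 1)) * (2 * (C + 1)) \<le> e / 2"
          using e C(1) by (simp add: field_simps)
        then have "e / (2 * (2 * (C + 1) + 1)) * (2 * (C + 1)) * ?n \<le> e / 2 * ?n"
          by (rule mult_right_mono) simp
        then show ?thesis by (intro add_left_mono) (simp only: mult.assoc)
      qed
      also have "\<dots> = e * ?n" by simp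
      finally show ?thesis .
    qed
    then show "\<exists>d>0. \<forall>y. norm (y - a) < d \<longrightarrow> norm (q y - q a - G (k (y - a))) \<le> e * norm (y - a)"
      using d2(1) d3(1) by (intro exI[of _ "min d2 d3"]) auto
  qed
  then show ?thesis by (rule that)
qed

context enclosed_curvature_body begin

lemma tangent_kernel_trivial:
  assumes "q \<in> frontier K" "(N has_derivative D) (at q within frontier K)" "v \<bullet> N q = 0" "D v = 0"
  shows "v = 0"
  using not_flat[OF assms(1)] assms unfolding principal_curvature_at_def by auto

lemma N_eq_normalized:
  assumes "v \<noteq> 0" "q \<in> K" "supports v q"
  shows "q \<in> frontier K" "N q = v /\<^sub>R norm v"
proof -
  show q: "q \<in> frontier K" using supports_frontier assms by blast
  have "supports (v /\<^sub>R norm v) q"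
    unfolding supports_def
  proof
    fix x assume "x \<in> K"
    then have "v \<bullet> q \<le> v \<bullet> x" using assms(3) by (simp add: supports_def)
    then have "inverse (norm v) * (v \<bullet> q) \<le> inverse (norm v) * (v \<bullet> x)" by (intro mult_left_mono) auto
    then show "(v /\<^sub>R norm v) \<bullet> q \<le> (v /\<^sub>R norm v) \<bullet> x" by simp
  qed
  then show "N q = v /\<^sub>R norm v" using N_eqI[OF q] assms(1) by simp
qed

text \<open>If \<open>v\<close> is an inner normal vector at two points, then also on the segment between them. There the normal field is constant, so
the direction of the segment is in the kernel of its derivative.\<close>

lemma supports_unique:
  assumes v: "v \<noteq> 0" and q: "q \<in> K" "supports v q" and p: "p \<in> K" "supports v p"
  shows "p = q"
proof -
  have qf: "q \<in> frontier K" using N_eq_normalized v q by blast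
  obtain U f g H where ch: "q \<in> U" "oriented_chart U f g H" using ex_oriented_chart[OF qf] by blast
  note D = N_has_derivative[OF ch(2) qf ch(1)]
  have eq: "v \<bullet> p = v \<bullet> q" using p q unfolding supports_def by (metis order_antisym)
  define \<epsilon> where "\<epsilon> = (\<lambda>k::nat. inverse (real (Suc k)))"
  define x where "x = (\<lambda>k. q + \<epsilon> k *\<^sub>R (p - q))"
  have \<epsilon>: "\<epsilon> k > 0" "\<epsilon> k \<le> 1" for k by (simp_all add: \<epsilon>_def inverse_le_1_iff)
  have \<epsilon>0: "\<epsilon> \<longlonglongrightarrow> 0" unfolding \<epsilon>_def by (rule LIMSEQ_inverse_real_of_nat)
  have xK: "x k \<in> K" for k
  proof -
    have "x k = (1 - \<epsilon> k) *\<^sub>R q + \<epsilon> k *\<^sub>R p" by (simp add: x_def algebra_simps)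
    then show ?thesis using convexD[OF convex_K q(1) p(1), of "1 - \<epsilon> k" "\<epsilon> k"] \<epsilon>[of k] by simp
  qed
  have "supports v (x k)" for k
  proof -
    have "v \<bullet> x k = v \<bullet> q" using eq by (simp add: x_def inner_add_right inner_diff_right)
    then show ?thesis using q(2) by (simp add: supports_def)
  qed
  then have xf: "x k \<in> frontier K" and Nx: "N (x k) = N q" for k
    using N_eq_normalized[OF v xK] N_eq_normalized[OF v q] by simp_all
  have "(\<lambda>k. (x k - q) /\<^sub>R \<epsilon> k) = (\<lambda>k. p - q)"
    using \<epsilon>(1) by (auto simp: x_def less_imp_neq[THEN not_sym])
  then have lim: "(\<lambda>k. (x k - q) /\<^sub>R \<epsilon> k) \<longlonglongrightarrow> p - q" by simp
  have "(\<lambda>k. 0) \<longlonglongrightarrow> normal_derivative g H q (p - q)"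
    using directional_limit_within[OF D xf \<epsilon>(1) \<epsilon>0 lim] by (simp add: Nx)
  then have "normal_derivative g H q (p - q) = 0"
    using LIMSEQ_unique[OF tendsto_const] by metis
  moreover have "(p - q) \<bullet> N q = 0"
    using N_eq_normalized(2)[OF v q] eq by (simp add: inner_diff_right inner_commute[of "p - q"])
  ultimately have "p - q = 0" using tangent_kernel_trivial[OF qf D] by blast
  then show ?thesis by simp
qed

definition foot :: "real^'n \<Rightarrow> real^'n" where
  "foot v = (SOME q. q \<in> K \<and> supports v q)"

lemma foot_in_K: "foot v \<in> K" and supports_foot: "supports v (foot v)"
proof -
  have "K \<noteq> {}" using interior_nonempty by auto
  then obtain q where "q \<in> K" "\<forall>x\<in>K. v \<bullet> q \<le> v \<bullet> x"
    using continuous_attains_inf[OF compact_K, of "\<lambda>x. v \<bullet> x"]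
      continuous_on_inner[OF continuous_on_const continuous_on_id, of K v] by blast
  then have "\<exists>q. q \<in> K \<and> supports v q" by (auto simp: supports_def)
  then have "foot v \<in> K \<and> supports v (foot v)" unfolding foot_def by (rule someI_ex)
  then show "foot v \<in> K" "supports v (foot v)" by auto
qed

lemma foot_eqI: "v \<noteq> 0 \<Longrightarrow> q \<in> K \<Longrightarrow> supports v q \<Longrightarrow> foot v = q"
  using supports_unique[of v q "foot v"] foot_in_K supports_foot by blast

lemma foot_frontier: "v \<noteq> 0 \<Longrightarrow> foot v \<in> frontier K"
  and N_foot: "v \<noteq> 0 \<Longrightarrow> N (foot v) = v /\<^sub>R norm v"
  using N_eq_normalized foot_in_K supports_foot by blast+

lemma foot_le: "x \<in> K \<Longrightarrow> v \<bullet> foot v \<le> v \<bullet> x"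
  using supports_foot by (simp add: supports_def)

lemma foot_scale:
  assumes "v \<noteq> 0" "t > 0" shows "foot (t *\<^sub>R v) = foot v"
  using assms foot_in_K foot_le by (intro foot_eqI) (auto simp: supports_def)

text \<open>The graph is closed, because it is cut out by weak inequalities, and the values lie in a compact set.\<close>

lemma continuous_on_foot: "continuous_on (- {0}) foot"
proof (subst continuous_closed_graph_eq[OF compact_K])
  show "foot \<in> (- {0}) \<rightarrow> K" using foot_in_K by auto
  have "(\<lambda>v. (v, foot v)) ` (- {0}) = ((- {0}) \<times> K) \<inter> (\<Inter>x\<in>K. {(v, q). v \<bullet> q \<le> v \<bullet> x})"
  proof (intro equalityI subsetI)
    fix z assume "z \<in> (\<lambda>v. (v, foot v)) ` (- {0})"
    then show "z \<in> ((- {0}) \<times> K) \<inter> (\<Inter>x\<in>K. {(v, q). v \<bullet> q \<le> v \<bullet> x})"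
      using foot_in_K foot_le by auto
  next
    fix z assume "z \<in> ((- {0}) \<times> K) \<inter> (\<Inter>x\<in>K. {(v, q). v \<bullet> q \<le> v \<bullet> x})"
    then obtain v q where z: "z = (v, q)" "v \<noteq> 0" "q \<in> K" "supports v q"
      by (auto simp: supports_def)
    then have "foot v = q" by (intro foot_eqI)
    then show "z \<in> (\<lambda>v. (v, foot v)) ` (- {0})" using z by auto
  qed
  moreover have "closed (\<Inter>x\<in>K. {(v, q). v \<bullet> q \<le> v \<bullet> x})"
    unfolding case_prod_beta by (intro closed_INT ballI closed_Collect_le continuous_intros)
  ultimately show "closedin (top_of_set ((- {0}) \<times> K)) ((\<lambda>v. (v, foot v)) ` (- {0}))"
    by (simp add: closedin_closed_Int)
qed

lemma isCont_foot: "v \<noteq> 0 \<Longrightarrow> isCont foot v"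
  using continuous_on_foot by (simp add: continuous_on_eq_continuous_at open_Compl)

text \<open>The envelope theorem: minimality of \<open>foot v\<close> and of \<open>foot w\<close> traps the remainder between \<open>0\<close> and
\<open>(foot w - foot v) \<bullet> (w - v)\<close>, which is \<open>o(norm (w - v))\<close> as \<open>foot\<close> is continuous.\<close>

lemma support_function_has_derivative:
  assumes v: "v \<noteq> 0"
  shows "((\<lambda>v. v \<bullet> foot v) has_derivative (\<lambda>h. foot v \<bullet> h)) (at v)"
  unfolding has_derivative_at_alt
proof (intro conjI allI impI)
  show "bounded_linear (\<lambda>h. foot v \<bullet> h)" by (rule bounded_linear_inner_right)
  fix e :: real assume "e > 0"
  then obtain d where d: "d > 0" "\<And>w. norm (w - v) < d \<Longrightarrow> norm (foot w - foot v) < e"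
    using isCont_foot[OF v] unfolding continuous_at_eps_delta by (auto simp: dist_norm)
  have "norm (w \<bullet> foot w - v \<bullet> foot v - foot v \<bullet> (w - v)) \<le> e * norm (w - v)" if "norm (w - v) < d" for w
  proof -
    have 1: "w \<bullet> foot w \<le> w \<bullet> foot v" "v \<bullet> foot v \<le> v \<bullet> foot w"
      using foot_le foot_in_K by blast+
    have "\<bar>(foot w - foot v) \<bullet> (w - v)\<bar> \<le> norm (foot w - foot v) * norm (w - v)"
      by (rule Cauchy_Schwarz_ineq2)
    also have "\<dots> \<le> e * norm (w - v)" using d(2)[OF that] by (intro mult_right_mono) auto
    finally have "\<bar>(foot w - foot v) \<bullet> (w - v)\<bar> \<le> e * norm (w - v)" .
    then show ?thesis using 1 by (simp add: inner_diff_left inner_diff_right inner_commute abs_if split: if_splits)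
  qed
  then show "\<exists>d>0. \<forall>w. norm (w - v) < d \<longrightarrow> norm (w \<bullet> foot w - v \<bullet> foot v - foot v \<bullet> (w - v)) \<le> e * norm (w - v)"
    using d(1) by blast
qed

lemma normalize_has_derivative:
  assumes "v \<noteq> (0::real^'n)"
  shows "((\<lambda>w. w /\<^sub>R norm w) has_derivative (\<lambda>h. (h - ((v /\<^sub>R norm v) \<bullet> h) *\<^sub>R (v /\<^sub>R norm v)) /\<^sub>R norm v)) (at v)"
  using normalized_has_derivative[of "\<lambda>w. w" "\<lambda>h. h" v] assms by simp

text \<open>The Gauss map sends \<open>foot w\<close> to \<open>w / norm w\<close>, but it lives on a hypersurface. Adding the defining function in the normal
direction extends it to a map \<open>E\<close> of a neighbourhood with the same values on the boundary and with an injective derivative.\<close>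

lemma foot_differentiable:
  assumes v: "v \<noteq> 0"
  obtains B where "(foot has_derivative B) (at v)"
proof -
  define q where "q = foot v"
  have qf: "q \<in> frontier K" unfolding q_def by (rule foot_frontier[OF v])
  obtain U f g H where ch: "q \<in> U" "oriented_chart U f g H" using ex_oriented_chart[OF qf] by blast
  note c = oriented_chartD(1)[OF ch(2)]
  note g0 = chartD(5)[OF c ch(1)]
  define n where "n = g q /\<^sub>R norm (g q)"
  have nn: "n \<bullet> n = 1" using g0 by (simp add: n_def dot_square_norm power2_eq_square)
  define E where "E = (\<lambda>x. g x /\<^sub>R norm (g x) + f x *\<^sub>R n)"
  define E' where "E' = (\<lambda>h. normal_derivative g H q h + (g q \<bullet> h) *\<^sub>R n)"
  have E: "(E has_derivative E') (at q)"
    unfolding E_def E'_def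
    using normalized_has_derivative[OF chartD(3)[OF c ch(1)] g0]
    by (intro has_derivative_add has_derivative_scaleR_left chartD(2)[OF c ch(1)])
      (simp add: normal_derivative_def Let_def)
  have lin: "linear E'" using E has_derivative_linear by blast
  have "inj E'"
    unfolding linear_injective_0[OF lin]
  proof (intro allI impI)
    fix h assume h: "E' h = 0"
    define y where "y = H q *v h"
    have "normal_derivative g H q h = (y - (n \<bullet> y) *\<^sub>R n) /\<^sub>R norm (g q)"
      by (simp add: normal_derivative_def Let_def n_def y_def)
    then have "normal_derivative g H q h \<bullet> n = 0"
      by (simp add: inner_diff_left nn inner_commute[of n y])
    then have "E' h \<bullet> n = g q \<bullet> h" by (simp add: E'_def inner_add_left nn)
    then have gh: "g q \<bullet> h = 0" using h by simp
    then have "normal_derivative g H q h = 0" using h by (simp add: E'_def)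
    moreover have "h \<bullet> N q = 0"
      using oriented_chartD(2)[OF ch(2) qf ch(1)] gh by (simp add: inner_commute)
    ultimately show "h = 0"
      using tangent_kernel_trivial[OF qf N_has_derivative[OF ch(2) qf ch(1)]] by blast
  qed
  moreover have "((\<lambda>w. E (foot w)) has_derivative (\<lambda>h. (h - ((v /\<^sub>R norm v) \<bullet> h) *\<^sub>R (v /\<^sub>R norm v)) /\<^sub>R norm v)) (at v)"
  proof -
    define V where "V = - {0} \<inter> foot -` U"
    have "open V"
      unfolding V_def by (rule continuous_open_preimage[OF continuous_on_foot _ chartD(1)[OF c]]) auto
    moreover have "v \<in> V" using v ch(1) by (simp add: V_def q_def)
    moreover have "w /\<^sub>R norm w = E (foot w)" if "w \<in> V" for w
    proof -
      have w: "w \<noteq> 0" "foot w \<in> U" using that by (auto simp: V_def)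
      then have "f (foot w) = 0" using foot_frontier chartD(6)[OF c] by blast
      moreover have "g (foot w) /\<^sub>R norm (g (foot w)) = w /\<^sub>R norm w"
        using oriented_chartD(2)[OF ch(2) foot_frontier[OF w(1)] w(2)] N_foot[OF w(1)] by simp
      ultimately show ?thesis by (simp add: E_def)
    qed
    ultimately show ?thesis
      by (rule has_derivative_transform_within_open[OF normalize_has_derivative[OF v]])
  qed
  ultimately show ?thesis
    using has_derivative_of_composition[OF isCont_foot[OF v], of E E'] E that unfolding q_def by blast
qed

end

section \<open>Curvature along a normal\<close>

context enclosed_curvature_body begin

lemma foot_derivative_selfadjoint:
  assumes v: "v \<noteq> 0" and B: "(foot has_derivative B) (at v)"
  shows "B a \<bullet> b = a \<bullet> B b"
  by (rule gradient_derivative_selfadjoint[of "- {0}" v "\<lambda>v. v \<bullet> foot v" foot])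
    (use v B support_function_has_derivative in auto)

text \<open>The function \<open>w \<mapsto> v \<bullet> foot w\<close> is minimal at \<open>w = v\<close>.\<close>

lemma foot_derivative_orthogonal:
  assumes v: "v \<noteq> 0" and B: "(foot has_derivative B) (at v)"
  shows "v \<bullet> B y = 0"
proof -
  have "((\<lambda>w. v \<bullet> foot w) has_derivative (\<lambda>h. v \<bullet> B h)) (at v)"
    by (rule has_derivative_inner_right[OF B])
  then have "(\<lambda>h. v \<bullet> B h) = (\<lambda>h. 0)"
    by (rule differential_zero_maxmin[of v UNIV, rotated 2]) (use foot_le foot_in_K in auto)
  then show ?thesis by metis
qed

lemma foot_derivative_radial:
  assumes v: "v \<noteq> 0" and B: "(foot has_derivative B) (at v)"
  shows "B v = 0"
  using foot_derivative_selfadjoint[OF v B, of v "B v"] foot_derivative_orthogonal[OF v B, of "B v"]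
  by simp

text \<open>Differentiate \<open>N (foot w) = w / norm w\<close> in the direction \<open>y\<close>: an eigenvector of \<open>D foot\<close> with eigenvalue \<open>-\<rho>\<close> is an eigenvector of
the Weingarten map with eigenvalue \<open>1 / (\<rho> * norm v)\<close>, and its centre of curvature is \<open>foot v + \<rho> v\<close>.\<close>

lemma foot_derivative_eigenvalue:
  assumes v: "v \<noteq> 0" and B: "(foot has_derivative B) (at v)"
    and y: "y \<noteq> 0" "B y = - \<rho> *\<^sub>R y" and \<rho>: "\<rho> \<noteq> 0"
  shows "\<rho> > 0" and "foot v + \<rho> *\<^sub>R v \<in> K"
proof -
  let ?q = "foot v" and ?u = "v /\<^sub>R norm v"
  have qf: "?q \<in> frontier K" by (rule foot_frontier[OF v])
  obtain U f g H where ch: "?q \<in> U" "oriented_chart U f g H" using ex_oriented_chart[OF qf] by blast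
  let ?D = "normal_derivative g H ?q"
  note D = N_has_derivative[OF ch(2) qf ch(1)]
  have lD: "linear ?D" by (rule linear_normal_derivative)
  have "v \<bullet> y = 0"
    using foot_derivative_orthogonal[OF v B, of y] y \<rho> by simp
  then have uy: "?u \<bullet> y = 0" by simp
  have im: "foot ` (- {0}) \<subseteq> frontier K" using foot_frontier by auto
  have vi: "at v within (- {0}) = at v" using v by (intro at_within_open) auto
  have "((\<lambda>w. N (foot w)) has_derivative (\<lambda>h. ?D (B h))) (at v within (- {0}))"
    using has_derivative_in_compose[of foot B v "- {0}" N ?D] B has_derivative_subset[OF D im]
    by (simp add: vi)
  then have "((\<lambda>w. N (foot w)) has_derivative (\<lambda>h. ?D (B h))) (at v)" by (simp only: vi)
  moreover have "((\<lambda>w. N (foot w)) has_derivative (\<lambda>h. (h - (?u \<bullet> h) *\<^sub>R ?u) /\<^sub>R norm v)) (at v)"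
    by (rule has_derivative_transform_within_open[OF normalize_has_derivative[OF v], of "- {0}"])
      (use v N_foot in auto)
  ultimately have "(\<lambda>h. ?D (B h)) = (\<lambda>h. (h - (?u \<bullet> h) *\<^sub>R ?u) /\<^sub>R norm v)"
    by (rule has_derivative_unique)
  then have "?D (B y) = (y - (?u \<bullet> y) *\<^sub>R ?u) /\<^sub>R norm v" by metis
  then have "- \<rho> *\<^sub>R ?D y = y /\<^sub>R norm v"
    unfolding y(2) linear_scale[OF lD] uy by simp
  then have "(1 / \<rho>) *\<^sub>R (- \<rho> *\<^sub>R ?D y) = (1 / \<rho>) *\<^sub>R (y /\<^sub>R norm v)" by simp
  then have eig: "- ?D y = (1 / (\<rho> * norm v)) *\<^sub>R y"
    using \<rho> by (simp add: divide_inverse mult.commute)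
  have "y \<bullet> N ?q = 0" using uy N_foot[OF v] by (simp add: inner_commute)
  then have "principal_curvature_at K ?q (1 / (\<rho> * norm v))"
    unfolding principal_curvature_at_def using D y(1) eig by blast
  then have "?q + (1 / (1 / (\<rho> * norm v))) *\<^sub>R N ?q \<in> K"
    using v \<rho> by (intro principal_curvature_centre[OF qf]) auto
  moreover have "(1 / (1 / (\<rho> * norm v))) *\<^sub>R N ?q = \<rho> *\<^sub>R v"
    using v by (simp add: N_foot[OF v])
  ultimately show in_K: "?q + \<rho> *\<^sub>R v \<in> K" by simp
  have "v \<bullet> ?q \<le> v \<bullet> (?q + \<rho> *\<^sub>R v)" by (rule foot_le[OF in_K])
  then have "0 \<le> \<rho> * (v \<bullet> v)" by (simp add: inner_add_right)
  moreover have "v \<bullet> v > 0" using v by simp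
  ultimately show "\<rho> > 0" using \<rho> by (simp add: zero_le_mult_iff)
qed

definition foot_derivative :: "real^'n \<Rightarrow> real^'n \<Rightarrow> real^'n" where
  "foot_derivative v = frechet_derivative foot (at v)"

lemma foot_has_derivative:
  assumes v: "v \<noteq> 0" shows "(foot has_derivative foot_derivative v) (at v)"
proof -
  obtain B where "(foot has_derivative B) (at v)" using foot_differentiable[OF v] by blast
  then have "foot differentiable (at v)" by (rule differentiableI)
  then show ?thesis unfolding foot_derivative_def by (simp only: frechet_derivative_works)
qed

text \<open>The map \<open>foot\<close> is homogeneous of degree \<open>0\<close>.\<close>

lemma foot_derivative_scale:
  assumes v: "v \<noteq> 0" and t: "t > 0"
  shows "foot_derivative (t *\<^sub>R v) h = (1 / t) *\<^sub>R foot_derivative v h"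
proof -
  have lin: "linear (foot_derivative v)"
    using foot_has_derivative[OF v] has_derivative_linear by blast
  have "((\<lambda>w. (1 / t) *\<^sub>R w) has_derivative (\<lambda>h. (1 / t) *\<^sub>R h)) (at (t *\<^sub>R v))"
    by (intro has_derivative_scaleR_right has_derivative_ident)
  moreover have "(foot has_derivative foot_derivative v) (at ((1 / t) *\<^sub>R (t *\<^sub>R v)))"
    using foot_has_derivative[OF v] t by simp
  ultimately have "((\<lambda>w. foot ((1 / t) *\<^sub>R w)) has_derivative (\<lambda>h. foot_derivative v ((1 / t) *\<^sub>R h))) (at (t *\<^sub>R v))"
    by (rule has_derivative_compose)
  then have "(foot has_derivative (\<lambda>h. foot_derivative v ((1 / t) *\<^sub>R h))) (at (t *\<^sub>R v))"
    by (rule has_derivative_transform_within_open[of _ _ _ UNIV "- {0}"])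
      (use v t foot_scale in auto)
  then have "foot_derivative (t *\<^sub>R v) = (\<lambda>h. foot_derivative v ((1 / t) *\<^sub>R h))"
    using v t by (intro has_derivative_unique[OF foot_has_derivative]) simp_all
  then show ?thesis by (simp only: linear_scale[OF lin])
qed

abbreviation normal_jacobian :: "real^'n \<Rightarrow> real" where
  "normal_jacobian v \<equiv> jacobian (\<lambda>h. foot_derivative v h + h)"

text \<open>In an orthonormal eigenbasis of \<open>D foot\<close> at \<open>v\<close>, the map \<open>D foot + id\<close> at \<open>t v\<close> has the eigenvalues \<open>1 - \<rho>\<^sub>i / t\<close>. One of the \<open>\<rho>\<^sub>i\<close> is zero
because \<open>D foot\<close> annihilates \<open>v\<close>; the index set \<open>I\<close> leaves it out.\<close>

lemma normal_jacobian_on_ray: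
  assumes v: "v \<noteq> 0"
  obtains I and \<rho> :: "'n \<Rightarrow> real" where "card I = CARD('n) - 1"
    "\<And>i. i \<in> I \<Longrightarrow> 0 \<le> \<rho> i \<and> foot v + \<rho> i *\<^sub>R v \<in> K"
    "\<And>t. t > 0 \<Longrightarrow> t ^ (CARD('n) - 1) * normal_jacobian (t *\<^sub>R v) = (\<Prod>i\<in>I. \<bar>t - \<rho> i\<bar>)"
proof -
  let ?B = "foot_derivative v"
  note B = foot_has_derivative[OF v]
  have lin: "linear ?B" using B has_derivative_linear by blast
  obtain e :: "'n \<Rightarrow> real^'n" and c where e: "orthonormal_family e" "\<And>i. ?B (e i) = c i *\<^sub>R e i"
    using selfadjoint_eigenbasis[OF lin foot_derivative_selfadjoint[OF v B]] by blast
  have "\<not> inj ?B"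
    using linear_injective_0[OF lin] foot_derivative_radial[OF v B] v by blast
  then have "(\<Prod>i\<in>UNIV. c i) = 0"
    using det_nz_iff_inj[OF lin] det_orthonormal_eigenbasis[OF lin e] by simp
  then obtain j where j: "c j = 0" by auto
  let ?I = "UNIV - {j}"
  have card: "card ?I = CARD('n) - 1" by simp
  moreover have "0 \<le> - c i \<and> foot v + (- c i) *\<^sub>R v \<in> K" for i
  proof (cases "c i = 0")
    case True then show ?thesis using foot_in_K by simp
  next
    case False
    have "norm (e i) = 1" using e(1) by (simp add: orthonormal_family_def norm_eq_1)
    then have "e i \<noteq> 0" by auto
    then show ?thesis
      using foot_derivative_eigenvalue[OF v B, of "e i" "- c i"] e(2)[of i] False by simp
  qed
  moreover have "t ^ (CARD('n) - 1) * normal_jacobian (t *\<^sub>R v) = (\<Prod>i\<in>?I. \<bar>t - (- c i)\<bar>)" if t: "t > 0" for t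
  proof -
    let ?L = "\<lambda>h. foot_derivative (t *\<^sub>R v) h + h"
    have L: "?L = (\<lambda>h. (1 / t) *\<^sub>R ?B h + h)" using foot_derivative_scale[OF v t] by auto
    have "linear ?L"
      unfolding L by (rule linearI) (simp_all add: linear_add[OF lin] linear_scale[OF lin] algebra_simps)
    moreover have "?L (e i) = (c i / t + 1) *\<^sub>R e i" for i
      by (simp add: foot_derivative_scale[OF v t] e(2) scaleR_add_left)
    ultimately have "normal_jacobian (t *\<^sub>R v) = (\<Prod>i\<in>UNIV. \<bar>c i / t + 1\<bar>)"
      by (rule jacobian_orthonormal_eigenbasis[OF _ e(1)])
    also have "\<dots> = \<bar>c j / t + 1\<bar> * (\<Prod>i\<in>?I. \<bar>c i / t + 1\<bar>)"
      by (rule prod.remove) auto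
    also have "\<dots> = (\<Prod>i\<in>?I. \<bar>t - (- c i)\<bar> / t)"
    proof -
      have "\<bar>c i / t + 1\<bar> = \<bar>t - (- c i)\<bar> / t" for i
      proof -
        have "c i / t + 1 = (t - (- c i)) / t" using t by (simp add: add_divide_distrib)
        then show ?thesis using t by (simp only: abs_divide abs_of_pos)
      qed
      then show ?thesis by (simp add: j)
    qed
    also have "\<dots> = (\<Prod>i\<in>?I. \<bar>t - (- c i)\<bar>) / t ^ (CARD('n) - 1)"
      unfolding prod_dividef prod_constant card by simp
    finally show ?thesis using t by simp
  qed
  ultimately show ?thesis by (intro that[of ?I "\<lambda>i. - c i"]) auto
qed

text \<open>The vectors that lead from a boundary point along its inner normal to another point of \<open>K\<close>.\<close>

definition inward_normals :: "(real^'n) set" where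
  "inward_normals = {v. v \<noteq> 0 \<and> foot v + v \<in> K}"

lemma chord_interval:
  assumes v: "v \<noteq> 0"
  obtains l where "0 \<le> l" "\<And>t. 0 \<le> t \<Longrightarrow> foot v + t *\<^sub>R v \<in> K \<longleftrightarrow> t \<le> l"
    "\<And>t. 0 < t \<Longrightarrow> t *\<^sub>R v \<in> inward_normals \<longleftrightarrow> t \<le> l"
proof -
  define T where "T = {t. 0 \<le> t \<and> foot v + t *\<^sub>R v \<in> K}"
  obtain b where b: "\<And>x. x \<in> K \<Longrightarrow> norm x \<le> b" using compact_imp_bounded[OF compact_K] bounded_iff by blast
  have nv: "norm v > 0" using v by simp
  have "t \<le> 2 * b / norm v" if "t \<in> T" for t
  proof -
    have "norm (t *\<^sub>R v) \<le> norm (foot v + t *\<^sub>R v) + norm (foot v)"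
      using norm_triangle_ineq4[of "foot v + t *\<^sub>R v" "foot v"] by simp
    also have "\<dots> \<le> b + b" using that foot_in_K by (intro add_mono b) (auto simp: T_def)
    finally show ?thesis using that nv by (simp add: T_def le_divide_eq)
  qed
  then have "bounded T"
    by (intro boundedI[of _ "2 * b / norm v"]) (auto simp: T_def)
  moreover have "closed T"
  proof -
    have "T = {0..} \<inter> (\<lambda>t. foot v + t *\<^sub>R v) -` K" by (auto simp: T_def)
    moreover have "closed ((\<lambda>t. foot v + t *\<^sub>R v) -` K)"
      by (rule closed_vimage[OF closed_K]) (intro continuous_intros)
    ultimately show ?thesis by auto
  qed
  ultimately have "compact T" by (simp add: compact_eq_bounded_closed)
  moreover have zero: "0 \<in> T" using foot_in_K by (simp add: T_def)
  ultimately obtain l where l: "l \<in> T" "\<And>t. t \<in> T \<Longrightarrow> t \<le> l"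
    using compact_attains_sup[of T] by blast
  have iff: "foot v + t *\<^sub>R v \<in> K \<longleftrightarrow> t \<le> l" if "0 \<le> t" for t
  proof
    assume "foot v + t *\<^sub>R v \<in> K" then show "t \<le> l" using l(2) that by (simp add: T_def)
  next
    assume tl: "t \<le> l"
    show "foot v + t *\<^sub>R v \<in> K"
    proof (cases "l = 0")
      case True then show ?thesis using tl that foot_in_K by simp
    next
      case False
      then have lpos: "l > 0" using l(1) by (simp add: T_def)
      have "foot v + t *\<^sub>R v = (1 - t / l) *\<^sub>R foot v + (t / l) *\<^sub>R (foot v + l *\<^sub>R v)"
        using lpos by (simp add: algebra_simps)
      moreover have "\<dots> \<in> K"
        using that tl lpos l(1) foot_in_K by (intro convexD[OF convex_K]) (auto simp: T_def)
      ultimately show ?thesis by simp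
    qed
  qed
  have "0 \<le> l" using l(2)[OF zero] .
  moreover have "t *\<^sub>R v \<in> inward_normals \<longleftrightarrow> t \<le> l" if "0 < t" for t
    using that v foot_scale[OF v that] iff[of t] by (simp add: inward_normals_def)
  ultimately show ?thesis using iff that by blast
qed

end

section \<open>Counting normals\<close>

lemma emeasure_count_space_image_le:
  assumes "X \<subseteq> f ` Y"
  shows "emeasure (count_space UNIV) X \<le> emeasure (count_space UNIV) Y"
proof (cases "finite Y")
  case True
  then have "finite X" "card X \<le> card Y"
    using assms by (auto intro: finite_subset surj_card_le)
  then show ?thesis using True by (simp add: emeasure_count_space of_nat_mono)
next
  case False then show ?thesis by (simp add: emeasure_count_space)
qed

context enclosed_curvature_body begin

lemma borel_measurable_foot [measurable]: "foot \<in> borel_measurable borel"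
proof -
  have "(\<lambda>v. indicator (- {0}) v *\<^sub>R foot v) \<in> borel_measurable borel"
    by (rule borel_measurable_continuous_on_indicator[OF _ continuous_on_foot]) simp
  then have "(\<lambda>v. if v = 0 then foot 0 else indicator (- {0}) v *\<^sub>R foot v) \<in> borel_measurable borel"
    by measurable
  also have "(\<lambda>v. if v = 0 then foot 0 else indicator (- {0}) v *\<^sub>R foot v) = foot"
    by (auto simp: fun_eq_iff)
  finally show ?thesis .
qed

lemma inward_normals_borel [measurable]: "inward_normals \<in> sets borel"
proof -
  have [measurable]: "K \<in> sets borel" using closed_K by simp
  have "inward_normals = {v \<in> space borel. v \<noteq> 0 \<and> foot v + v \<in> K}"
    by (simp add: inward_normals_def)
  also have "\<dots> \<in> sets borel" by measurable
  finally show ?thesis .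
qed

text \<open>A derivative is a pointwise limit of difference quotients.\<close>

lemma borel_measurable_foot_derivative:
  "(\<lambda>v. if v = 0 then 0 else foot_derivative v h $ i) \<in> borel_measurable borel"
proof (rule borel_measurable_LIMSEQ_real)
  let ?\<epsilon> = "\<lambda>k::nat. inverse (real (Suc k))"
  fix v :: "real^'n"
  show "(\<lambda>k. if v = 0 then 0 else ((foot (v + ?\<epsilon> k *\<^sub>R h) - foot v) /\<^sub>R ?\<epsilon> k) $ i)
    \<longlonglongrightarrow> (if v = 0 then 0 else foot_derivative v h $ i)"
  proof (cases "v = 0")
    case False
    have "(\<lambda>k. (v + ?\<epsilon> k *\<^sub>R h - v) /\<^sub>R ?\<epsilon> k) = (\<lambda>k. h)" by (simp add: fun_eq_iff)
    then have lim: "(\<lambda>k. (foot (v + ?\<epsilon> k *\<^sub>R h) - foot v) /\<^sub>R ?\<epsilon> k) \<longlonglongrightarrow> foot_derivative v h"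
      by (intro directional_limit_within[OF foot_has_derivative[OF False]] LIMSEQ_inverse_real_of_nat) simp_all
    show ?thesis unfolding if_not_P[OF False] by (rule tendsto_vec_nth[OF lim])
  qed simp
next
  have [measurable]: "(\<lambda>x :: real^'n. x $ i) \<in> borel_measurable borel"
    by (intro borel_measurable_continuous_onI continuous_intros)
  show "(\<lambda>v. if v = 0 then 0 else ((foot (v + inverse (real (Suc k)) *\<^sub>R h) - foot v) /\<^sub>R inverse (real (Suc k))) $ i)
      \<in> borel_measurable borel" for k
    by measurable
qed

lemma borel_measurable_normal_jacobian:
  "(\<lambda>v. normal_jacobian v * indicator inward_normals v) \<in> borel_measurable borel"
proof -
  define d where "d = (\<lambda>h i v. if v = 0 then 0 else foot_derivative v h $ i)"
  have [measurable]: "d h i \<in> borel_measurable borel" for h i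
    unfolding d_def by (rule borel_measurable_foot_derivative)
  have "(\<lambda>v. normal_jacobian v * indicator inward_normals v) =
    (\<lambda>v. \<bar>det (\<chi> i j. d (axis (Rep_ordered_copy j) 1) (Rep_ordered_copy i) v
        + axis (Rep_ordered_copy j) 1 $ Rep_ordered_copy i)\<bar> * indicator inward_normals v)"
  proof
    fix v
    show "normal_jacobian v * indicator inward_normals v =
      \<bar>det (\<chi> i j. d (axis (Rep_ordered_copy j) 1) (Rep_ordered_copy i) v
        + axis (Rep_ordered_copy j) 1 $ Rep_ordered_copy i)\<bar> * indicator inward_normals v"
    proof (cases "v \<in> inward_normals")
      case True
      then have "v \<noteq> 0" by (simp add: inward_normals_def)
      then show ?thesis by (simp add: jacobian_entries d_def)
    qed simp
  qed
  also have "\<dots> \<in> borel_measurable borel"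
    unfolding det_def vec_lambda_beta by measurable
  finally show ?thesis .
qed

text \<open>On this ray the set \<open>inward_normals\<close> is the interval \<open>0 < s \<le> l\<close> and all \<open>\<rho>\<^sub>i\<close> lie in \<open>{0..l}\<close>, so the
estimate for the integral of a product of distances applies.\<close>

lemma normal_jacobian_ray_le:
  assumes v: "v \<noteq> 0"
  shows "(\<integral>\<^sup>+s. ennreal (s ^ (CARD('n) - 1)) * (ennreal (normal_jacobian (s *\<^sub>R v)) * indicator inward_normals (s *\<^sub>R v))
      * indicator {0<..} s \<partial>lborel) \<le>
    (\<integral>\<^sup>+s. ennreal (s ^ (CARD('n) - 1)) * indicator inward_normals (s *\<^sub>R v) * indicator {0<..} s \<partial>lborel)"
proof -
  obtain l where l: "0 \<le> l" "\<And>t. 0 \<le> t \<Longrightarrow> foot v + t *\<^sub>R v \<in> K \<longleftrightarrow> t \<le> l"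
    "\<And>t. 0 < t \<Longrightarrow> t *\<^sub>R v \<in> inward_normals \<longleftrightarrow> t \<le> l"
    using chord_interval[OF v] by blast
  obtain I and \<rho> :: "'n \<Rightarrow> real" where I: "card I = CARD('n) - 1"
    "\<And>i. i \<in> I \<Longrightarrow> 0 \<le> \<rho> i \<and> foot v + \<rho> i *\<^sub>R v \<in> K"
    "\<And>t. t > 0 \<Longrightarrow> t ^ (CARD('n) - 1) * normal_jacobian (t *\<^sub>R v) = (\<Prod>i\<in>I. \<bar>t - \<rho> i\<bar>)"
    using normal_jacobian_on_ray[OF v] by blast
  have fin: "finite I" by simp
  have ne: "I \<noteq> {}" using I(1) dim by auto
  have \<rho>: "0 \<le> \<rho> i \<and> \<rho> i \<le> l" if "i \<in> I" for i using I(2)[OF that] l(2)[of "\<rho> i"] by blast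
  have "(\<integral>\<^sup>+s. ennreal (s ^ (CARD('n) - 1)) * (ennreal (normal_jacobian (s *\<^sub>R v)) * indicator inward_normals (s *\<^sub>R v))
      * indicator {0<..} s \<partial>lborel) \<le> (\<integral>\<^sup>+s. ennreal (\<Prod>i\<in>I. \<bar>s - \<rho> i\<bar>) * indicator {0..l} s \<partial>lborel)"
  proof (rule nn_integral_mono)
    fix s :: real
    show "ennreal (s ^ (CARD('n) - 1)) * (ennreal (normal_jacobian (s *\<^sub>R v)) * indicator inward_normals (s *\<^sub>R v))
      * indicator {0<..} s \<le> ennreal (\<Prod>i\<in>I. \<bar>s - \<rho> i\<bar>) * indicator {0..l} s"
    proof (cases "0 < s \<and> s \<le> l")
      case True
      then have "ennreal (s ^ (CARD('n) - 1)) * ennreal (normal_jacobian (s *\<^sub>R v)) = ennreal (\<Prod>i\<in>I. \<bar>s - \<rho> i\<bar>)"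
        using I(3)[of s] by (subst ennreal_mult'[symmetric]) auto
      then show ?thesis using True l(3)[of s] by (simp add: indicator_def)
    next
      case False
      then show ?thesis using l(3)[of s] by (auto simp: indicator_def)
    qed
  qed
  also have "\<dots> \<le> (\<integral>\<^sup>+s. ennreal (s ^ card I) * indicator {0..l} s \<partial>lborel)"
    by (rule nn_integral_prod_abs_diff_le[OF fin ne \<rho>])
  also have "\<dots> = (\<integral>\<^sup>+s. ennreal (s ^ (CARD('n) - 1)) * indicator inward_normals (s *\<^sub>R v) * indicator {0<..} s \<partial>lborel)"
  proof (intro nn_integral_cong_AE eventually_mono[OF AE_lborel_singleton[of 0]])
    fix s :: real assume "s \<noteq> 0"
    then show "ennreal (s ^ card I) * indicator {0..l} s =
      ennreal (s ^ (CARD('n) - 1)) * indicator inward_normals (s *\<^sub>R v) * indicator {0<..} s"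
      unfolding I(1) using l(3)[of s] by (cases "s > 0") (auto simp: indicator_def)
  qed
  finally show ?thesis .
qed

lemma inward_normals_subset: "inward_normals \<subseteq> difference_body K"
proof
  fix v assume "v \<in> inward_normals"
  then have "v = (foot v + v) - foot v" "foot v + v \<in> K" by (auto simp: inward_normals_def)
  then show "v \<in> difference_body K" unfolding difference_body_def using foot_in_K by blast
qed

lemma difference_body_borel: "difference_body K \<in> sets borel"
  and difference_body_finite: "emeasure lborel (difference_body K) < \<infinity>"
proof -
  have "compact (difference_body K)"
    unfolding difference_body_def by (rule compact_differences[OF compact_K compact_K])
  then show "difference_body K \<in> sets borel" "emeasure lborel (difference_body K) < \<infinity>"
    by (rule borel_compact, rule emeasure_compact_finite)
qed

lemma normal_jacobian_integral_le:
  "(\<integral>\<^sup>+v. ennreal (normal_jacobian v) * indicator inward_normals v \<partial>lborel) \<le>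
    emeasure lborel (difference_body K)"
proof -
  have "(\<lambda>v. ennreal (normal_jacobian v) * indicator inward_normals v) =
      (\<lambda>v. ennreal (normal_jacobian v * indicator inward_normals v))"
    by (auto simp: indicator_def)
  then have J: "(\<lambda>v. ennreal (normal_jacobian v) * indicator inward_normals v) \<in> borel_measurable borel"
    using borel_measurable_normal_jacobian by simp
  have "(\<integral>\<^sup>+v. ennreal (normal_jacobian v) * indicator inward_normals v \<partial>lborel) \<le>
      (\<integral>\<^sup>+v. indicator inward_normals v \<partial>lborel)"
    using normal_jacobian_ray_le by (intro nn_integral_le_by_rays[OF J]) simp_all
  also have "\<dots> = emeasure lborel inward_normals" by simp
  also have "\<dots> \<le> emeasure lborel (difference_body K)"
    using inward_normals_subset difference_body_borel by (intro emeasure_mono) auto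
  finally show ?thesis .
qed

text \<open>Through an interior point \<open>p\<close>, a normal that starts at \<open>q\<close> is recovered from \<open>v = p - q\<close>. As \<open>p\<close> is not on the boundary, \<open>v \<noteq> 0\<close>, and \<open>v\<close> is an inner
normal vector at \<open>q\<close>.\<close>

lemma normal_count_le:
  assumes p: "p \<in> interior K"
  shows "normal_count K p \<le> emeasure (count_space UNIV) {v \<in> inward_normals. foot v + v = p}"
  unfolding normal_count_def
proof (rule emeasure_count_space_image_le[of _ "\<lambda>v. (p - v, range (\<lambda>t. (p - v) + t *\<^sub>R v))"], safe)
  fix q L assume L: "is_normal_at K q L" "p \<in> L"
  then obtain u where qf: "q \<in> frontier K" and u: "u \<noteq> 0" "\<And>x. x \<in> K \<Longrightarrow> u \<bullet> x \<le> u \<bullet> q"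
    and Lu: "L = range (\<lambda>t. q + t *\<^sub>R u)"
    unfolding is_normal_at_def by blast
  obtain t where t: "p = q + t *\<^sub>R u" using L(2) Lu by auto
  define v where "v = t *\<^sub>R u"
  have "supports (- u) q" using u(2) by (simp add: supports_def)
  then have "(- u) \<bullet> q < (- u) \<bullet> p" using supports_strict[OF p, of "- u" q] u(1) by simp
  then have "t * (u \<bullet> u) < 0" by (simp add: t inner_add_right)
  moreover have "u \<bullet> u > 0" using u(1) by simp
  ultimately have tneg: "t < 0" by (simp add: mult_less_0_iff)
  have v0: "v \<noteq> 0" using tneg u(1) by (simp add: v_def)
  have qK: "q \<in> K" using qf frontier_subset_K by blast
  have "supports v q"
    unfolding supports_def v_def using u(2) tneg by (auto intro: mult_left_mono_neg)
  then have foot: "foot v = q" by (intro foot_eqI v0 qK)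
  have pv: "p - v = q" "q + v = p" by (simp_all add: t v_def)
  have "v \<in> inward_normals" using v0 foot pv p interior_subset by (auto simp: inward_normals_def)
  moreover have "L = range (\<lambda>s. q + s *\<^sub>R v)"
  proof -
    have "q + s *\<^sub>R u = q + (s / t) *\<^sub>R v" "q + s *\<^sub>R v = q + (s * t) *\<^sub>R u" for s
      using tneg by (simp_all add: v_def)
    then show ?thesis unfolding Lu by (metis (no_types, lifting) image_subset_iff rangeI subset_antisym)
  qed
  ultimately show "(q, L) \<in> (\<lambda>v. (p - v, range (\<lambda>t. (p - v) + t *\<^sub>R v))) ` {v \<in> inward_normals. foot v + v = p}"
    using pv foot by (intro image_eqI[of _ _ v]) auto
qed

text \<open>Boundary points of \<open>K\<close> may be neglected, because the boundary of a convex set has measure zero.\<close>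

lemma normal_integral_le: "normal_integral K \<le> emeasure lborel (difference_body K)"
proof -
  have "AE p in lebesgue. p \<notin> frontier K"
    using negligible_convex_frontier[OF convex_K] by (simp add: negligible_iff_null_sets AE_not_in)
  then have "normal_integral K \<le> (\<integral>\<^sup>+p. emeasure (count_space UNIV) {v \<in> inward_normals. foot v + v = p} \<partial>lebesgue)"
    unfolding normal_integral_def
  proof (intro nn_integral_mono_AE, elim eventually_mono)
    fix p assume "p \<notin> frontier K"
    then have "p \<in> K \<Longrightarrow> p \<in> interior K" using closed_K by (simp add: frontier_def)
    then show "normal_count K p * indicator K p \<le> emeasure (count_space UNIV) {v \<in> inward_normals. foot v + v = p}"
      using normal_count_le by (cases "p \<in> K") auto
  qed
  also have "\<dots> \<le> (\<integral>\<^sup>+v. ennreal (normal_jacobian v) * indicator inward_normals v \<partial>lborel)"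
  proof (rule nn_integral_multiplicity_le)
    show "inward_normals \<in> sets borel" by measurable
    show "(\<lambda>v. normal_jacobian v * indicator inward_normals v) \<in> borel_measurable borel"
      by (rule borel_measurable_normal_jacobian)
    show "(\<integral>\<^sup>+v. ennreal (normal_jacobian v) * indicator inward_normals v \<partial>lborel) < \<infinity>"
      using normal_jacobian_integral_le difference_body_finite by (rule le_less_trans)
    fix v assume "v \<in> inward_normals"
    then have "v \<noteq> 0" by (simp add: inward_normals_def)
    then show "((\<lambda>v. foot v + v) has_derivative (\<lambda>h. foot_derivative v h + h)) (at v within inward_normals)"
      by (rule has_derivative_at_withinI[OF has_derivative_add[OF foot_has_derivative has_derivative_ident]])
  qed
  also have "\<dots> \<le> emeasure lborel (difference_body K)" by (rule normal_jacobian_integral_le)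
  finally show ?thesis .
qed

end

theorem theorem3:
  fixes K :: "(real^'n) set"
  assumes "CARD('n) \<ge> 2"
    and "convex_body K"
    and "C2_boundary K"
    and "centres_of_curvature K \<subseteq> K"
  shows "normal_integral K \<le> emeasure lebesgue (difference_body K) \<and>
         mean_normal_count K \<le> of_nat ((2 * CARD('n)) choose CARD('n))"
proof
  interpret enclosed_curvature_body K
    by (unfold_locales; rule assms)
  let ?C = "of_nat ((2 * CARD('n)) choose CARD('n)) :: ennreal"
  show le: "normal_integral K \<le> emeasure lebesgue (difference_body K)"
    using normal_integral_le difference_body_borel by simp
  have K_borel: "K \<in> sets borel" using closed_K by simp
  have pos: "emeasure lborel K \<noteq> 0"
  proof
    assume "emeasure lborel K = 0"
    moreover have "emeasure lborel (interior K) \<le> emeasure lborel K"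
      using K_borel interior_subset by (intro emeasure_mono) auto
    ultimately have "negligible (interior K)"
      by (simp add: negligible_iff_null_sets null_sets_def)
    then show False
      using open_not_negligible[OF open_interior interior_nonempty] by blast
  qed
  have fin: "emeasure lborel K < \<infinity>" using compact_K by (rule emeasure_compact_finite)
  have "emeasure lborel (difference_body K) \<le> ?C * emeasure lborel K"
    using Rogers_Shephard[OF compact_K convex_K pos] by (simp add: difference_body_def)
  then have "normal_integral K \<le> ?C * emeasure lborel K"
    using normal_integral_le by (rule order_trans[rotated])
  then have "normal_integral K / emeasure lborel K \<le> ?C * emeasure lborel K / emeasure lborel K"
    by (rule divide_right_mono_ennreal)
  also have "\<dots> = ?C" using pos fin by (simp add: ennreal_mult_divide_eq)
  finally show "mean_normal_count K \<le> ?C"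
    using K_borel by (simp add: mean_normal_count_def)
qed

end
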